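(* Let $k$ be a field, let $E$ and $W$ be $k$-vector spaces of dimensions $r$ and $s$, let $\mathcal V=\operatorname{Hom}_k(E^{\otimes3},W)$ and let $\mathcal V^{\mathrm{surj}}\subseteq\mathcal V$ be the Zariski-open subset of surjective tensors. For integers $a,b$, the subsets $$\mathcal X_{a,b}=\{\mu\in\mathcal V^{\mathrm{surj}}:\operatorname{rank}\Theta_\mu\le a,\ \operatorname{rank}B_\mu\le b\}$$ are closed in $\mathcal V^{\mathrm{surj}}$ and stable under the natural action of $\mathrm{GL}(E)\times\mathrm{GL}(W)$. The function $$\delta(\mu)=\dim_k\mathfrak D(T_\mu,k)=r^2-\operatorname{rank}\Theta_\mu+2rs-\operatorname{rank}B_\mu$$ is upper semicontinuous. Consequently, every irreducible component of $\mathcal V^{\mathrm{surj}}$ contains a dense open subset on which the defect dimension is minimal and constant.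
   Context: All tensor products are over $k$, and $\mathcal V$ carries the Zariski topology. For $\mu\in\mathcal V$ define $\Theta_\mu:E\otimes E\to\operatorname{Hom}_k(E,W)$ by $\Theta_\mu(a\otimes b)(c)=\mu(a,b,c)$, and $B_\mu:E^{\otimes4}\to(W\otimes E)\oplus(E\otimes W)$ by $B_\mu(a\otimes b\otimes c\otimes d)=\mu(a,b,c)\otimes d-a\otimes\mu(b,c,d)$. For $\mu\in\mathcal V^{\mathrm{surj}}$, $T_\mu=E\oplus W$ with $\Gamma=k$ and ternary product $(x+u)\,n\,(y+v)\,m\,(z+w)=nm\,\mu(x,y,z)$ ($x,y,z\in E$; $u,v,w\in W$; $n,m\in k$). The operator rng $\mathcal O_k(T,\Gamma)$ is the quotient of $T\otimes_k\Gamma\otimes_kT\otimes_k\Gamma$, with multiplication $(a\otimes\alpha\otimes b\otimes\beta)(c\otimes\gamma\otimes d\otimes\delta)=(a\alpha b\beta c)\otimes\gamma\otimes d\otimes\delta$, by the two-sided ideal generated by all $(a\alpha b\beta c)\otimes\gamma\otimes d\otimes\delta-a\otimes\alpha\otimes(b\beta c\gamma d)\otimes\delta$. The operator defect $\mathfrak D(T_\mu,k)$ is the kernel of the regular representation $\mathcal O_k(T_\mu,k)\to\operatorname{End}_k(T_\mu)$, $[a,\alpha,b,\beta]\mapsto(x\mapsto a\alpha b\beta x)$. A function $\delta$ is upper semicontinuous if each set $\{\delta\ge n\}$ is closed. *)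

theory Defs
  imports
    "Jordan_Normal_Form.VS_Connect"
    "HOL-Algebra.QuotRing"
    "HOL-Library.Poly_Mapping"
    "HOL-Analysis.Abstract_Topology"
begin

text \<open>
  Vector spaces over the field \<open>'k\<close> are module records \<open>V\<close> with \<open>vectorspace class_ring V\<close>.
  The record fields \<open>mult\<close> and \<open>one\<close> of a vector space carry no information, except where an
  algebra is meant explicitly.
\<close>

section \<open>Linear algebra\<close>

definition field_vs :: "('k::field, 'k) module" where
  "field_vs = \<lparr>carrier = UNIV, mult = (*), one = 1, zero = 0, add = (+), smult = (*)\<rparr>"

text \<open>Homomorphisms are taken extensional (undefined off the carrier), so that equality in
  \<open>hom_vs M N\<close> is equality of maps on the carrier of \<open>M\<close>.\<close>

definition hom_vs ::
  "('k::field, 'm) module \<Rightarrow> ('k, 'n) module \<Rightarrow> ('k, 'm \<Rightarrow> 'n) module" where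
  "hom_vs M N =
     \<lparr>carrier = {f \<in> extensional (carrier M). f \<in> LinearCombinations.module_hom class_ring M N},
      mult = (\<lambda>f g. \<lambda>x\<in>carrier M. \<zero>\<^bsub>N\<^esub>),
      one = (\<lambda>x\<in>carrier M. \<zero>\<^bsub>N\<^esub>),
      zero = (\<lambda>x\<in>carrier M. \<zero>\<^bsub>N\<^esub>),
      add = (\<lambda>f g. \<lambda>x\<in>carrier M. f x \<oplus>\<^bsub>N\<^esub> g x),
      smult = (\<lambda>c f. \<lambda>x\<in>carrier M. c \<odot>\<^bsub>N\<^esub> f x)\<rparr>"

definition rank_of ::
  "('k::field, 'm) module \<Rightarrow> ('k, 'n) module \<Rightarrow> ('m \<Rightarrow> 'n) \<Rightarrow> nat" where
  "rank_of M N f = vectorspace.dim class_ring (N\<lparr>carrier := f ` carrier M\<rparr>)"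

definition GL_vs :: "('k::field, 'v) module \<Rightarrow> ('v \<Rightarrow> 'v) set" where
  "GL_vs V = {g \<in> carrier (hom_vs V V). bij_betw g (carrier V) (carrier V)}"

text \<open>The factor ring construction \<open>V Quot N\<close> of HOL-Algebra, together with the induced scalar
  multiplication \<open>c \<odot> (N +> x) = N +> c \<odot> x\<close>; the summand \<open>N\<close> is what makes this a coset for
  \<open>c = 0\<close>.\<close>

definition quotient_vs :: "('k::field, 'v) module \<Rightarrow> 'v set \<Rightarrow> ('k, 'v set) module" where
  "quotient_vs V N =
     \<lparr>carrier = a_rcosets\<^bsub>V\<^esub> N, mult = rcoset_mult V N, one = N +>\<^bsub>V\<^esub> \<one>\<^bsub>V\<^esub>,
      zero = N, add = set_add V,
      smult = (\<lambda>c X. N <+>\<^bsub>V\<^esub> ((\<lambda>x. c \<odot>\<^bsub>V\<^esub> x) ` X))\<rparr>"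


section \<open>Tensor products\<close>

definition free_vs :: "'x set \<Rightarrow> ('k::field, 'x \<Rightarrow>\<^sub>0 'k) module" where
  "free_vs S =
     \<lparr>carrier = {f. Poly_Mapping.keys f \<subseteq> S}, mult = (\<lambda>f g. 0), one = 0, zero = 0, add = (+),
      smult = (\<lambda>c f. Poly_Mapping.map ((*) c) f)\<rparr>"

definition bilinear_relations ::
  "('k::field, 'm) module \<Rightarrow> ('k, 'n) module \<Rightarrow> ('m \<times> 'n \<Rightarrow>\<^sub>0 'k) set" where
  "bilinear_relations M N =
     {Poly_Mapping.single (x \<oplus>\<^bsub>M\<^esub> x', y) 1 - Poly_Mapping.single (x, y) 1
        - Poly_Mapping.single (x', y) 1 | x x' y.
        x \<in> carrier M \<and> x' \<in> carrier M \<and> y \<in> carrier N} \<union>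
     {Poly_Mapping.single (x, y \<oplus>\<^bsub>N\<^esub> y') 1 - Poly_Mapping.single (x, y) 1
        - Poly_Mapping.single (x, y') 1 | x y y'.
        x \<in> carrier M \<and> y \<in> carrier N \<and> y' \<in> carrier N} \<union>
     {Poly_Mapping.single (c \<odot>\<^bsub>M\<^esub> x, y) 1 - Poly_Mapping.single (x, y) c | c x y.
        x \<in> carrier M \<and> y \<in> carrier N} \<union>
     {Poly_Mapping.single (x, c \<odot>\<^bsub>N\<^esub> y) 1 - Poly_Mapping.single (x, y) c | c x y.
        x \<in> carrier M \<and> y \<in> carrier N}"

definition tensor_null ::
  "('k::field, 'm) module \<Rightarrow> ('k, 'n) module \<Rightarrow> ('m \<times> 'n \<Rightarrow>\<^sub>0 'k) set" where
  "tensor_null M N =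
     LinearCombinations.module.span class_ring (free_vs (carrier M \<times> carrier N))
       (bilinear_relations M N)"

definition tensor ::
  "('k::field, 'm) module \<Rightarrow> ('k, 'n) module \<Rightarrow> ('k, ('m \<times> 'n \<Rightarrow>\<^sub>0 'k) set) module"
  where
  "tensor M N = quotient_vs (free_vs (carrier M \<times> carrier N)) (tensor_null M N)"

definition tens ::
  "('k::field, 'm) module \<Rightarrow> ('k, 'n) module \<Rightarrow> 'm \<Rightarrow> 'n \<Rightarrow> ('m \<times> 'n \<Rightarrow>\<^sub>0 'k) set" where
  "tens M N x y =
     tensor_null M N +>\<^bsub>free_vs (carrier M \<times> carrier N)\<^esub> Poly_Mapping.single (x, y) 1"

text \<open>Iterated tensor products are bracketed to the left.\<close>

abbreviation tensor3 where
  "tensor3 L M N \<equiv> tensor (tensor L M) N"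

abbreviation tens3 where
  "tens3 L M N x y z \<equiv> tens (tensor L M) N (tens L M x y) z"

abbreviation tensor4 where
  "tensor4 L M N P \<equiv> tensor (tensor3 L M N) P"

abbreviation tens4 where
  "tens4 L M N P x y z w \<equiv> tens (tensor3 L M N) P (tens3 L M N x y z) w"


section \<open>Zariski topology, irreducible components, semicontinuity\<close>

text \<open>The polynomial functions on a finite-dimensional vector space: the algebra of functions
  generated by the constants and the linear forms.\<close>

inductive_set poly_funs :: "('k::field, 'v) module \<Rightarrow> ('v \<Rightarrow> 'k) set"
  for V :: "('k, 'v) module" where
  const: "(\<lambda>v. c) \<in> poly_funs V"
| linear: "f \<in> LinearCombinations.module_hom class_ring V field_vs \<Longrightarrow> f \<in> poly_funs V"
| add: "f \<in> poly_funs V \<Longrightarrow> g \<in> poly_funs V \<Longrightarrow> (\<lambda>v. f v + g v) \<in> poly_funs V"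
| mult: "f \<in> poly_funs V \<Longrightarrow> g \<in> poly_funs V \<Longrightarrow> (\<lambda>v. f v * g v) \<in> poly_funs V"

definition zero_locus :: "('k::field, 'v) module \<Rightarrow> ('v \<Rightarrow> 'k) set \<Rightarrow> 'v set" where
  "zero_locus V F = {v \<in> carrier V. \<forall>f\<in>F. f v = 0}"

definition zariski :: "('k::field, 'v) module \<Rightarrow> 'v topology" where
  "zariski V = topology (\<lambda>U. \<exists>F\<subseteq>poly_funs V. U = carrier V - zero_locus V F)"

lemma istopology_zariski:
  "istopology (\<lambda>U. \<exists>F\<subseteq>poly_funs V. U = carrier V - zero_locus V F)"
  unfolding istopology_def
proof (intro conjI allI impI)
  fix S T
  assume "\<exists>F\<subseteq>poly_funs V. S = carrier V - zero_locus V F"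
    and "\<exists>F\<subseteq>poly_funs V. T = carrier V - zero_locus V F"
  then obtain F G where F: "F \<subseteq> poly_funs V" "S = carrier V - zero_locus V F"
    and G: "G \<subseteq> poly_funs V" "T = carrier V - zero_locus V G"
    by blast
  let ?H = "{\<lambda>v. f v * g v | f g. f \<in> F \<and> g \<in> G}"
  have "S \<inter> T = carrier V - zero_locus V ?H"
    unfolding F(2) G(2) zero_locus_def by (auto; metis mult_eq_0_iff)
  moreover have "?H \<subseteq> poly_funs V"
    using F(1) G(1) by (auto intro: poly_funs.mult)
  ultimately show "\<exists>F\<subseteq>poly_funs V. S \<inter> T = carrier V - zero_locus V F"
    by blast
next
  fix \<K>
  assume "\<forall>U\<in>\<K>. \<exists>F\<subseteq>poly_funs V. U = carrier V - zero_locus V F"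
  then obtain F where F: "\<And>U. U \<in> \<K> \<Longrightarrow> F U \<subseteq> poly_funs V"
    "\<And>U. U \<in> \<K> \<Longrightarrow> U = carrier V - zero_locus V (F U)"
    by metis
  have "\<Union>\<K> = carrier V - zero_locus V (\<Union>U\<in>\<K>. F U)"
    using F(2) unfolding zero_locus_def by blast
  moreover have "(\<Union>U\<in>\<K>. F U) \<subseteq> poly_funs V"
    using F(1) by blast
  ultimately show "\<exists>F\<subseteq>poly_funs V. \<Union>\<K> = carrier V - zero_locus V F"
    by blast
qed

definition irreducible_set :: "'v topology \<Rightarrow> 'v set \<Rightarrow> bool" where
  "irreducible_set X Z \<longleftrightarrow> Z \<subseteq> topspace X \<and> Z \<noteq> {} \<and>
     (\<forall>A B. closedin X A \<and> closedin X B \<and> Z \<subseteq> A \<union> B \<longrightarrow> Z \<subseteq> A \<or> Z \<subseteq> B)"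

definition irreducible_component :: "'v topology \<Rightarrow> 'v set \<Rightarrow> bool" where
  "irreducible_component X Z \<longleftrightarrow>
     irreducible_set X Z \<and> (\<forall>Z'. irreducible_set X Z' \<and> Z \<subseteq> Z' \<longrightarrow> Z' = Z)"

definition upper_semicontinuous :: "'v topology \<Rightarrow> ('v \<Rightarrow> nat) \<Rightarrow> bool" where
  "upper_semicontinuous X \<delta> \<longleftrightarrow> (\<forall>n. closedin X {v \<in> topspace X. n \<le> \<delta> v})"


section \<open>Operator rng and operator defect\<close>

text \<open>Here \<open>T\<close> and \<open>G\<close> (for \<open>\<Gamma>\<close>) are vector spaces and \<open>p a \<alpha> b \<beta> c\<close> stands for the ternary
  product \<open>a\<alpha>b\<beta>c\<close>, which is assumed to be linear in each of its five arguments.  Maps that are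
  prescribed on pure tensors are introduced as the unique linear maps with these values.\<close>

definition op_mult ::
  "('k::field, 't) module \<Rightarrow> ('k, 'g) module \<Rightarrow> ('t \<Rightarrow> 'g \<Rightarrow> 't \<Rightarrow> 'g \<Rightarrow> 't \<Rightarrow> 't) \<Rightarrow> _ \<Rightarrow> _ \<Rightarrow> _"
  where
  "op_mult T G p =
     (THE m. m \<in> carrier (hom_vs (tensor4 T G T G) (hom_vs (tensor4 T G T G) (tensor4 T G T G))) \<and>
        (\<forall>a\<in>carrier T. \<forall>\<alpha>\<in>carrier G. \<forall>b\<in>carrier T. \<forall>\<beta>\<in>carrier G.
         \<forall>c\<in>carrier T. \<forall>\<gamma>\<in>carrier G. \<forall>d\<in>carrier T. \<forall>\<delta>\<in>carrier G.
           m (tens4 T G T G a \<alpha> b \<beta>) (tens4 T G T G c \<gamma> d \<delta>) =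
             tens4 T G T G (p a \<alpha> b \<beta> c) \<gamma> d \<delta>))"

definition op_tensor_rng where
  "op_tensor_rng T G p = (tensor4 T G T G)\<lparr>mult := op_mult T G p\<rparr>"

text \<open>HOL-Algebra's \<open>ideal\<close> requires a unital ring; the rng at hand has no unit.\<close>

definition rng_ideal :: "'a set \<Rightarrow> ('a, 'b) ring_scheme \<Rightarrow> bool" where
  "rng_ideal I R \<longleftrightarrow> additive_subgroup I R \<and>
     (\<forall>x\<in>I. \<forall>y\<in>carrier R. x \<otimes>\<^bsub>R\<^esub> y \<in> I \<and> y \<otimes>\<^bsub>R\<^esub> x \<in> I)"

definition gen_rng_ideal :: "('a, 'b) ring_scheme \<Rightarrow> 'a set \<Rightarrow> 'a set" where
  "gen_rng_ideal R S = \<Inter>{I. rng_ideal I R \<and> S \<subseteq> I}"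

definition op_ideal ::
  "('k::field, 't) module \<Rightarrow> ('k, 'g) module \<Rightarrow> ('t \<Rightarrow> 'g \<Rightarrow> 't \<Rightarrow> 'g \<Rightarrow> 't \<Rightarrow> 't) \<Rightarrow> _ set"
  where
  "op_ideal T G p =
     gen_rng_ideal (op_tensor_rng T G p)
       {tens4 T G T G (p a \<alpha> b \<beta> c) \<gamma> d \<delta> \<ominus>\<^bsub>tensor4 T G T G\<^esub> tens4 T G T G a \<alpha> (p b \<beta> c \<gamma> d) \<delta>
        | a \<alpha> b \<beta> c \<gamma> d \<delta>.
          a \<in> carrier T \<and> \<alpha> \<in> carrier G \<and> b \<in> carrier T \<and> \<beta> \<in> carrier G \<and>
          c \<in> carrier T \<and> \<gamma> \<in> carrier G \<and> d \<in> carrier T \<and> \<delta> \<in> carrier G}"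

definition operator_rng where
  "operator_rng T G p = quotient_vs (op_tensor_rng T G p) (op_ideal T G p)"

definition op_class where
  "op_class T G p a \<alpha> b \<beta> =
     op_ideal T G p +>\<^bsub>op_tensor_rng T G p\<^esub> tens4 T G T G a \<alpha> b \<beta>"

definition regular_rep where
  "regular_rep T G p =
     (THE \<rho>. \<rho> \<in> carrier (hom_vs (operator_rng T G p) (hom_vs T T)) \<and>
        (\<forall>a\<in>carrier T. \<forall>\<alpha>\<in>carrier G. \<forall>b\<in>carrier T. \<forall>\<beta>\<in>carrier G. \<forall>x\<in>carrier T.
           \<rho> (op_class T G p a \<alpha> b \<beta>) x = p a \<alpha> b \<beta> x))"

definition operator_defect where
  "operator_defect T G p =
     (operator_rng T G p)\<lparr>carrier :=
        mod_hom.ker (operator_rng T G p) (hom_vs T T) (regular_rep T G p)\<rparr>"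


section \<open>Ternary tensors and their defect\<close>

definition tensor_maps ::
  "('k::field, 'e) module \<Rightarrow> ('k, 'w) module \<Rightarrow> ('k, _ \<Rightarrow> 'w) module" where
  "tensor_maps E W = hom_vs (tensor3 E E E) W"

definition surj_tensor_maps where
  "surj_tensor_maps E W = {\<mu> \<in> carrier (tensor_maps E W). \<mu> ` carrier (tensor3 E E E) = carrier W}"

abbreviation surj_topology where
  "surj_topology E W \<equiv> subtopology (zariski (tensor_maps E W)) (surj_tensor_maps E W)"

definition Theta where
  "Theta E W \<mu> =
     (THE \<theta>. \<theta> \<in> carrier (hom_vs (tensor E E) (hom_vs E W)) \<and>
        (\<forall>a\<in>carrier E. \<forall>b\<in>carrier E. \<forall>c\<in>carrier E.
           \<theta> (tens E E a b) c = \<mu> (tens3 E E E a b c)))"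

text \<open>A difference \<open>u - v\<close> with \<open>u\<close> in the first and \<open>v\<close> in the second summand of a direct sum
  is the pair \<open>(u, -v)\<close>.\<close>

definition Bmap where
  "Bmap E W \<mu> =
     (THE \<beta>. \<beta> \<in> carrier (hom_vs (tensor4 E E E E) (direct_sum (tensor W E) (tensor E W))) \<and>
        (\<forall>a\<in>carrier E. \<forall>b\<in>carrier E. \<forall>c\<in>carrier E. \<forall>d\<in>carrier E.
           \<beta> (tens4 E E E E a b c d) =
             (tens W E (\<mu> (tens3 E E E a b c)) d,
              \<ominus>\<^bsub>tensor E W\<^esub> tens E W a (\<mu> (tens3 E E E b c d)))))"

definition rank_Theta where
  "rank_Theta E W \<mu> = rank_of (tensor E E) (hom_vs E W) (Theta E W \<mu>)"

definition rank_B where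
  "rank_B E W \<mu> =
     rank_of (tensor4 E E E E) (direct_sum (tensor W E) (tensor E W)) (Bmap E W \<mu>)"

definition X_locus where
  "X_locus E W a b =
     {\<mu> \<in> surj_tensor_maps E W. int (rank_Theta E W \<mu>) \<le> a \<and> int (rank_B E W \<mu>) \<le> b}"

text \<open>The action of \<open>(g, h)\<close> sends \<open>\<mu>\<close> to \<open>h \<circ> \<mu> \<circ> (g\<^sup>-\<^sup>1 \<otimes> g\<^sup>-\<^sup>1 \<otimes> g\<^sup>-\<^sup>1)\<close>.\<close>

definition GL_act where
  "GL_act E W g h \<mu> =
     (THE \<nu>. \<nu> \<in> carrier (tensor_maps E W) \<and>
        (\<forall>a\<in>carrier E. \<forall>b\<in>carrier E. \<forall>c\<in>carrier E.
           \<nu> (tens3 E E E a b c) =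
             h (\<mu> (tens3 E E E (inv_into (carrier E) g a) (inv_into (carrier E) g b)
                      (inv_into (carrier E) g c)))))"

definition T_prod ::
  "('k::field, 'e) module \<Rightarrow> ('k, 'w) module \<Rightarrow> (_ \<Rightarrow> 'w) \<Rightarrow>
     'e \<times> 'w \<Rightarrow> 'k \<Rightarrow> 'e \<times> 'w \<Rightarrow> 'k \<Rightarrow> 'e \<times> 'w \<Rightarrow> 'e \<times> 'w" where
  "T_prod E W \<mu> a n b m c =
     (\<zero>\<^bsub>E\<^esub>, (n * m) \<odot>\<^bsub>W\<^esub> \<mu> (tens3 E E E (fst a) (fst b) (fst c)))"

definition T_defect where
  "T_defect E W \<mu> = operator_defect (direct_sum E W) field_vs (T_prod E W \<mu>)"

definition defect_dim where
  "defect_dim E W \<mu> = vectorspace.dim class_ring (T_defect E W \<mu>)"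

end

theory Submission
  imports Defs
begin

text \<open>
  The rank of a linear map is at least \<open>n\<close> iff some \<open>n\<close> vectors and \<open>n\<close> functionals on the target
  have a nonvanishing \<open>n \<times> n\<close> minor.  As \<open>\<Theta>\<^sub>\<mu>\<close> and \<open>B\<^sub>\<mu>\<close> depend linearly on \<open>\<mu>\<close>, these minors are
  polynomial in \<open>\<mu>\<close>, so the loci of bounded rank are closed.

  For the defect, \<open>T \<otimes> k \<otimes> T \<otimes> k \<cong> T \<otimes> T\<close> is projected onto
  \<open>Q = (E \<otimes> E) \<oplus> (W \<otimes> E) \<oplus> (E \<otimes> W)\<close>.  Since \<open>\<mu>\<close> vanishes on \<open>W\<close> and is surjective, the relations with
  an argument in \<open>W\<close> already give all of \<open>W \<otimes> W\<close>, the remaining ones give the image of \<open>B\<^sub>\<mu>\<close>, and their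
  products with anything vanish modulo \<open>W \<otimes> W\<close>: the defining ideal is the preimage of \<open>0 \<oplus> im B\<^sub>\<mu>\<close>.
  The regular representation factors through \<open>\<Theta>\<^sub>\<mu>\<close> on \<open>E \<otimes> E\<close>, so two applications of rank-nullity
  give the dimension formula.
\<close>

section \<open>Vector spaces and linear maps\<close>

text \<open>\<open>Theta\<close>, \<open>Bmap\<close>, \<open>GL_act\<close>, \<open>op_mult\<close>
  and \<open>regular_rep\<close> are definite descriptions of maps prescribed only on pure tensors
  or their classes, so nothing can be said about them before existence and uniqueness are shown.
  This is why universal properties for two, three and four factors and for quotients are developed,
  and why homomorphisms are compared as extensional functions. A second obstacle is that the
  defining ideal is generated in a rng: the ideals it is compared with are merely additive
  subgroups, with no closure under scalars. Arguments about them use only sums of pure tensors, into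
  whose factors scalars can be absorbed. The constant r^2 + 2rs is the dimension of
  \<open>Q\<close>; the dimension of the full space
  \<open>T \<otimes> k \<otimes> T \<otimes> k\<close> cancels and is never computed. Semicontinuity
  of the defect follows from closedness of the loci because a bound on the sum of the two ranks is a
  finite union of conditions bounding each rank. For stability under the group, one inequality
  between ranks is enough, since the loci are given by upper bounds.\<close>

abbreviation vspace :: "('k::field, 'v) module \<Rightarrow> bool" where
  "vspace V \<equiv> vectorspace class_ring V"

abbreviation lin :: "('k::field, 'm) module \<Rightarrow> ('k, 'n) module \<Rightarrow> ('m \<Rightarrow> 'n) set" where
  "lin M N \<equiv> LinearCombinations.module_hom class_ring M N"

text \<open>The additive inverse is asked for in the explicit form \<open>(- 1) \<odot> x\<close>,
  so that checking an instance is purely equational.\<close>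

lemma vspaceI:
  fixes V :: "('k::field, 'v) module"
  assumes "\<zero>\<^bsub>V\<^esub> \<in> carrier V"
    and "\<And>x y. x \<in> carrier V \<Longrightarrow> y \<in> carrier V \<Longrightarrow> x \<oplus>\<^bsub>V\<^esub> y \<in> carrier V"
    and "\<And>c x. x \<in> carrier V \<Longrightarrow> c \<odot>\<^bsub>V\<^esub> x \<in> carrier V"
    and "\<And>x y. x \<in> carrier V \<Longrightarrow> y \<in> carrier V \<Longrightarrow> x \<oplus>\<^bsub>V\<^esub> y = y \<oplus>\<^bsub>V\<^esub> x"
    and "\<And>x y z. x \<in> carrier V \<Longrightarrow> y \<in> carrier V \<Longrightarrow> z \<in> carrier V \<Longrightarrow>
      (x \<oplus>\<^bsub>V\<^esub> y) \<oplus>\<^bsub>V\<^esub> z = x \<oplus>\<^bsub>V\<^esub> (y \<oplus>\<^bsub>V\<^esub> z)"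
    and "\<And>x. x \<in> carrier V \<Longrightarrow> x \<oplus>\<^bsub>V\<^esub> \<zero>\<^bsub>V\<^esub> = x"
    and "\<And>x. x \<in> carrier V \<Longrightarrow> x \<oplus>\<^bsub>V\<^esub> ((- 1) \<odot>\<^bsub>V\<^esub> x) = \<zero>\<^bsub>V\<^esub>"
    and "\<And>a b x. x \<in> carrier V \<Longrightarrow> (a * b) \<odot>\<^bsub>V\<^esub> x = a \<odot>\<^bsub>V\<^esub> (b \<odot>\<^bsub>V\<^esub> x)"
    and "\<And>x. x \<in> carrier V \<Longrightarrow> 1 \<odot>\<^bsub>V\<^esub> x = x"
    and "\<And>a b x. x \<in> carrier V \<Longrightarrow> (a + b) \<odot>\<^bsub>V\<^esub> x = a \<odot>\<^bsub>V\<^esub> x \<oplus>\<^bsub>V\<^esub> b \<odot>\<^bsub>V\<^esub> x"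
    and "\<And>a x y. x \<in> carrier V \<Longrightarrow> y \<in> carrier V \<Longrightarrow>
      a \<odot>\<^bsub>V\<^esub> (x \<oplus>\<^bsub>V\<^esub> y) = a \<odot>\<^bsub>V\<^esub> x \<oplus>\<^bsub>V\<^esub> a \<odot>\<^bsub>V\<^esub> y"
  shows "vspace V"
proof (intro vs_criteria class_field)
  show "\<forall>v\<in>carrier V. \<exists>w\<in>carrier V. v \<oplus>\<^bsub>V\<^esub> w = \<zero>\<^bsub>V\<^esub>"
    using assms(3,7) by blast
qed (use assms in auto)

lemma vspace_module: "vspace V \<Longrightarrow> Module.module class_ring V"
  by (simp add: vectorspace_def)

lemma vspace_abelian_group: "vspace V \<Longrightarrow> abelian_group V"
  using vspace_module unfolding Module.module_def by blast

lemma vspace_abelian_monoid: "vspace V \<Longrightarrow> abelian_monoid V"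
  using vspace_abelian_group unfolding abelian_group_def by blast

context
  fixes V :: "('k::field, 'v) module"
  assumes V: "vspace V"
begin

interpretation vectorspace class_ring V by (rule V)

lemma vs_zero_closed [simp]: "\<zero>\<^bsub>V\<^esub> \<in> carrier V"
  by (rule M.zero_closed)

lemma vs_add_closed [simp]:
  "x \<in> carrier V \<Longrightarrow> y \<in> carrier V \<Longrightarrow> x \<oplus>\<^bsub>V\<^esub> y \<in> carrier V"
  by (rule M.a_closed)

lemma vs_smult_closed [simp]: "x \<in> carrier V \<Longrightarrow> c \<odot>\<^bsub>V\<^esub> x \<in> carrier V"
  by (rule smult_closed) simp

lemma vs_minus_closed [simp]:
  "x \<in> carrier V \<Longrightarrow> y \<in> carrier V \<Longrightarrow> x \<ominus>\<^bsub>V\<^esub> y \<in> carrier V"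
  by (rule M.minus_closed)

lemma vs_add_comm:
  "x \<in> carrier V \<Longrightarrow> y \<in> carrier V \<Longrightarrow> x \<oplus>\<^bsub>V\<^esub> y = y \<oplus>\<^bsub>V\<^esub> x"
  by (rule M.a_comm)

lemma vs_add_assoc:
  "x \<in> carrier V \<Longrightarrow> y \<in> carrier V \<Longrightarrow> z \<in> carrier V \<Longrightarrow>
    (x \<oplus>\<^bsub>V\<^esub> y) \<oplus>\<^bsub>V\<^esub> z = x \<oplus>\<^bsub>V\<^esub> (y \<oplus>\<^bsub>V\<^esub> z)"
  by (rule M.a_assoc)

lemma vs_add_left_comm:
  "x \<in> carrier V \<Longrightarrow> y \<in> carrier V \<Longrightarrow> z \<in> carrier V \<Longrightarrow>
    x \<oplus>\<^bsub>V\<^esub> (y \<oplus>\<^bsub>V\<^esub> z) = y \<oplus>\<^bsub>V\<^esub> (x \<oplus>\<^bsub>V\<^esub> z)"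
  by (rule M.a_lcomm)

lemma vs_add_zero [simp]:
  "x \<in> carrier V \<Longrightarrow> x \<oplus>\<^bsub>V\<^esub> \<zero>\<^bsub>V\<^esub> = x"
  "x \<in> carrier V \<Longrightarrow> \<zero>\<^bsub>V\<^esub> \<oplus>\<^bsub>V\<^esub> x = x"
  by (simp_all add: M.l_zero M.r_zero)

lemma vs_smult_one [simp]: "x \<in> carrier V \<Longrightarrow> 1 \<odot>\<^bsub>V\<^esub> x = x"
  using smult_one by simp

lemma vs_smult_smult:
  "x \<in> carrier V \<Longrightarrow> (a * b) \<odot>\<^bsub>V\<^esub> x = a \<odot>\<^bsub>V\<^esub> (b \<odot>\<^bsub>V\<^esub> x)"
  using smult_assoc1[of a b x] by simp

lemma vs_add_smult:
  "x \<in> carrier V \<Longrightarrow> (a + b) \<odot>\<^bsub>V\<^esub> x = a \<odot>\<^bsub>V\<^esub> x \<oplus>\<^bsub>V\<^esub> b \<odot>\<^bsub>V\<^esub> x"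
  using smult_l_distr[of a b x] by simp

lemma vs_smult_add:
  "x \<in> carrier V \<Longrightarrow> y \<in> carrier V \<Longrightarrow>
    a \<odot>\<^bsub>V\<^esub> (x \<oplus>\<^bsub>V\<^esub> y) = a \<odot>\<^bsub>V\<^esub> x \<oplus>\<^bsub>V\<^esub> a \<odot>\<^bsub>V\<^esub> y"
  using smult_r_distr[of a x y] by simp

lemma vs_zero_smult [simp]: "x \<in> carrier V \<Longrightarrow> 0 \<odot>\<^bsub>V\<^esub> x = \<zero>\<^bsub>V\<^esub>"
  using lmult_0[of x] by simp

lemma vs_smult_zero [simp]: "c \<odot>\<^bsub>V\<^esub> \<zero>\<^bsub>V\<^esub> = \<zero>\<^bsub>V\<^esub>"
  using rmult_0[of c] by simp

lemma vs_neg_eq: "x \<in> carrier V \<Longrightarrow> \<ominus>\<^bsub>V\<^esub> x = (- 1) \<odot>\<^bsub>V\<^esub> x"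
  using smult_minus_1[of x] by (simp add: class_ring_simps)

lemma vs_minus_eq: "y \<in> carrier V \<Longrightarrow> x \<ominus>\<^bsub>V\<^esub> y = x \<oplus>\<^bsub>V\<^esub> ((- 1) \<odot>\<^bsub>V\<^esub> y)"
  by (simp add: a_minus_def vs_neg_eq)

lemma vs_add_neg [simp]:
  "x \<in> carrier V \<Longrightarrow> x \<oplus>\<^bsub>V\<^esub> ((- 1) \<odot>\<^bsub>V\<^esub> x) = \<zero>\<^bsub>V\<^esub>"
  using M.r_neg[of x] by (simp add: vs_neg_eq)

lemma vs_minus_add_cancel:
  "x \<in> carrier V \<Longrightarrow> y \<in> carrier V \<Longrightarrow> (x \<ominus>\<^bsub>V\<^esub> y) \<oplus>\<^bsub>V\<^esub> y = x"
  by (metis M.add.inv_closed M.add.m_assoc M.l_neg M.r_zero a_minus_def)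

lemma vs_minus_self [simp]: "x \<in> carrier V \<Longrightarrow> x \<ominus>\<^bsub>V\<^esub> x = \<zero>\<^bsub>V\<^esub>"
  by (simp add: a_minus_def M.r_neg)

lemma vs_minus_zero [simp]: "x \<in> carrier V \<Longrightarrow> x \<ominus>\<^bsub>V\<^esub> \<zero>\<^bsub>V\<^esub> = x"
  by (simp add: a_minus_def)

lemma vs_minus_zeroD:
  "x \<in> carrier V \<Longrightarrow> y \<in> carrier V \<Longrightarrow> x \<ominus>\<^bsub>V\<^esub> y = \<zero>\<^bsub>V\<^esub> \<Longrightarrow> x = y"
  using vs_minus_add_cancel by fastforce

lemma vs_finsum_closed [simp]: "f \<in> A \<rightarrow> carrier V \<Longrightarrow> finsum V f A \<in> carrier V"
  by (rule M.finsum_closed)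

lemma vs_finsum_insert:
  "finite A \<Longrightarrow> a \<notin> A \<Longrightarrow> f \<in> A \<rightarrow> carrier V \<Longrightarrow> f a \<in> carrier V \<Longrightarrow>
    finsum V f (insert a A) = f a \<oplus>\<^bsub>V\<^esub> finsum V f A"
  by (rule M.finsum_insert)

lemma vs_finsum_empty [simp]: "finsum V f {} = \<zero>\<^bsub>V\<^esub>"
  by (rule M.finsum_empty)

lemma vs_finsum_add:
  "f \<in> A \<rightarrow> carrier V \<Longrightarrow> g \<in> A \<rightarrow> carrier V \<Longrightarrow>
    finsum V (\<lambda>i. f i \<oplus>\<^bsub>V\<^esub> g i) A = finsum V f A \<oplus>\<^bsub>V\<^esub> finsum V g A"
  by (rule M.finsum_addf)

lemma vs_finsum_smult:
  "f \<in> A \<rightarrow> carrier V \<Longrightarrow> finsum V (\<lambda>i. c \<odot>\<^bsub>V\<^esub> f i) A = c \<odot>\<^bsub>V\<^esub> finsum V f A"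
proof (induction A rule: infinite_finite_induct)
  case (insert x F)
  then show ?case by (simp add: vs_finsum_insert vs_smult_add Pi_def)
qed (simp_all add: M.finsum_infinite)

lemma vs_finsum_single:
  assumes "finite A" "i \<in> A" "f i \<in> carrier V" "\<And>j. j \<in> A \<Longrightarrow> j \<noteq> i \<Longrightarrow> f j = \<zero>\<^bsub>V\<^esub>"
  shows "finsum V f A = f i"
proof -
  have *: "f \<in> A \<rightarrow> carrier V" using assms by (metis M.zero_closed Pi_I')
  have "finsum V f A = finsum V (\<lambda>j. if i = j then f j else \<zero>\<^bsub>V\<^esub>) A"
    using assms * by (intro M.finsum_cong') auto
  also have "\<dots> = f i" by (rule M.finsum_singleton) (use assms * in auto)
  finally show ?thesis .
qed

end

section \<open>Linear maps\<close>

lemma linI: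
  assumes "\<And>x. x \<in> carrier M \<Longrightarrow> f x \<in> carrier N"
    and "\<And>x y. x \<in> carrier M \<Longrightarrow> y \<in> carrier M \<Longrightarrow> f (x \<oplus>\<^bsub>M\<^esub> y) = f x \<oplus>\<^bsub>N\<^esub> f y"
    and "\<And>c x. x \<in> carrier M \<Longrightarrow> f (c \<odot>\<^bsub>M\<^esub> x) = c \<odot>\<^bsub>N\<^esub> f x"
  shows "f \<in> lin M N"
  using assms by (auto simp: LinearCombinations.module_hom_def)

lemma lin_closed: "f \<in> lin M N \<Longrightarrow> x \<in> carrier M \<Longrightarrow> f x \<in> carrier N"
  by (auto simp: LinearCombinations.module_hom_def)

lemma lin_add:
  "f \<in> lin M N \<Longrightarrow> x \<in> carrier M \<Longrightarrow> y \<in> carrier M \<Longrightarrow> f (x \<oplus>\<^bsub>M\<^esub> y) = f x \<oplus>\<^bsub>N\<^esub> f y"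
  by (auto simp: LinearCombinations.module_hom_def)

lemma lin_smult: "f \<in> lin M N \<Longrightarrow> x \<in> carrier M \<Longrightarrow> f (c \<odot>\<^bsub>M\<^esub> x) = c \<odot>\<^bsub>N\<^esub> f x"
  by (auto simp: LinearCombinations.module_hom_def)

lemma lin_zero: "f \<in> lin M N \<Longrightarrow> vspace M \<Longrightarrow> vspace N \<Longrightarrow> f \<zero>\<^bsub>M\<^esub> = \<zero>\<^bsub>N\<^esub>"
  by (metis lin_closed lin_smult vs_zero_closed vs_zero_smult)

lemma lin_minus:
  "f \<in> lin M N \<Longrightarrow> vspace M \<Longrightarrow> vspace N \<Longrightarrow> x \<in> carrier M \<Longrightarrow> y \<in> carrier M \<Longrightarrow>
    f (x \<ominus>\<^bsub>M\<^esub> y) = f x \<ominus>\<^bsub>N\<^esub> f y"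
  by (simp add: vs_minus_eq lin_add lin_smult lin_closed)

text \<open>Linearity only concerns values on the carrier. This passes between a formula and its
  restriction, or a map that is known only through its values on the carrier.\<close>

lemma lin_cong:
  assumes "f \<in> lin M N" "vspace M" "\<And>x. x \<in> carrier M \<Longrightarrow> f x = g x"
  shows "g \<in> lin M N"
proof (rule linI)
  show "g x \<in> carrier N" if "x \<in> carrier M" for x
    using assms that lin_closed by fastforce
  show "g (x \<oplus>\<^bsub>M\<^esub> y) = g x \<oplus>\<^bsub>N\<^esub> g y" if "x \<in> carrier M" "y \<in> carrier M" for x y
    using lin_add[OF assms(1) that] assms(2,3) that by simp
  show "g (c \<odot>\<^bsub>M\<^esub> x) = c \<odot>\<^bsub>N\<^esub> g x" if "x \<in> carrier M" for c x
    using lin_smult[OF assms(1) that, of c] assms(2,3) that by simp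
qed

lemma lin_comp: "f \<in> lin M N \<Longrightarrow> g \<in> lin N P \<Longrightarrow> (\<lambda>x. g (f x)) \<in> lin M P"
  by (rule linI) (simp_all add: lin_closed lin_add lin_smult)

lemma lin_id: "(\<lambda>x. x) \<in> lin M M"
  by (rule linI) simp_all

lemma lin_const_zero: "vspace N \<Longrightarrow> (\<lambda>x. \<zero>\<^bsub>N\<^esub>) \<in> lin M N"
  by (rule linI) simp_all

lemma lin_plus:
  assumes "f \<in> lin M N" "g \<in> lin M N" "vspace N"
  shows "(\<lambda>x. f x \<oplus>\<^bsub>N\<^esub> g x) \<in> lin M N"
  using assms
  by (intro linI) (simp_all add: lin_closed lin_add lin_smult vs_smult_add vs_add_assoc vs_add_left_comm)

lemma lin_scale:
  assumes "f \<in> lin M N" "vspace N"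
  shows "(\<lambda>x. c \<odot>\<^bsub>N\<^esub> f x) \<in> lin M N"
  using assms
  by (intro linI) (simp_all add: lin_closed lin_add lin_smult vs_smult_add mult.commute flip: vs_smult_smult)

lemma lin_finsum:
  assumes "f \<in> lin M N" "vspace M" "vspace N" "g \<in> A \<rightarrow> carrier M"
  shows "f (finsum M g A) = finsum N (\<lambda>i. f (g i)) A"
  using assms(4)
proof (induction A rule: infinite_finite_induct)
  \<comment> \<open>By convention a \<open>finsum\<close> over an infinite index set is zero, so the
    claim becomes preservation of zero.\<close>
  case (infinite A)
  then show ?case
    using assms by (simp add: abelian_monoid.finsum_infinite vspace_abelian_monoid lin_zero)
next
  case (insert x F)
  then show ?case
    using assms by (simp add: vs_finsum_insert lin_add lin_closed Pi_def)
qed (use assms in \<open>simp add: lin_zero\<close>)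

lemma linear_mapI: "vspace M \<Longrightarrow> vspace N \<Longrightarrow> f \<in> lin M N \<Longrightarrow> linear_map class_ring M N f"
  by (simp add: linear_map_def mod_hom_def mod_hom_axioms_def vspace_module)

section \<open>Subspaces\<close>

text \<open>A locale-free form of \<open>submodule\<close>, whose closure conditions can be handed
  to automation without an interpretation.\<close>

definition subsp :: "'v set \<Rightarrow> ('k::field, 'v) module \<Rightarrow> bool" where
  "subsp U V \<longleftrightarrow> U \<subseteq> carrier V \<and> \<zero>\<^bsub>V\<^esub> \<in> U \<and> (\<forall>x\<in>U. \<forall>y\<in>U. x \<oplus>\<^bsub>V\<^esub> y \<in> U) \<and>
     (\<forall>c. \<forall>x\<in>U. c \<odot>\<^bsub>V\<^esub> x \<in> U)"

lemma subsp_submodule: "vspace V \<Longrightarrow> subsp U V \<longleftrightarrow> submodule class_ring U V"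
  by (auto simp: subsp_def submodule_def vspace_module)

lemma subsp_subspace: "vspace V \<Longrightarrow> subsp U V \<Longrightarrow> VectorSpace.subspace class_ring U V"
  by (simp add: VectorSpace.subspace_def subsp_submodule)

lemma subsp_vspace: "vspace V \<Longrightarrow> subsp U V \<Longrightarrow> vspace (V\<lparr>carrier := U\<rparr>)"
  by (simp add: vectorspace.subspace_is_vs subsp_subspace)

lemma subsp_carrier: "vspace V \<Longrightarrow> subsp (carrier V) V"
  by (simp add: subsp_def)

lemma subsp_image:
  assumes f: "f \<in> lin M N" and M: "vspace M" and N: "vspace N" and U: "subsp U M"
  shows "subsp (f ` U) N"
proof -
  have U': "x \<in> carrier M" if "x \<in> U" for x using U that by (auto simp: subsp_def)
  have "\<zero>\<^bsub>N\<^esub> \<in> f ` U"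
    using lin_zero[OF f M N] U unfolding subsp_def by (metis imageI)
  moreover have "f x \<oplus>\<^bsub>N\<^esub> f y \<in> f ` U" if "x \<in> U" "y \<in> U" for x y
    using U that U' by (simp add: subsp_def flip: lin_add[OF f])
  moreover have "c \<odot>\<^bsub>N\<^esub> f x \<in> f ` U" if "x \<in> U" for c x
    using U that U' by (simp add: subsp_def flip: lin_smult[OF f])
  ultimately show ?thesis
    using U' by (auto simp: subsp_def lin_closed[OF f])
qed

lemma subsp_range: "f \<in> lin M N \<Longrightarrow> vspace M \<Longrightarrow> vspace N \<Longrightarrow> subsp (f ` carrier M) N"
  by (simp add: subsp_image subsp_carrier)

lemma subsp_vimage:
  "f \<in> lin M N \<Longrightarrow> vspace M \<Longrightarrow> vspace N \<Longrightarrow> subsp U N \<Longrightarrow> subsp {x \<in> carrier M. f x \<in> U} M"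
  by (auto simp: subsp_def lin_zero lin_add lin_smult)

lemma subsp_zero: "vspace V \<Longrightarrow> subsp {\<zero>\<^bsub>V\<^esub>} V"
  by (auto simp: subsp_def)

section \<open>The ground field as a vector space, bases and dual bases\<close>

lemma vspace_field_vs: "vspace (field_vs :: ('k::field, 'k) module)"
  by (rule vspaceI) (auto simp: field_vs_def algebra_simps)

lemma field_vs_simps [simp]:
  "carrier field_vs = UNIV" "add field_vs = (+)" "zero field_vs = 0" "module.smult field_vs = (*)"
  by (simp_all add: field_vs_def)

lemma finsum_field_vs: "finite A \<Longrightarrow> finsum (field_vs :: ('k::field, 'k) module) f A = sum f A"
  by (induction A rule: finite_induct) (simp_all add: vs_finsum_insert vspace_field_vs)

abbreviation vdim :: "('k::field, 'v) module \<Rightarrow> nat" where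
  "vdim V \<equiv> vectorspace.dim class_ring V"

definition fdvs :: "('k::field, 'v) module \<Rightarrow> bool" where
  "fdvs V \<longleftrightarrow> vspace V \<and> vectorspace.fin_dim class_ring V"

lemma fdvs_vspace [simp]: "fdvs V \<Longrightarrow> vspace V"
  by (simp add: fdvs_def)

text \<open>A finite basis together with its dual basis. The index set is kept apart from the
  vectors so that products and disjoint sums of index sets can be used for tensor products, spaces
  of maps and direct sums; the functionals are what later produces minors.\<close>

definition coords ::
  "('k::field, 'v) module \<Rightarrow> 'i set \<Rightarrow> ('i \<Rightarrow> 'v) \<Rightarrow> ('i \<Rightarrow> 'v \<Rightarrow> 'k) \<Rightarrow> bool" where
  "coords V I b \<phi> \<longleftrightarrow> finite I \<and> b \<in> I \<rightarrow> carrier V \<and> (\<forall>i\<in>I. \<phi> i \<in> lin V field_vs) \<and>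
     (\<forall>i\<in>I. \<forall>j\<in>I. \<phi> i (b j) = (if i = j then 1 else 0)) \<and>
     (\<forall>v\<in>carrier V. v = finsum V (\<lambda>i. \<phi> i v \<odot>\<^bsub>V\<^esub> b i) I)"

lemma coords_idD:
  assumes "coords V A (\<lambda>x. x) \<phi>"
  shows "finite A" "A \<subseteq> carrier V" "\<And>i. i \<in> A \<Longrightarrow> \<phi> i \<in> lin V field_vs"
    "\<And>i j. i \<in> A \<Longrightarrow> j \<in> A \<Longrightarrow> \<phi> i j = (if i = j then 1 else 0)"
    "\<And>v. v \<in> carrier V \<Longrightarrow> finsum V (\<lambda>i. \<phi> i v \<odot>\<^bsub>V\<^esub> i) A = v"
  using assms by (auto simp: coords_def)

text \<open>Duality separates the vectors and, applied to a vanishing combination, isolates each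
  coefficient; the expansion formula gives spanning.\<close>

lemma coords_basis:
  fixes V :: "('k::field, 'v) module"
  assumes V: "vspace V" and c: "coords V I b \<phi>"
  shows "inj_on b I" "vectorspace.basis class_ring V (b ` I)"
proof -
  interpret vectorspace class_ring V by (rule V)
  have fin: "finite I" and b: "b \<in> I \<rightarrow> carrier V" and \<phi>: "\<And>i. i \<in> I \<Longrightarrow> \<phi> i \<in> lin V field_vs"
    and dual: "\<And>i j. i \<in> I \<Longrightarrow> j \<in> I \<Longrightarrow> \<phi> i (b j) = (if i = j then 1 else 0)"
    and expand: "\<And>v. v \<in> carrier V \<Longrightarrow> v = finsum V (\<lambda>i. \<phi> i v \<odot>\<^bsub>V\<^esub> b i) I"
    using c by (auto simp: coords_def)
  show inj: "inj_on b I"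
    by (rule inj_onI) (metis dual one_neq_zero)
  have sub: "b ` I \<subseteq> carrier V" using b by auto
  have lc: "lincomb a (b ` I) = finsum V (\<lambda>i. a (b i) \<odot>\<^bsub>V\<^esub> b i) I" for a
    unfolding lincomb_def using b inj by (subst M.finsum_reindex) (auto simp: V)
  have "lin_indpt (b ` I)"
  proof (rule finite_lin_indpt2)
    fix a assume 0: "lincomb a (b ` I) = \<zero>\<^bsub>V\<^esub>"
    have "a (b j) = 0" if j: "j \<in> I" for j
    proof -
      have "0 = \<phi> j (finsum V (\<lambda>i. a (b i) \<odot>\<^bsub>V\<^esub> b i) I)"
        using lin_zero[OF \<phi>[OF j] V vspace_field_vs] 0 lc by simp
      also have "\<dots> = (\<Sum>i\<in>I. a (b i) * \<phi> j (b i))"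
        using b by (subst lin_finsum[OF \<phi>[OF j] V vspace_field_vs])
          (auto simp: V Pi_def finsum_field_vs fin lin_smult[OF \<phi>[OF j]] intro!: sum.cong)
      also have "\<dots> = (\<Sum>i\<in>I. if i = j then a (b i) else 0)"
        by (intro sum.cong) (auto simp: dual j)
      also have "\<dots> = a (b j)" using fin j by simp
      finally show ?thesis by simp
    qed
    then show "\<forall>v\<in>b ` I. a v = \<zero>\<^bsub>class_ring\<^esub>" by simp
  qed (use fin sub in auto)
  moreover have "gen_set (b ` I)"
  proof
    show "span (b ` I) \<subseteq> carrier V" by (rule span_is_subset2[OF sub])
    show "carrier V \<subseteq> span (b ` I)"
    proof
      fix v assume v: "v \<in> carrier V"
      define a where "a x = \<phi> (the_inv_into I b x) v" for x
      have "lincomb a (b ` I) = finsum V (\<lambda>i. \<phi> i v \<odot>\<^bsub>V\<^esub> b i) I"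
        unfolding lc by (rule M.finsum_cong') (use b inj V in \<open>auto simp: a_def the_inv_into_f_f\<close>)
      then have "v = lincomb a (b ` I)" using expand[OF v] by simp
      then show "v \<in> span (b ` I)"
        using fin sub by (auto simp: finite_span)
    qed
  qed
  ultimately show "basis (b ` I)" using sub by (simp add: basis_def)
qed

lemma coords_fdvs:
  fixes V :: "('k::field, 'v) module"
  assumes V: "vspace V" and c: "coords V I b \<phi>"
  shows "fdvs V" "vdim V = card I"
proof -
  interpret vectorspace class_ring V by (rule V)
  have fin: "finite I" using c by (simp add: coords_def)
  show "vdim V = card I"
    using dim_basis[OF _ coords_basis(2)[OF V c]] card_image[OF coords_basis(1)[OF V c]] fin by simp
  show "fdvs V"
    using coords_basis(2)[OF V c] fin V
    by (auto simp: fdvs_def basis_def fin_dim_def intro!: exI[of _ "b ` I"])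
qed

text \<open>The coefficients of a vector in a basis are unique, and uniqueness makes them additive
  and homogeneous: the sum or multiple of coefficient functions is a coefficient function of the sum
  or multiple.\<close>

lemma basis_coords:
  fixes V :: "('k::field, 'v) module"
  assumes V: "vspace V" and finA: "finite A" and A: "vectorspace.basis class_ring V A"
  shows "\<exists>\<phi>. coords V A (\<lambda>x. x) \<phi>"
proof -
  interpret vectorspace class_ring V by (rule V)
  have sub: "A \<subseteq> carrier V" using A by (simp add: basis_def)
  have lc: "lincomb a A = finsum V (\<lambda>x. a x \<odot>\<^bsub>V\<^esub> x) A" for a
    by (simp add: lincomb_def)
  \<comment> \<open>A linear combination over \<open>A\<close> sees only the values on
    \<open>A\<close>, so uniqueness needs coefficient functions that are extensional on
    \<open>A\<close>.\<close>
  have ex1: "\<exists>!a. a \<in> A \<rightarrow>\<^sub>E UNIV \<and> lincomb a A = v" if "v \<in> carrier V" for v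
    using iffD1[OF basis_criterion[OF finA sub] A] that by simp
  define c where "c v = (THE a. a \<in> A \<rightarrow>\<^sub>E UNIV \<and> lincomb a A = v)" for v
  have c: "c v \<in> A \<rightarrow>\<^sub>E UNIV" "lincomb (c v) A = v" if "v \<in> carrier V" for v
    using theI'[OF ex1[OF that]] unfolding c_def by auto
  have uniq: "c v x = a x" if "lincomb a A = v" "x \<in> A" for a v x
  proof -
    have v: "v \<in> carrier V" using that(1) sub by (auto intro: lincomb_closed)
    have "lincomb (restrict a A) A = v"
      unfolding that(1)[symmetric] lc by (rule M.finsum_cong') (use sub V in auto)
    then have "restrict a A = c v"
      using ex1[OF v] c[OF v] by (metis restrict_PiE_iff UNIV_I)
    then show ?thesis using that(2) by (metis restrict_apply')
  qed
  have "coords V A (\<lambda>x. x) (\<lambda>x v. c v x)"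
    unfolding coords_def
  proof (intro conjI ballI)
    show "(\<lambda>v. c v x) \<in> lin V field_vs" if x: "x \<in> A" for x
    proof (rule linI)
      fix v w assume v: "v \<in> carrier V" and w: "w \<in> carrier V"
      have "lincomb (\<lambda>x. c v x + c w x) A = finsum V (\<lambda>x. c v x \<odot>\<^bsub>V\<^esub> x \<oplus>\<^bsub>V\<^esub> c w x \<odot>\<^bsub>V\<^esub> x) A"
        unfolding lc by (rule M.finsum_cong') (use sub V in \<open>auto simp: vs_add_smult subset_iff\<close>)
      also have "\<dots> = lincomb (c v) A \<oplus>\<^bsub>V\<^esub> lincomb (c w) A"
        unfolding lc using sub by (intro vs_finsum_add V) (auto simp: V)
      finally have "lincomb (\<lambda>x. c v x + c w x) A = v \<oplus>\<^bsub>V\<^esub> w" using c v w by simp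
      then show "c (v \<oplus>\<^bsub>V\<^esub> w) x = c v x \<oplus>\<^bsub>field_vs\<^esub> c w x" using uniq x by simp
    next
      fix k v assume v: "v \<in> carrier V"
      have "lincomb (\<lambda>x. k * c v x) A = finsum V (\<lambda>x. k \<odot>\<^bsub>V\<^esub> (c v x \<odot>\<^bsub>V\<^esub> x)) A"
        unfolding lc by (rule M.finsum_cong') (use sub V in \<open>auto simp: vs_smult_smult subset_iff\<close>)
      also have "\<dots> = k \<odot>\<^bsub>V\<^esub> lincomb (c v) A"
        unfolding lc using sub by (intro vs_finsum_smult V) (auto simp: V)
      finally have "lincomb (\<lambda>x. k * c v x) A = k \<odot>\<^bsub>V\<^esub> v" using c v by simp
      then show "c (k \<odot>\<^bsub>V\<^esub> v) x = k \<odot>\<^bsub>field_vs\<^esub> c v x" using uniq x by simp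
    qed simp
    show "c y x = (if x = y then 1 else 0)" if x: "x \<in> A" and y: "y \<in> A" for x y
    proof -
      have yV: "y \<in> carrier V" using y sub by auto
      have "lincomb (\<lambda>x. if x = y then 1 else 0) A = 1 \<odot>\<^bsub>V\<^esub> y"
        unfolding lc using finA y sub V yV
        by (subst vs_finsum_single[where i = y]) (auto simp: subset_iff)
      then show ?thesis using uniq[OF _ x, of _ y] yV V by simp
    qed
    show "v = finsum V (\<lambda>x. c v x \<odot>\<^bsub>V\<^esub> x) A" if "v \<in> carrier V" for v
      using c(2)[OF that] by (simp add: lc)
  qed (use finA sub in auto)
  then show ?thesis by blast
qed

lemma fdvs_coords:
  fixes V :: "('k::field, 'v) module"
  assumes "fdvs V"
  obtains A :: "'v set" and \<phi> where "coords V A (\<lambda>x. x) \<phi>" "card A = vdim V"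
proof -
  have V: "vspace V" using assms by simp
  interpret vectorspace class_ring V by (rule V)
  obtain A where "finite A" "basis A" using finite_basis_exists assms by (auto simp: fdvs_def)
  then show ?thesis using basis_coords[OF V, of A] that dim_basis by metis
qed

section \<open>Dimensions of subspaces\<close>

text \<open>Independence inside \<open>U\<close> and inside \<open>V\<close> agree, so independent
  subsets of \<open>U\<close> have at most \<open>vdim V\<close> elements. A maximal one therefore
  exists, and it is a basis of \<open>U\<close>.\<close>

lemma subsp_basis:
  fixes V :: "('k::field, 'v) module"
  assumes fd: "fdvs V" and U: "subsp U V"
  obtains A where "finite A" "vectorspace.basis class_ring (V\<lparr>carrier := U\<rparr>) A" "A \<subseteq> U"
    "\<not> module.lin_dep class_ring V A" "card A \<le> vdim V"
proof -
  have V: "vspace V" using fd by simp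
  have sm: "submodule class_ring U V" using U V by (simp add: subsp_submodule)
  have VU: "vspace (V\<lparr>carrier := U\<rparr>)" by (rule subsp_vspace[OF V U])
  interpret V: vectorspace class_ring V by (rule V)
  interpret U: vectorspace class_ring "V\<lparr>carrier := U\<rparr>" by (rule VU)
  have UV: "U \<subseteq> carrier V" using U by (simp add: subsp_def)
  have li: "U.lin_dep A = V.lin_dep A" if "A \<subseteq> U" for A
    by (rule V.span_li_not_depend(2)[OF that sm])
  have "\<exists>A. finite A \<and> maximal A (\<lambda>S. S \<subseteq> carrier (V\<lparr>carrier := U\<rparr>) \<and> U.lin_indpt S)"
  proof (rule maximal_exists)
    fix A assume "A \<subseteq> carrier (V\<lparr>carrier := U\<rparr>) \<and> U.lin_indpt A"
    then show "finite A \<and> card A \<le> vdim V"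
      using V.li_le_dim[of A] li[of A] UV fd by (auto simp: fdvs_def)
  next
    show "{} \<subseteq> carrier (V\<lparr>carrier := U\<rparr>) \<and> U.lin_indpt {}"
      by (simp add: U.lin_dep_def)
  qed
  then obtain A where A: "finite A" "maximal A (\<lambda>S. S \<subseteq> carrier (V\<lparr>carrier := U\<rparr>) \<and> U.lin_indpt S)"
    by blast
  have "U.basis A" by (rule U.max_li_is_basis[OF A(2)])
  moreover have "A \<subseteq> U" "V.lin_indpt A" using A(2) li[of A] by (auto simp: maximal_def)
  moreover have "card A \<le> vdim V"
    using V.li_le_dim(2)[of A] calculation UV fd by (auto simp: fdvs_def)
  ultimately show ?thesis using that A(1) by blast
qed

lemma subsp_fdvs:
  fixes V :: "('k::field, 'v) module"
  assumes fd: "fdvs V" and U: "subsp U V"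
  shows "fdvs (V\<lparr>carrier := U\<rparr>)" "vdim (V\<lparr>carrier := U\<rparr>) \<le> vdim V"
proof -
  have VU: "vspace (V\<lparr>carrier := U\<rparr>)" using fd U by (simp add: subsp_vspace)
  interpret U: vectorspace class_ring "V\<lparr>carrier := U\<rparr>" by (rule VU)
  obtain A where A: "finite A" "U.basis A" "card A \<le> vdim V"
    using subsp_basis[OF fd U] by metis
  show "fdvs (V\<lparr>carrier := U\<rparr>)"
    using A VU unfolding fdvs_def U.fin_dim_def U.basis_def by blast
  show "vdim (V\<lparr>carrier := U\<rparr>) \<le> vdim V"
    using U.dim_basis A by simp
qed

text \<open>A basis of \<open>U\<close> is extended to one of \<open>V\<close> by the replacement
  theorem; its bound on the number of added vectors makes the union a spanning set of at most
  \<open>vdim V\<close> elements, hence a basis. The point is to have functionals on all of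
  \<open>V\<close> that are dual to vectors of \<open>U\<close>.\<close>

lemma subsp_adapted_coords:
  fixes V :: "('k::field, 'v) module"
  assumes fd: "fdvs V" and U: "subsp U V"
  obtains A B :: "'v set" and \<phi>
  where "coords V B (\<lambda>x. x) \<phi>" "A \<subseteq> B" "A \<subseteq> U" "card A = vdim (V\<lparr>carrier := U\<rparr>)"
    "card B = vdim V"
proof -
  have V: "vspace V" using fd by simp
  have VU: "vspace (V\<lparr>carrier := U\<rparr>)" by (rule subsp_vspace[OF V U])
  interpret V: vectorspace class_ring V by (rule V)
  interpret U: vectorspace class_ring "V\<lparr>carrier := U\<rparr>" by (rule VU)
  obtain A where A: "finite A" "U.basis A" "A \<subseteq> U" "V.lin_indpt A"
    using subsp_basis[OF fd U] by metis
  have UV: "U \<subseteq> carrier V" using U by (simp add: subsp_def)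
  obtain B where B: "finite B" "V.basis B" using V.finite_basis_exists fd by (auto simp: fdvs_def)
  have B': "B \<subseteq> carrier V" "V.gen_set B" using B(2) by (auto simp: V.basis_def)
  obtain C where C: "finite C" "C \<subseteq> carrier V" "C \<inter> A = {}" "int (card C) \<le> int (card B) - int (card A)"
    "V.span (A \<union> C) = V.span B"
    using V.replacement[OF A(1) B(1) B'(1) A(4)] A(3) B'(2) UV by blast
  have bas: "V.basis (A \<union> C)"
  proof (rule V.dim_gen_is_basis)
    show "card (A \<union> C) \<le> V.dim"
      using C(1,3,4) A(1) V.dim_basis[OF B] by (simp add: card_Un_disjoint Int_commute)
  qed (use A C B' UV in auto)
  have "card A = vdim (V\<lparr>carrier := U\<rparr>)"
    using U.dim_basis A by simp
  moreover obtain \<phi> where "coords V (A \<union> C) (\<lambda>x. x) \<phi>"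
    using basis_coords[OF V _ bas] A(1) C(1) by auto
  ultimately show ?thesis
    using A C bas V.dim_basis[of "A \<union> C"] by (intro that[of "A \<union> C" \<phi> A]) auto
qed

text \<open>In an adapted basis the part lying in \<open>U\<close> has as many elements as the whole
  basis, so it is the whole basis.\<close>

lemma subsp_eq_carrier:
  fixes V :: "('k::field, 'v) module"
  assumes fd: "fdvs V" and U: "subsp U V" and dim: "vdim V \<le> vdim (V\<lparr>carrier := U\<rparr>)"
  shows "U = carrier V"
proof -
  have V: "vspace V" using fd by simp
  obtain A B \<phi> where c: "coords V B (\<lambda>x. x) \<phi>" "A \<subseteq> B" "A \<subseteq> U"
      "card A = vdim (V\<lparr>carrier := U\<rparr>)" "card B = vdim V"
    using subsp_adapted_coords[OF fd U] by metis
  interpret V: vectorspace class_ring V by (rule V)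
  have "finite B" using c by (simp add: coords_def)
  then have "A = B" using c dim by (metis card_seteq)
  then have "carrier V = V.span A"
    using coords_basis(2)[OF V c(1)] by (simp add: V.basis_def)
  also have "\<dots> \<subseteq> U"
    using V.span_is_subset[OF c(3)] U V by (simp add: subsp_submodule)
  finally show ?thesis using U by (auto simp: subsp_def)
qed

lemma vdim_mono:
  assumes "fdvs V" "subsp U V" "subsp U' V" "U \<subseteq> U'"
  shows "vdim (V\<lparr>carrier := U\<rparr>) \<le> vdim (V\<lparr>carrier := U'\<rparr>)"
proof -
  have "subsp U (V\<lparr>carrier := U'\<rparr>)"
    using assms by (auto simp: subsp_def)
  then show ?thesis
    using subsp_fdvs(2)[of "V\<lparr>carrier := U'\<rparr>" U] subsp_fdvs(1)[of V U'] assms by simp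
qed

section \<open>Rank-nullity and the dimensions of images and preimages\<close>

lemma rank_nullity:
  assumes f: "f \<in> lin M N" and M: "fdvs M" and N: "vspace N"
  shows "vdim (N\<lparr>carrier := f ` carrier M\<rparr>) + vdim (M\<lparr>carrier := {x \<in> carrier M. f x = \<zero>\<^bsub>N\<^esub>}\<rparr>) = vdim M"
proof -
  interpret linear_map class_ring M N f using assms by (intro linear_mapI) auto
  show ?thesis
    using rank_nullity M by (simp add: fdvs_def im_def ker_def)
qed

lemma fdvs_image:
  assumes f: "f \<in> lin M N" and M: "fdvs M" and N: "vspace N"
  shows "fdvs (N\<lparr>carrier := f ` carrier M\<rparr>)"
proof -
  have v: "vspace (N\<lparr>carrier := f ` carrier M\<rparr>)"
    using assms by (intro subsp_vspace subsp_range) auto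
  have "f \<in> lin M (N\<lparr>carrier := f ` carrier M\<rparr>)"
    using f by (auto simp: LinearCombinations.module_hom_def)
  then interpret linear_map class_ring M "N\<lparr>carrier := f ` carrier M\<rparr>" f
    using assms v by (intro linear_mapI) auto
  show ?thesis
    using surj_fin_dim M v by (simp add: fdvs_def)
qed

lemma fdvs_surj:
  assumes "f \<in> lin M N" "fdvs M" "vspace N" "f ` carrier M = carrier N"
  shows "fdvs N"
  using fdvs_image[OF assms(1-3)] assms(4) by simp

lemma vdim_zero: "vspace V \<Longrightarrow> vdim (V\<lparr>carrier := {\<zero>\<^bsub>V\<^esub>}\<rparr>) = 0"
proof -
  assume V: "vspace V"
  have "vspace (V\<lparr>carrier := {\<zero>\<^bsub>V\<^esub>}\<rparr>)" by (intro subsp_vspace subsp_zero V)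
  \<comment> \<open>The empty family is a basis of the zero space.\<close>
  moreover have "coords (V\<lparr>carrier := {\<zero>\<^bsub>V\<^esub>}\<rparr>) ({} :: nat set) b \<phi>" for b \<phi>
    using calculation by (simp add: coords_def)
  ultimately show ?thesis using coords_fdvs(2) card.empty by metis
qed

lemma lin_restrict: "f \<in> lin M N \<Longrightarrow> U \<subseteq> carrier M \<Longrightarrow> f \<in> lin (M\<lparr>carrier := U\<rparr>) N"
  by (auto simp: LinearCombinations.module_hom_def subset_iff Pi_def)

lemma vdim_image_le:
  assumes "f \<in> lin M N" "fdvs M" "vspace N" "subsp U M"
  shows "vdim (N\<lparr>carrier := f ` U\<rparr>) \<le> vdim (M\<lparr>carrier := U\<rparr>)"
  using rank_nullity[of f "M\<lparr>carrier := U\<rparr>" N] assms subsp_fdvs(1)[of M U] lin_restrict[of f M N U]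
  by (simp add: subsp_def)

lemma vdim_image_inj:
  assumes f: "f \<in> lin M N" and M: "fdvs M" and N: "vspace N" and U: "subsp U M"
    and inj: "\<And>x. x \<in> U \<Longrightarrow> f x = \<zero>\<^bsub>N\<^esub> \<Longrightarrow> x = \<zero>\<^bsub>M\<^esub>"
  shows "vdim (N\<lparr>carrier := f ` U\<rparr>) = vdim (M\<lparr>carrier := U\<rparr>)"
proof -
  have "{x \<in> U. f x = \<zero>\<^bsub>N\<^esub>} = {\<zero>\<^bsub>M\<^esub>}"
    using inj U lin_zero[OF f _ N] M by (auto simp: subsp_def)
  then show ?thesis
    using rank_nullity[of f "M\<lparr>carrier := U\<rparr>" N] subsp_fdvs(1)[OF M U]
      lin_restrict[OF f, of U] N U M vdim_zero[of M] by (simp add: subsp_def)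
qed

text \<open>Restricted to the preimage of \<open>U\<close>, the map has image \<open>U\<close> and
  still its full kernel, so comparing rank-nullity for the restriction and for \<open>f\<close>
  eliminates the kernel. The additive form avoids truncated subtraction.\<close>

lemma vdim_vimage:
  assumes f: "f \<in> lin M N" and M: "fdvs M" and N: "vspace N" and surj: "f ` carrier M = carrier N"
    and U: "subsp U N"
  shows "vdim (M\<lparr>carrier := {x \<in> carrier M. f x \<in> U}\<rparr>) + vdim N = vdim M + vdim (N\<lparr>carrier := U\<rparr>)"
proof -
  let ?U = "{x \<in> carrier M. f x \<in> U}"
  have sub: "subsp ?U M" using assms by (intro subsp_vimage) auto
  have "f ` ?U = U" using surj U by (auto simp: subsp_def)
  moreover have "{x \<in> ?U. f x = \<zero>\<^bsub>N\<^esub>} = {x \<in> carrier M. f x = \<zero>\<^bsub>N\<^esub>}" using U by (auto simp: subsp_def)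
  ultimately have "vdim (N\<lparr>carrier := U\<rparr>) + vdim (M\<lparr>carrier := {x \<in> carrier M. f x = \<zero>\<^bsub>N\<^esub>}\<rparr>) =
      vdim (M\<lparr>carrier := ?U\<rparr>)"
    using rank_nullity[of f "M\<lparr>carrier := ?U\<rparr>" N] subsp_fdvs(1)[OF M sub] lin_restrict[OF f, of ?U] N
    by simp
  then show ?thesis
    using rank_nullity[OF f M N] surj by simp
qed

lemma subsp_additive_subgroup:
  assumes V: "vspace V" and N: "subsp N V"
  shows "additive_subgroup N V"
proof (rule additive_subgroup.intro, rule group.subgroupI)
  show "group (add_monoid V)"
    using vspace_abelian_group[OF V] by (rule abelian_group.a_group)
  show "inv\<^bsub>add_monoid V\<^esub> a \<in> N" if "a \<in> N" for a
    using N that vs_neg_eq[OF V, of a] by (auto simp: subsp_def a_inv_def)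
qed (use N in \<open>auto simp: subsp_def\<close>)

section \<open>Quotients\<close>

text \<open>The vector space axioms are identities in the operations, so they pass along a
  surjection that respects these. It is applied to the map sending a vector to its coset.\<close>

lemma vspace_surj_image:
  fixes V :: "('k::field, 'v) module" and Q :: "('k, 'q) module"
  assumes V: "vspace V" and q: "q ` carrier V = carrier Q" and zero: "q \<zero>\<^bsub>V\<^esub> = \<zero>\<^bsub>Q\<^esub>"
    and add: "\<And>x y. x \<in> carrier V \<Longrightarrow> y \<in> carrier V \<Longrightarrow> q x \<oplus>\<^bsub>Q\<^esub> q y = q (x \<oplus>\<^bsub>V\<^esub> y)"
    and smult: "\<And>c x. x \<in> carrier V \<Longrightarrow> c \<odot>\<^bsub>Q\<^esub> q x = q (c \<odot>\<^bsub>V\<^esub> x)"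
  shows "vspace Q"
proof -
  note [simp] = V q[symmetric] zero[symmetric] add smult
  show ?thesis
    by (rule vspaceI) (auto simp: vs_add_assoc vs_add_left_comm vs_smult_smult vs_add_smult vs_smult_add vs_add_comm
        intro: arg_cong[where f = q])
qed

context
  fixes V :: "('k::field, 'v) module" and N :: "'v set"
  assumes V: "vspace V" and N: "subsp N V"
begin

interpretation abelian_subgroup N V
  by (rule abelian_subgroupI3[OF subsp_additive_subgroup[OF V N] vspace_abelian_group[OF V]])

lemma coset_eq_iff:
  assumes "x \<in> carrier V" "y \<in> carrier V"
  shows "N +>\<^bsub>V\<^esub> x = N +>\<^bsub>V\<^esub> y \<longleftrightarrow> x \<ominus>\<^bsub>V\<^esub> y \<in> N"
  using a_rcos_module[of y x] a_repr_independence[OF _ _ a_subgroup] a_rcos_self assms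
  unfolding a_minus_def by metis

lemma coset_zero: "N +>\<^bsub>V\<^esub> \<zero>\<^bsub>V\<^esub> = N"
  using a_coset_add_zero a_subset by blast

lemma coset_eq_zero_iff: "x \<in> carrier V \<Longrightarrow> N +>\<^bsub>V\<^esub> x = N \<longleftrightarrow> x \<in> N"
  using coset_eq_iff[of x "\<zero>\<^bsub>V\<^esub>"] coset_zero V by simp

lemma coset_add:
  "x \<in> carrier V \<Longrightarrow> y \<in> carrier V \<Longrightarrow> set_add V (N +>\<^bsub>V\<^esub> x) (N +>\<^bsub>V\<^esub> y) = N +>\<^bsub>V\<^esub> (x \<oplus>\<^bsub>V\<^esub> y)"
  by (rule a_rcos_sum)

text \<open>For \<open>c = 0\<close> the multiples of a coset form a single vector, and the summand
  \<open>N\<close> restores the coset; in general \<open>N\<close> absorbs the multiple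
  \<open>c n\<close> of an element of \<open>N\<close>.\<close>

lemma coset_smult:
  assumes x: "x \<in> carrier V"
  shows "set_add V N ((\<lambda>y. c \<odot>\<^bsub>V\<^esub> y) ` (N +>\<^bsub>V\<^esub> x)) = N +>\<^bsub>V\<^esub> (c \<odot>\<^bsub>V\<^esub> x)"
proof -
  have N': "n \<in> carrier V" if "n \<in> N" for n using N that by (auto simp: subsp_def)
  show ?thesis
  proof (intro equalityI subsetI)
    fix y assume "y \<in> set_add V N ((\<lambda>y. c \<odot>\<^bsub>V\<^esub> y) ` (N +>\<^bsub>V\<^esub> x))"
    then obtain n n' where n: "n \<in> N" "n' \<in> N" "y = n \<oplus>\<^bsub>V\<^esub> c \<odot>\<^bsub>V\<^esub> (n' \<oplus>\<^bsub>V\<^esub> x)"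
      by (auto simp: set_add_def' a_r_coset_def')
    then have "y = (n \<oplus>\<^bsub>V\<^esub> c \<odot>\<^bsub>V\<^esub> n') \<oplus>\<^bsub>V\<^esub> c \<odot>\<^bsub>V\<^esub> x"
      using N' x V by (simp add: vs_smult_add vs_add_assoc)
    then show "y \<in> N +>\<^bsub>V\<^esub> (c \<odot>\<^bsub>V\<^esub> x)"
      using n N by (auto simp: a_r_coset_def' subsp_def)
  next
    fix y assume "y \<in> N +>\<^bsub>V\<^esub> (c \<odot>\<^bsub>V\<^esub> x)"
    then obtain n where n: "n \<in> N" "y = n \<oplus>\<^bsub>V\<^esub> c \<odot>\<^bsub>V\<^esub> x"
      by (auto simp: a_r_coset_def')
    moreover have "x \<in> N +>\<^bsub>V\<^esub> x" using a_rcos_self[OF x] .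
    ultimately show "y \<in> set_add V N ((\<lambda>y. c \<odot>\<^bsub>V\<^esub> y) ` (N +>\<^bsub>V\<^esub> x))"
      unfolding set_add_def' by blast
  qed
qed

lemma quotient_vs_simps:
  "carrier (quotient_vs V N) = (\<lambda>x. N +>\<^bsub>V\<^esub> x) ` carrier V"
  "\<zero>\<^bsub>quotient_vs V N\<^esub> = N"
  "x \<in> carrier V \<Longrightarrow> y \<in> carrier V \<Longrightarrow>
    (N +>\<^bsub>V\<^esub> x) \<oplus>\<^bsub>quotient_vs V N\<^esub> (N +>\<^bsub>V\<^esub> y) = N +>\<^bsub>V\<^esub> (x \<oplus>\<^bsub>V\<^esub> y)"
  "x \<in> carrier V \<Longrightarrow> c \<odot>\<^bsub>quotient_vs V N\<^esub> (N +>\<^bsub>V\<^esub> x) = N +>\<^bsub>V\<^esub> (c \<odot>\<^bsub>V\<^esub> x)"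
  by (auto simp: quotient_vs_def A_RCOSETS_def' coset_add coset_smult)

lemma vspace_quotient_vs: "vspace (quotient_vs V N)"
  by (rule vspace_surj_image[OF V, where q = "\<lambda>x. N +>\<^bsub>V\<^esub> x"]) (simp_all add: quotient_vs_simps coset_zero)

lemma lin_coset: "(\<lambda>x. N +>\<^bsub>V\<^esub> x) \<in> lin V (quotient_vs V N)"
  by (rule linI) (simp_all add: quotient_vs_simps)

lemma quotient_lift:
  assumes f: "f \<in> lin V P" and P: "vspace P" and 0: "\<And>x. x \<in> N \<Longrightarrow> f x = \<zero>\<^bsub>P\<^esub>"
  obtains g where "g \<in> lin (quotient_vs V N) P" "\<And>x. x \<in> carrier V \<Longrightarrow> g (N +>\<^bsub>V\<^esub> x) = f x"
proof -
  \<comment> \<open>The value on a coset is read off from a chosen representative; two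
    representatives differ by an element of \<open>N\<close>, where \<open>f\<close>
    vanishes.\<close>
  define g where "g X = f (SOME x. x \<in> carrier V \<and> N +>\<^bsub>V\<^esub> x = X)" for X
  have g: "g (N +>\<^bsub>V\<^esub> x) = f x" if x: "x \<in> carrier V" for x
  proof -
    define y where "y = (SOME y. y \<in> carrier V \<and> N +>\<^bsub>V\<^esub> y = N +>\<^bsub>V\<^esub> x)"
    have y: "y \<in> carrier V \<and> N +>\<^bsub>V\<^esub> y = N +>\<^bsub>V\<^esub> x"
      unfolding y_def by (rule someI_ex) (use x in blast)
    have gy: "g (N +>\<^bsub>V\<^esub> x) = f y"
      unfolding g_def y_def ..
    from y have "f (y \<ominus>\<^bsub>V\<^esub> x) = \<zero>\<^bsub>P\<^esub>" using x coset_eq_iff[of y x] by (intro 0) blast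
    then have "f y \<ominus>\<^bsub>P\<^esub> f x = \<zero>\<^bsub>P\<^esub>" using lin_minus[OF f V P _ x] y by metis
    then show ?thesis
      unfolding gy using vs_minus_zeroD[OF P] lin_closed[OF f] x y by blast
  qed
  have "g \<in> lin (quotient_vs V N) P"
    by (rule linI) (auto simp: quotient_vs_simps g V lin_closed[OF f] lin_add[OF f] lin_smult[OF f])
  with g that show ?thesis by blast
qed

end

section \<open>Spaces of linear maps\<close>

lemma hom_vs_simps:
  "f \<in> carrier (hom_vs M N) \<longleftrightarrow> f \<in> extensional (carrier M) \<and> f \<in> lin M N"
  "\<zero>\<^bsub>hom_vs M N\<^esub> = (\<lambda>x\<in>carrier M. \<zero>\<^bsub>N\<^esub>)"
  "f \<oplus>\<^bsub>hom_vs M N\<^esub> g = (\<lambda>x\<in>carrier M. f x \<oplus>\<^bsub>N\<^esub> g x)"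
  "c \<odot>\<^bsub>hom_vs M N\<^esub> f = (\<lambda>x\<in>carrier M. c \<odot>\<^bsub>N\<^esub> f x)"
  by (simp_all add: hom_vs_def)

lemma hom_vs_lin: "f \<in> carrier (hom_vs M N) \<Longrightarrow> f \<in> lin M N"
  by (simp add: hom_vs_simps)

lemma hom_vs_closed: "f \<in> carrier (hom_vs M N) \<Longrightarrow> x \<in> carrier M \<Longrightarrow> f x \<in> carrier N"
  using hom_vs_lin lin_closed by fast

lemma hom_vs_eqI:
  "f \<in> carrier (hom_vs M N) \<Longrightarrow> g \<in> carrier (hom_vs M N) \<Longrightarrow>
    (\<And>x. x \<in> carrier M \<Longrightarrow> f x = g x) \<Longrightarrow> f = g"
  by (auto simp: hom_vs_simps intro: extensionalityI)

lemma restrict_hom_vs: "vspace M \<Longrightarrow> f \<in> lin M N \<Longrightarrow> restrict f (carrier M) \<in> carrier (hom_vs M N)"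
  by (simp add: hom_vs_simps lin_cong[of f])

lemma vspace_hom_vs:
  assumes M: "vspace M" and N: "vspace N"
  shows "vspace (hom_vs M N)"
proof -
  have cl: "f x \<in> carrier N" if "f \<in> lin M N" "x \<in> carrier M" for f x
    using that lin_closed by fast
  have ext: "restrict f (carrier M) = f" if "f \<in> extensional (carrier M)" for f :: "_ \<Rightarrow> 'c"
    using that by (rule extensional_restrict)
  note [simp] = M N hom_vs_simps cl
  show ?thesis
  proof (rule vspaceI)
    show "\<zero>\<^bsub>hom_vs M N\<^esub> \<in> carrier (hom_vs M N)"
      using restrict_hom_vs[OF M lin_const_zero[OF N]] by simp
    show "f \<oplus>\<^bsub>hom_vs M N\<^esub> g \<in> carrier (hom_vs M N)"
      if "f \<in> carrier (hom_vs M N)" "g \<in> carrier (hom_vs M N)" for f g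
      using that restrict_hom_vs[OF M lin_plus[of f M N g]] by simp
    show "c \<odot>\<^bsub>hom_vs M N\<^esub> f \<in> carrier (hom_vs M N)" if "f \<in> carrier (hom_vs M N)" for f c
      using that restrict_hom_vs[OF M lin_scale[of f M N]] by simp
  qed (auto intro!: restrict_ext extensionalityI[where A = "carrier M"]
      simp: vs_add_comm vs_add_assoc vs_add_left_comm vs_smult_smult vs_add_smult vs_smult_add)
qed

lemma lin_hom_vs_apply: "x \<in> carrier M \<Longrightarrow> (\<lambda>f. f x) \<in> lin (hom_vs M N) N"
  by (rule linI) (auto simp: hom_vs_simps lin_closed)

text \<open>Linearity of a map into a space of homomorphisms is tested by evaluating at each point.
  This is the currying step that turns multilinear formulas into linear maps with values in
  \<open>hom_vs\<close>.\<close>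

lemma lin_into_hom_vs:
  assumes "\<And>v. v \<in> carrier V \<Longrightarrow> F v \<in> carrier (hom_vs M N)"
    and "\<And>x. x \<in> carrier M \<Longrightarrow> (\<lambda>v. F v x) \<in> lin V N" and V: "vspace V" and M: "vspace M" and N: "vspace N"
  shows "F \<in> lin V (hom_vs M N)"
proof (rule linI)
  fix v w assume v: "v \<in> carrier V" and w: "w \<in> carrier V"
  have "F v \<oplus>\<^bsub>hom_vs M N\<^esub> F w \<in> carrier (hom_vs M N)"
    using assms v w by (intro vs_add_closed vspace_hom_vs) auto
  then show "F (v \<oplus>\<^bsub>V\<^esub> w) = F v \<oplus>\<^bsub>hom_vs M N\<^esub> F w"
    using v w V assms(1) by (intro hom_vs_eqI[of _ M N]) (simp_all add: hom_vs_simps(3) lin_add[OF assms(2)])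
next
  fix c v assume v: "v \<in> carrier V"
  have "c \<odot>\<^bsub>hom_vs M N\<^esub> F v \<in> carrier (hom_vs M N)"
    using assms v by (intro vs_smult_closed vspace_hom_vs) auto
  then show "F (c \<odot>\<^bsub>V\<^esub> v) = c \<odot>\<^bsub>hom_vs M N\<^esub> F v"
    using v V assms(1) by (intro hom_vs_eqI[of _ M N]) (simp_all add: hom_vs_simps(4) lin_smult[OF assms(2)])
qed (use assms in auto)

section \<open>Direct sums\<close>

lemma direct_sum_simps [simp]:
  "carrier (direct_sum M N) = carrier M \<times> carrier N"
  "\<zero>\<^bsub>direct_sum M N\<^esub> = (\<zero>\<^bsub>M\<^esub>, \<zero>\<^bsub>N\<^esub>)"
  "p \<oplus>\<^bsub>direct_sum M N\<^esub> q = (fst p \<oplus>\<^bsub>M\<^esub> fst q, snd p \<oplus>\<^bsub>N\<^esub> snd q)"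
  "c \<odot>\<^bsub>direct_sum M N\<^esub> p = (c \<odot>\<^bsub>M\<^esub> fst p, c \<odot>\<^bsub>N\<^esub> snd p)"
  by (simp_all add: direct_sum_def)

lemma vspace_direct_sum: "vspace M \<Longrightarrow> vspace N \<Longrightarrow> vspace (direct_sum M N)"
  by (rule direct_sum_is_vs)

lemma lin_fst: "fst \<in> lin (direct_sum M N) M" and lin_snd: "snd \<in> lin (direct_sum M N) N"
  by (rule linI, auto)+

lemma lin_Pair: "f \<in> lin V M \<Longrightarrow> g \<in> lin V N \<Longrightarrow> (\<lambda>x. (f x, g x)) \<in> lin V (direct_sum M N)"
  by (rule linI) (simp_all add: lin_closed lin_add lin_smult)

section \<open>Tensor products\<close>

lemma free_vs_simps:
  "carrier (free_vs S) = {f. Poly_Mapping.keys f \<subseteq> S}" "\<zero>\<^bsub>free_vs S\<^esub> = 0" "f \<oplus>\<^bsub>free_vs S\<^esub> g = f + g"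
  "c \<odot>\<^bsub>free_vs S\<^esub> f = Poly_Mapping.map ((*) c) f"
  by (simp_all add: free_vs_def)

lemma lookup_map_mult [simp]:
  "Poly_Mapping.lookup (Poly_Mapping.map ((*) (c :: 'k::field)) f) s = c * Poly_Mapping.lookup f s"
  by (simp add: map.rep_eq when_def)

lemma map_mult_minus_one [simp]: "Poly_Mapping.map ((*) (- 1 :: 'k::field)) f = - f"
  by (rule poly_mapping_eqI) simp

lemma map_mult_single [simp]:
  "Poly_Mapping.map ((*) (c :: 'k::field)) (Poly_Mapping.single x a) = Poly_Mapping.single x (c * a)"
  by (rule poly_mapping_eqI) (simp add: lookup_single when_def)

text \<open>Only an inclusion, since multiplication by zero empties the support.\<close>

lemma keys_map_mult: "Poly_Mapping.keys (Poly_Mapping.map ((*) (c :: 'k::field)) f) \<subseteq> Poly_Mapping.keys f"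
  by (auto simp: in_keys_iff)

lemma vspace_free_vs: "vspace (free_vs S)"
proof (rule vspaceI)
  show "c \<odot>\<^bsub>free_vs S\<^esub> x \<in> carrier (free_vs S)" if "x \<in> carrier (free_vs S)" for c x
    using that keys_map_mult[of c x] by (auto simp: free_vs_simps)
  show "x \<oplus>\<^bsub>free_vs S\<^esub> y \<in> carrier (free_vs S)"
    if "x \<in> carrier (free_vs S)" "y \<in> carrier (free_vs S)" for x y
    using that Poly_Mapping.keys_add[of x y] by (auto simp: free_vs_simps)
qed (auto simp: free_vs_simps lookup_add algebra_simps intro!: poly_mapping_eqI)

lemma free_vs_minus:
  "f \<in> carrier (free_vs S) \<Longrightarrow> g \<in> carrier (free_vs S) \<Longrightarrow> f \<ominus>\<^bsub>free_vs S\<^esub> g = f - g"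
  by (subst vs_minus_eq[OF vspace_free_vs]) (simp_all add: free_vs_simps)

lemma free_lift:
  fixes P :: "('k::field, 'p) module" and f :: "'s \<Rightarrow> 'p"
  assumes P: "vspace P" and f: "\<And>s. s \<in> S \<Longrightarrow> f s \<in> carrier P"
  obtains F where "F \<in> lin (free_vs S) P"
    "\<And>s c. s \<in> S \<Longrightarrow> F (Poly_Mapping.single s c) = c \<odot>\<^bsub>P\<^esub> f s"
proof -
  interpret abelian_monoid P by (rule vspace_abelian_monoid[OF P])
  define F where "F g = finsum P (\<lambda>s. Poly_Mapping.lookup g s \<odot>\<^bsub>P\<^esub> f s) (Poly_Mapping.keys g)"
    for g :: "'s \<Rightarrow>\<^sub>0 'k"
  \<comment> \<open>The sum over the support may be taken over any larger finite subset of
    \<open>S\<close>, as the new terms have coefficient zero. This gives two summands a common index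
    set.\<close>
  have F: "F g = finsum P (\<lambda>s. Poly_Mapping.lookup g s \<odot>\<^bsub>P\<^esub> f s) A"
    if "finite A" "Poly_Mapping.keys g \<subseteq> A" "A \<subseteq> S" for g A
    unfolding F_def using that f P
    by (intro add.finprod_mono_neutral_cong_left) (auto simp: in_keys_iff subset_iff)
  have "F \<in> lin (free_vs S) P"
  proof (rule linI)
    show "F g \<in> carrier P" if "g \<in> carrier (free_vs S)" for g
      unfolding F_def using that f P by (intro finsum_closed) (auto simp: free_vs_simps)
  next
    fix g h :: "'s \<Rightarrow>\<^sub>0 'k"
    assume "g \<in> carrier (free_vs S)" "h \<in> carrier (free_vs S)"
    then have A: "Poly_Mapping.keys g \<union> Poly_Mapping.keys h \<subseteq> S" by (simp add: free_vs_simps)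
    let ?A = "Poly_Mapping.keys g \<union> Poly_Mapping.keys h"
    have "F (g + h) = finsum P (\<lambda>s. Poly_Mapping.lookup g s \<odot>\<^bsub>P\<^esub> f s \<oplus>\<^bsub>P\<^esub> Poly_Mapping.lookup h s \<odot>\<^bsub>P\<^esub> f s) ?A"
      by (subst F[of ?A]; (rule finsum_cong')?)
        (use A f P Poly_Mapping.keys_add[of g h] in \<open>auto simp: lookup_add vs_add_smult subset_iff\<close>)
    also have "\<dots> = F g \<oplus>\<^bsub>P\<^esub> F h"
      using A f P by (simp add: F[of ?A] subset_iff Pi_def vs_finsum_add)
    finally show "F (g \<oplus>\<^bsub>free_vs S\<^esub> h) = F g \<oplus>\<^bsub>P\<^esub> F h" by (simp add: free_vs_simps)
  next
    fix c :: 'k and g :: "'s \<Rightarrow>\<^sub>0 'k"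
    assume "g \<in> carrier (free_vs S)"
    then have A: "Poly_Mapping.keys g \<subseteq> S" by (simp add: free_vs_simps)
    have "F (Poly_Mapping.map ((*) c) g) = finsum P (\<lambda>s. c \<odot>\<^bsub>P\<^esub> (Poly_Mapping.lookup g s \<odot>\<^bsub>P\<^esub> f s)) (Poly_Mapping.keys g)"
      using A f P keys_map_mult[of c g]
      by (subst F[of "Poly_Mapping.keys g"]) (auto simp: vs_smult_smult subset_iff intro!: finsum_cong')
    also have "\<dots> = c \<odot>\<^bsub>P\<^esub> F g"
      unfolding F_def using A f P by (intro vs_finsum_smult) auto
    finally show "F (c \<odot>\<^bsub>free_vs S\<^esub> g) = c \<odot>\<^bsub>P\<^esub> F g" by (simp add: free_vs_simps)
  qed
  moreover have "F (Poly_Mapping.single s c) = c \<odot>\<^bsub>P\<^esub> f s" if "s \<in> S" for s c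
    using that f P by (subst F[of "{s}"]) (auto simp: vs_finsum_insert)
  ultimately show ?thesis using that by blast
qed

text \<open>An element is dismantled by splitting off one key of its finite support at a time. The
  case of zero has to be stated because \<open>S\<close> may be empty.\<close>

lemma free_vs_induct [consumes 1, case_names single add]:
  assumes g: "g \<in> carrier (free_vs S)"
    and single: "\<And>s c. s \<in> S \<Longrightarrow> Q (Poly_Mapping.single s c)"
    and add: "\<And>f g. f \<in> carrier (free_vs S) \<Longrightarrow> g \<in> carrier (free_vs S) \<Longrightarrow> Q f \<Longrightarrow> Q g \<Longrightarrow> Q (f + g)"
    and zero: "Q 0"
  shows "Q g"
proof -
  have "Q g" if "finite A" "Poly_Mapping.keys g \<subseteq> A" "A \<subseteq> S" for A g
    using that
  proof (induction A arbitrary: g rule: finite_induct)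
    case empty
    then show ?case using zero by simp
  next
    case (insert a A)
    let ?s = "Poly_Mapping.single a (Poly_Mapping.lookup g a)"
    have k: "Poly_Mapping.keys (g - ?s) \<subseteq> A"
      using insert.prems by (auto simp: in_keys_iff lookup_minus lookup_single when_def split: if_splits)
    have "Q (g - ?s + ?s)"
    proof (rule add)
      show "g - ?s \<in> carrier (free_vs S)" "?s \<in> carrier (free_vs S)"
        using k insert.prems by (auto simp: free_vs_simps)
      show "Q (g - ?s)" using insert.IH[of "g - ?s"] k insert.prems by auto
      show "Q ?s" using single insert.prems by auto
    qed
    then show ?case by simp
  qed
  from this[OF finite_keys order_refl] show ?thesis using g by (simp add: free_vs_simps)
qed

definition bilin ::
  "('k::field, 'm) module \<Rightarrow> ('k, 'n) module \<Rightarrow> ('k, 'p) module \<Rightarrow> ('m \<Rightarrow> 'n \<Rightarrow> 'p) \<Rightarrow> bool" where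
  "bilin M N P f \<longleftrightarrow> (\<forall>y\<in>carrier N. (\<lambda>x. f x y) \<in> lin M P) \<and> (\<forall>x\<in>carrier M. f x \<in> lin N P)"

lemma bilinD:
  assumes "bilin M N P f" "x \<in> carrier M" "x' \<in> carrier M" "y \<in> carrier N" "y' \<in> carrier N"
  shows "f x y \<in> carrier P" "f (x \<oplus>\<^bsub>M\<^esub> x') y = f x y \<oplus>\<^bsub>P\<^esub> f x' y"
    "f (c \<odot>\<^bsub>M\<^esub> x) y = c \<odot>\<^bsub>P\<^esub> f x y" "f x (y \<oplus>\<^bsub>N\<^esub> y') = f x y \<oplus>\<^bsub>P\<^esub> f x y'"
    "f x (c \<odot>\<^bsub>N\<^esub> y) = c \<odot>\<^bsub>P\<^esub> f x y"
  using assms by (auto simp: bilin_def LinearCombinations.module_hom_def)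

context
  fixes M :: "('k::field, 'm) module" and N :: "('k, 'n) module"
  assumes M: "vspace M" and N: "vspace N"
begin

abbreviation (input) "free_MN \<equiv> free_vs (carrier M \<times> carrier N) :: ('k, 'm \<times> 'n \<Rightarrow>\<^sub>0 'k) module"

lemma bilinear_relations_closed: "bilinear_relations M N \<subseteq> carrier free_MN"
proof -
  have *: "x - y \<in> carrier free_MN" if "x \<in> carrier free_MN" "y \<in> carrier free_MN" for x y
    using free_vs_minus[OF that] vs_minus_closed[OF vspace_free_vs that] by simp
  show ?thesis
    unfolding bilinear_relations_def using M N by (auto intro!: *) (auto simp: free_vs_simps split: if_splits)
qed

lemma subsp_tensor_null: "subsp (tensor_null M N) free_MN"
proof -
  interpret vectorspace class_ring free_MN by (rule vspace_free_vs)
  show ?thesis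
    using span_is_submodule[OF bilinear_relations_closed] by (simp add: subsp_submodule vspace_free_vs tensor_null_def)
qed

lemma bilinear_relations_null: "g \<in> bilinear_relations M N \<Longrightarrow> g \<in> tensor_null M N"
proof -
  interpret vectorspace class_ring free_MN by (rule vspace_free_vs)
  show "g \<in> bilinear_relations M N \<Longrightarrow> g \<in> tensor_null M N"
    using in_own_span[OF bilinear_relations_closed] by (auto simp: tensor_null_def)
qed

lemma vspace_tensor: "vspace (tensor M N)"
  unfolding tensor_def by (rule vspace_quotient_vs[OF vspace_free_vs subsp_tensor_null])

lemmas tensor_simps = quotient_vs_simps[OF vspace_free_vs subsp_tensor_null, folded tensor_def]

lemma single_closed: "x \<in> carrier M \<Longrightarrow> y \<in> carrier N \<Longrightarrow> Poly_Mapping.single (x, y) c \<in> carrier free_MN"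
  by (simp add: free_vs_simps)

lemma tens_smult_eq:
  "x \<in> carrier M \<Longrightarrow> y \<in> carrier N \<Longrightarrow>
    tensor_null M N +>\<^bsub>free_MN\<^esub> Poly_Mapping.single (x, y) c = c \<odot>\<^bsub>tensor M N\<^esub> tens M N x y"
  unfolding tens_def by (simp add: tensor_simps single_closed) (simp add: free_vs_simps)

lemma tens_closed: "x \<in> carrier M \<Longrightarrow> y \<in> carrier N \<Longrightarrow> tens M N x y \<in> carrier (tensor M N)"
  unfolding tens_def by (simp add: tensor_simps single_closed)

text \<open>For each of the four laws the difference of the two representatives in the free space is
  literally one of the generating relations.\<close>

lemma bilin_tens: "bilin M N (tensor M N) (tens M N)"
proof -
  let ?q = "\<lambda>g. tensor_null M N +>\<^bsub>free_MN\<^esub> g"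
  have eq: "?q f = ?q g" if "f - g \<in> tensor_null M N" "f \<in> carrier free_MN" "g \<in> carrier free_MN" for f g
    using that by (simp add: coset_eq_iff[OF vspace_free_vs subsp_tensor_null] free_vs_minus)
  have add: "tens M N x y \<oplus>\<^bsub>tensor M N\<^esub> tens M N x' y' =
      ?q (Poly_Mapping.single (x, y) 1 + Poly_Mapping.single (x', y') 1)"
    if "x \<in> carrier M" "y \<in> carrier N" "x' \<in> carrier M" "y' \<in> carrier N" for x y x' y'
    unfolding tens_def using that by (simp add: tensor_simps single_closed) (simp add: free_vs_simps)
  have cl: "f + g \<in> carrier free_MN" if "f \<in> carrier free_MN" "g \<in> carrier free_MN" for f g
    using vs_add_closed[OF vspace_free_vs that] by (simp add: free_vs_simps)
  show ?thesis
    unfolding bilin_def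
  proof (intro conjI ballI linI)
    fix y x x' assume c: "y \<in> carrier N" "x \<in> carrier M" "x' \<in> carrier M"
    then show "tens M N (x \<oplus>\<^bsub>M\<^esub> x') y = tens M N x y \<oplus>\<^bsub>tensor M N\<^esub> tens M N x' y"
      unfolding add[OF c(2,1,3,1)] unfolding tens_def using M
      by (intro eq bilinear_relations_null cl single_closed) (auto simp: bilinear_relations_def simp flip: diff_diff_eq)
  next
    fix x y y' assume c: "x \<in> carrier M" "y \<in> carrier N" "y' \<in> carrier N"
    then show "tens M N x (y \<oplus>\<^bsub>N\<^esub> y') = tens M N x y \<oplus>\<^bsub>tensor M N\<^esub> tens M N x y'"
      unfolding add[OF c(1,2,1,3)] unfolding tens_def using N
      by (intro eq bilinear_relations_null cl single_closed) (auto simp: bilinear_relations_def simp flip: diff_diff_eq)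
  next
    fix y c x assume *: "y \<in> carrier N" "x \<in> carrier M"
    show "tens M N (c \<odot>\<^bsub>M\<^esub> x) y = c \<odot>\<^bsub>tensor M N\<^esub> tens M N x y"
      unfolding tens_smult_eq[OF *(2,1), symmetric] unfolding tens_def using M *
      by (intro eq bilinear_relations_null single_closed) (auto simp: bilinear_relations_def)
  next
    fix x c y assume *: "y \<in> carrier N" "x \<in> carrier M"
    show "tens M N x (c \<odot>\<^bsub>N\<^esub> y) = c \<odot>\<^bsub>tensor M N\<^esub> tens M N x y"
      unfolding tens_smult_eq[OF *(2,1), symmetric] unfolding tens_def using N *
      by (intro eq bilinear_relations_null single_closed) (auto simp: bilinear_relations_def)
  qed (auto intro: tens_closed)
qed

lemmas tens_simps = bilinD(2-5)[OF bilin_tens]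

text \<open>There is no case for scalars: a multiple of a pure tensor is again pure, the scalar
  moving into the left factor. Hence the rule also applies to properties closed under addition only,
  such as membership in an additive ideal.\<close>

lemma tensor_induct_aux [consumes 1, case_names tens add]:
  assumes t: "t \<in> carrier (tensor M N)"
    and tens: "\<And>x y. x \<in> carrier M \<Longrightarrow> y \<in> carrier N \<Longrightarrow> Q (tens M N x y)"
    and add: "\<And>s t. s \<in> carrier (tensor M N) \<Longrightarrow> t \<in> carrier (tensor M N) \<Longrightarrow> Q s \<Longrightarrow> Q t \<Longrightarrow>
      Q (s \<oplus>\<^bsub>tensor M N\<^esub> t)"
  shows "Q t"
proof -
  let ?q = "\<lambda>g. tensor_null M N +>\<^bsub>free_MN\<^esub> g"
  have s: "Q (?q (Poly_Mapping.single (x, y) c))" if "x \<in> carrier M" "y \<in> carrier N" for x y c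
    using that tens[of "c \<odot>\<^bsub>M\<^esub> x" y] M N by (simp add: tens_smult_eq tens_simps)
  have "Q (?q g)" if "g \<in> carrier free_MN" for g
    using that
  proof (induction g rule: free_vs_induct)
    case (single s c)
    then show ?case using s by auto
  next
    case (add f g)
    then show ?case
      using assms(3)[of "?q f" "?q g"] by (simp add: tensor_simps) (simp add: free_vs_simps)
  next
    \<comment> \<open>The zero tensor is itself the pure tensor of the two zero vectors.\<close>
    show "Q (?q 0)" using s[of "\<zero>\<^bsub>M\<^esub>" "\<zero>\<^bsub>N\<^esub>" 0] M N by simp
  qed
  then show ?thesis using t by (auto simp: tensor_simps)
qed

text \<open>The linear extension of \<open>f\<close> to the free space kills the bilinear relations.
  Its kernel is a subspace, so it contains their span, and the extension descends to the
  quotient.\<close>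

lemma tensor_lift:
  fixes P :: "('k, 'p) module"
  assumes f: "bilin M N P f" and P: "vspace P"
  obtains g where "g \<in> lin (tensor M N) P"
    "\<And>x y. x \<in> carrier M \<Longrightarrow> y \<in> carrier N \<Longrightarrow> g (tens M N x y) = f x y"
proof -
  let ?r = "bilinear_relations M N"
  obtain F where F: "F \<in> lin free_MN P"
    and Fs: "\<And>s c. s \<in> carrier M \<times> carrier N \<Longrightarrow> F (Poly_Mapping.single s c) = c \<odot>\<^bsub>P\<^esub> case_prod f s"
    using free_lift[OF P, of "carrier M \<times> carrier N" "case_prod f"] bilinD(1)[OF f] by (metis (no_types, lifting) SigmaE split_conv)
  have Fs': "F (Poly_Mapping.single (x, y) c) = c \<odot>\<^bsub>P\<^esub> f x y" if "x \<in> carrier M" "y \<in> carrier N" for x y c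
    using Fs[of "(x, y)"] that by simp
  have Fm: "F (g - h) = F g \<ominus>\<^bsub>P\<^esub> F h" if "g \<in> carrier free_MN" "h \<in> carrier free_MN" for g h
    using lin_minus[OF F vspace_free_vs P that] free_vs_minus[OF that] by simp
  have cl: "g - h \<in> carrier free_MN" if "g \<in> carrier free_MN" "h \<in> carrier free_MN" for g h
    using free_vs_minus[OF that] vs_minus_closed[OF vspace_free_vs that] by simp
  have fcl: "f x y \<in> carrier P" if "x \<in> carrier M" "y \<in> carrier N" for x y
    using bilinD(1)[OF f] that by blast
  have canc: "(p \<oplus>\<^bsub>P\<^esub> q) \<ominus>\<^bsub>P\<^esub> p \<ominus>\<^bsub>P\<^esub> q = \<zero>\<^bsub>P\<^esub>" if "p \<in> carrier P" "q \<in> carrier P" for p q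
    using that P by (simp add: vs_minus_eq vs_add_assoc vs_add_left_comm[of P q])
  have rel: "F g = \<zero>\<^bsub>P\<^esub>" if "g \<in> ?r" for g
    using that unfolding bilinear_relations_def using M N P
    by (auto simp: Fm Fs' cl single_closed fcl bilinD(2-5)[OF f] canc)
  have "subsp {g \<in> carrier free_MN. F g \<in> {\<zero>\<^bsub>P\<^esub>}} free_MN"
    by (rule subsp_vimage[OF F vspace_free_vs P subsp_zero[OF P]])
  then have "tensor_null M N \<subseteq> {g \<in> carrier free_MN. F g \<in> {\<zero>\<^bsub>P\<^esub>}}"
    unfolding tensor_null_def using rel bilinear_relations_closed
    by (intro module.span_is_subset vspace_module vspace_free_vs) (auto simp: subsp_submodule vspace_free_vs)
  then obtain g where "g \<in> lin (tensor M N) P" "\<And>x. x \<in> carrier free_MN \<Longrightarrow> g (tensor_null M N +>\<^bsub>free_MN\<^esub> x) = F x"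
    using quotient_lift[OF vspace_free_vs subsp_tensor_null F P] unfolding tensor_def by blast
  then show ?thesis
    using that Fs' single_closed P fcl unfolding tens_def by (metis vs_smult_one)
qed

lemma tensor_lin_eq:
  assumes "f \<in> lin (tensor M N) P" "g \<in> lin (tensor M N) P" "t \<in> carrier (tensor M N)"
    and "\<And>x y. x \<in> carrier M \<Longrightarrow> y \<in> carrier N \<Longrightarrow> f (tens M N x y) = g (tens M N x y)"
  shows "f t = g t"
  using assms(3) by (induction rule: tensor_induct_aux) (simp_all add: assms lin_add[OF assms(1)] lin_add[OF assms(2)])

end

text \<open>Outside the context the vector space assumptions on the two factors become leading
  premises, so three premises are consumed.\<close>

lemmas tensor_induct [consumes 3, case_names tens add] = tensor_induct_aux

section \<open>Dimensions of tensor products, direct sums and spaces of linear maps\<close>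

lemma finsum_Times:
  assumes V: "vspace V" and "finite I" "finite J" and f: "\<And>i j. i \<in> I \<Longrightarrow> j \<in> J \<Longrightarrow> f i j \<in> carrier V"
  shows "finsum V (\<lambda>i. finsum V (f i) J) I = finsum V (\<lambda>(i, j). f i j) (I \<times> J)"
  using \<open>finite I\<close> f
proof (induction I rule: finite_induct)
  case empty
  then show ?case using V by simp
next
  case (insert i I)
  interpret abelian_monoid V by (rule vspace_abelian_monoid[OF V])
  have "insert i I \<times> J = Pair i ` J \<union> I \<times> J" by auto
  moreover have "Pair i ` J \<inter> (I \<times> J) = {}" using insert by auto
  ultimately have "finsum V (\<lambda>(i, j). f i j) (insert i I \<times> J) =
      finsum V (\<lambda>(i, j). f i j) (Pair i ` J) \<oplus>\<^bsub>V\<^esub> finsum V (\<lambda>(i, j). f i j) (I \<times> J)"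
    using insert \<open>finite J\<close> by (simp only:) (rule finsum_Un_disjoint, auto)
  also have "finsum V (\<lambda>(i, j). f i j) (Pair i ` J) = finsum V (f i) J"
    using insert.prems by (subst finsum_reindex) (auto simp: inj_on_def)
  finally show ?case
    using insert V by (simp add: vs_finsum_insert Pi_def)
qed

lemma fdvs_field_vs: "fdvs (field_vs :: ('k::field, 'k) module)"
proof -
  let ?V = "field_vs :: ('k::field, 'k) module"
  have "coords ?V {0 :: nat} (\<lambda>_. 1) (\<lambda>_ x. x)"
    by (simp add: coords_def lin_id finsum_field_vs)
  then show ?thesis by (rule coords_fdvs(1)[OF vspace_field_vs])
qed

lemma bilin_scaled_product:
  fixes M :: "('k::field, 'm) module" and N :: "('k, 'n) module"
  assumes "f \<in> lin M field_vs" "g \<in> lin N field_vs"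
  shows "bilin M N field_vs (\<lambda>x y. f x * g y)"
  using assms by (auto simp: bilin_def LinearCombinations.module_hom_def algebra_simps)

text \<open>Tensors of basis vectors form a basis whose dual functionals are the lifts of the
  products \<open>\<phi> i x * \<psi> j y\<close>. Duality is immediate; the expansion formula is
  additive in the tensor, so it has to be computed for pure tensors only.\<close>

lemma fdvs_tensor:
  fixes M :: "('k::field, 'm) module" and N :: "('k, 'n) module"
  assumes M: "fdvs M" and N: "fdvs N"
  shows "fdvs (tensor M N)" "vdim (tensor M N) = vdim M * vdim N"
proof -
  have vM: "vspace M" and vN: "vspace N" using M N by auto
  note T = vspace_tensor[OF vM vN]
  obtain A \<phi> where A: "coords M A (\<lambda>x. x) \<phi>" "card A = vdim M" by (rule fdvs_coords[OF M])
  obtain B \<psi> where B: "coords N B (\<lambda>x. x) \<psi>" "card B = vdim N" by (rule fdvs_coords[OF N])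
  note a = coords_idD[OF A(1)]
  note b = coords_idD[OF B(1)]
  have "\<exists>h. h \<in> lin (tensor M N) field_vs \<and> (\<forall>x\<in>carrier M. \<forall>y\<in>carrier N. h (tens M N x y) = \<phi> i x * \<psi> j y)"
    if "i \<in> A" "j \<in> B" for i j
    using tensor_lift[OF vM vN bilin_scaled_product[OF a(3) b(3)] vspace_field_vs] that by metis
  then obtain h where h: "\<And>i j. i \<in> A \<Longrightarrow> j \<in> B \<Longrightarrow> h i j \<in> lin (tensor M N) field_vs"
    "\<And>i j x y. i \<in> A \<Longrightarrow> j \<in> B \<Longrightarrow> x \<in> carrier M \<Longrightarrow> y \<in> carrier N \<Longrightarrow> h i j (tens M N x y) = \<phi> i x * \<psi> j y"
    by metis
  let ?e = "\<lambda>(i, j). tens M N i j" and ?h = "\<lambda>(i, j). h i j"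
  have ecl: "?e p \<in> carrier (tensor M N)" if "p \<in> A \<times> B" for p
    using that a b by (auto intro!: tens_closed vM vN)
  have hlin: "?h p \<in> lin (tensor M N) field_vs" if "p \<in> A \<times> B" for p
    using that h by auto
  have exp: "t = finsum (tensor M N) (\<lambda>p. ?h p t \<odot>\<^bsub>tensor M N\<^esub> ?e p) (A \<times> B)"
    if "t \<in> carrier (tensor M N)" for t
    using vM vN that
  proof (induction rule: tensor_induct)
    case (tens x y)
    have x: "(\<lambda>i. \<phi> i x \<odot>\<^bsub>M\<^esub> i) \<in> A \<rightarrow> carrier M" and y: "(\<lambda>j. \<psi> j y \<odot>\<^bsub>N\<^esub> j) \<in> B \<rightarrow> carrier N"
      using a b vM vN by auto
    interpret abelian_monoid "tensor M N" by (rule vspace_abelian_monoid[OF T])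
    note bil = bilin_tens[OF vM vN, unfolded bilin_def]
    have "tens M N x y = tens M N (finsum M (\<lambda>i. \<phi> i x \<odot>\<^bsub>M\<^esub> i) A) y"
      using a(5) tens by simp
    also have "\<dots> = finsum (tensor M N) (\<lambda>i. tens M N (\<phi> i x \<odot>\<^bsub>M\<^esub> i) y) A"
      using lin_finsum[of "\<lambda>x. tens M N x y", OF _ vM T x] bil tens by blast
    also have "\<dots> = finsum (tensor M N) (\<lambda>i. finsum (tensor M N) (\<lambda>j. tens M N (\<phi> i x \<odot>\<^bsub>M\<^esub> i) (\<psi> j y \<odot>\<^bsub>N\<^esub> j)) B) A"
    proof (rule finsum_cong')
      fix i assume i: "i \<in> A"
      then have ix: "\<phi> i x \<odot>\<^bsub>M\<^esub> i \<in> carrier M" using a vM by auto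
      show "tens M N (\<phi> i x \<odot>\<^bsub>M\<^esub> i) y = finsum (tensor M N) (\<lambda>j. tens M N (\<phi> i x \<odot>\<^bsub>M\<^esub> i) (\<psi> j y \<odot>\<^bsub>N\<^esub> j)) B"
        using lin_finsum[of "tens M N (\<phi> i x \<odot>\<^bsub>M\<^esub> i)", OF _ vN T y] bil tens ix b(5) by simp
    qed (use a b vM vN T in \<open>auto intro!: finsum_closed tens_closed\<close>)
    also have "\<dots> = finsum (tensor M N) (\<lambda>(i, j). tens M N (\<phi> i x \<odot>\<^bsub>M\<^esub> i) (\<psi> j y \<odot>\<^bsub>N\<^esub> j)) (A \<times> B)"
      using a b vM vN by (intro finsum_Times T tens_closed) auto
    also have "\<dots> = finsum (tensor M N) (\<lambda>p. ?h p (tens M N x y) \<odot>\<^bsub>tensor M N\<^esub> ?e p) (A \<times> B)"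
    proof (rule finsum_cong')
      fix p assume "p \<in> A \<times> B"
      then obtain i j where p: "p = (i, j)" "i \<in> A" "j \<in> B" by auto
      have ij: "i \<in> carrier M" "j \<in> carrier N" using p a b by auto
      then have "tens M N (\<phi> i x \<odot>\<^bsub>M\<^esub> i) (\<psi> j y \<odot>\<^bsub>N\<^esub> j) = (\<phi> i x * \<psi> j y) \<odot>\<^bsub>tensor M N\<^esub> tens M N i j"
        using vM vN by (simp add: tens_simps T tens_closed mult.commute flip: vs_smult_smult)
      then show "(case p of (i, j) \<Rightarrow> tens M N (\<phi> i x \<odot>\<^bsub>M\<^esub> i) (\<psi> j y \<odot>\<^bsub>N\<^esub> j)) =
          ?h p (tens M N x y) \<odot>\<^bsub>tensor M N\<^esub> ?e p"
        using p h tens by simp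
    qed (use ecl T in auto)
    finally show ?case .
  next
    case (add s t)
    interpret abelian_monoid "tensor M N" by (rule vspace_abelian_monoid[OF T])
    have "finsum (tensor M N) (\<lambda>p. ?h p (s \<oplus>\<^bsub>tensor M N\<^esub> t) \<odot>\<^bsub>tensor M N\<^esub> ?e p) (A \<times> B) =
      finsum (tensor M N) (\<lambda>p. ?h p s \<odot>\<^bsub>tensor M N\<^esub> ?e p \<oplus>\<^bsub>tensor M N\<^esub> ?h p t \<odot>\<^bsub>tensor M N\<^esub> ?e p) (A \<times> B)"
    proof (rule finsum_cong')
      fix p assume p: "p \<in> A \<times> B"
      show "?h p (s \<oplus>\<^bsub>tensor M N\<^esub> t) \<odot>\<^bsub>tensor M N\<^esub> ?e p =
          ?h p s \<odot>\<^bsub>tensor M N\<^esub> ?e p \<oplus>\<^bsub>tensor M N\<^esub> ?h p t \<odot>\<^bsub>tensor M N\<^esub> ?e p"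
        using lin_add[OF hlin[OF p] add(1,2)] ecl[OF p] by (simp only: field_vs_simps vs_add_smult[OF T])
    qed (use ecl T in auto)
    also have "\<dots> = finsum (tensor M N) (\<lambda>p. ?h p s \<odot>\<^bsub>tensor M N\<^esub> ?e p) (A \<times> B) \<oplus>\<^bsub>tensor M N\<^esub>
       finsum (tensor M N) (\<lambda>p. ?h p t \<odot>\<^bsub>tensor M N\<^esub> ?e p) (A \<times> B)"
      using ecl T by (intro vs_finsum_add) auto
    also have "\<dots> = s \<oplus>\<^bsub>tensor M N\<^esub> t" using add(3,4) by argo
    finally show ?case by (rule sym)
  qed
  have "coords (tensor M N) (A \<times> B) ?e ?h"
    unfolding coords_def
  proof (intro conjI ballI)
    show "?h p (?e q) = (if p = q then 1 else 0)" if "p \<in> A \<times> B" "q \<in> A \<times> B" for p q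
      using that h a b by (auto simp: subset_iff split: if_splits)
  qed (use a b ecl hlin exp in blast)+
  from coords_fdvs[OF T this] show "fdvs (tensor M N)" "vdim (tensor M N) = vdim M * vdim N"
    using A(2) B(2) by (simp_all add: card_cartesian_product)
qed

lemma fdvs_direct_sum:
  fixes M :: "('k::field, 'm) module" and N :: "('k, 'n) module"
  assumes M: "fdvs M" and N: "fdvs N"
  shows "fdvs (direct_sum M N)" "vdim (direct_sum M N) = vdim M + vdim N"
proof -
  have vM: "vspace M" and vN: "vspace N" using M N by auto
  let ?D = "direct_sum M N"
  note D = vspace_direct_sum[OF vM vN]
  obtain A \<phi> where A: "coords M A (\<lambda>x. x) \<phi>" "card A = vdim M" by (rule fdvs_coords[OF M])
  obtain B \<psi> where B: "coords N B (\<lambda>x. x) \<psi>" "card B = vdim N" by (rule fdvs_coords[OF N])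
  note a = coords_idD[OF A(1)]
  note b = coords_idD[OF B(1)]
  let ?e = "\<lambda>p. case p of Inl i \<Rightarrow> (i, \<zero>\<^bsub>N\<^esub>) | Inr j \<Rightarrow> (\<zero>\<^bsub>M\<^esub>, j)"
  let ?h = "\<lambda>p v. case p of Inl i \<Rightarrow> \<phi> i (fst v) | Inr j \<Rightarrow> \<psi> j (snd v)"
  interpret abelian_monoid ?D by (rule vspace_abelian_monoid[OF D])
  have i1: "(\<lambda>x. (x, \<zero>\<^bsub>N\<^esub>)) \<in> lin M ?D" and i2: "(\<lambda>y. (\<zero>\<^bsub>M\<^esub>, y)) \<in> lin N ?D"
    by (intro lin_Pair lin_id lin_const_zero vM vN)+
  have exp: "v = finsum ?D (\<lambda>p. ?h p v \<odot>\<^bsub>?D\<^esub> ?e p) (A <+> B)" if v: "v \<in> carrier ?D" for v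
  proof -
    have "finsum ?D (\<lambda>p. ?h p v \<odot>\<^bsub>?D\<^esub> ?e p) (A <+> B) =
      finsum ?D (\<lambda>p. ?h p v \<odot>\<^bsub>?D\<^esub> ?e p) (Inl ` A) \<oplus>\<^bsub>?D\<^esub> finsum ?D (\<lambda>p. ?h p v \<odot>\<^bsub>?D\<^esub> ?e p) (Inr ` B)"
      unfolding Plus_def using a b vM vN by (intro finsum_Un_disjoint) auto
    also have "finsum ?D (\<lambda>p. ?h p v \<odot>\<^bsub>?D\<^esub> ?e p) (Inl ` A) = finsum ?D (\<lambda>i. (\<phi> i (fst v) \<odot>\<^bsub>M\<^esub> i, \<zero>\<^bsub>N\<^esub>)) A"
      using a vM vN by (subst finsum_reindex) auto
    also have "\<dots> = (fst v, \<zero>\<^bsub>N\<^esub>)"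
      using a v vM by (subst lin_finsum[OF i1 vM D, symmetric]) auto
    also have "finsum ?D (\<lambda>p. ?h p v \<odot>\<^bsub>?D\<^esub> ?e p) (Inr ` B) = finsum ?D (\<lambda>j. (\<zero>\<^bsub>M\<^esub>, \<psi> j (snd v) \<odot>\<^bsub>N\<^esub> j)) B"
      using b vM vN by (subst finsum_reindex) auto
    also have "\<dots> = (\<zero>\<^bsub>M\<^esub>, snd v)"
      using b v vN by (subst lin_finsum[OF i2 vN D, symmetric]) auto
    finally show ?thesis using v vM vN by auto
  qed
  have "coords ?D (A <+> B) ?e ?h"
    unfolding coords_def
  proof (intro conjI ballI)
    show "?h p \<in> lin ?D field_vs" if "p \<in> A <+> B" for p
      using that lin_comp[OF lin_fst a(3)] lin_comp[OF lin_snd b(3)] by auto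
    show "?h p (?e q) = (if p = q then 1 else 0)" if "p \<in> A <+> B" "q \<in> A <+> B" for p q
      using that a b lin_zero[OF a(3) vM vspace_field_vs] lin_zero[OF b(3) vN vspace_field_vs]
      by (auto split: if_splits)
    show "v = finsum ?D (\<lambda>p. ?h p v \<odot>\<^bsub>?D\<^esub> ?e p) (A <+> B)" if "v \<in> carrier ?D" for v
      using exp[OF that] .
  qed (use a b vM vN in auto)
  from coords_fdvs[OF D this] show "fdvs ?D" "vdim ?D = vdim M + vdim N"
    using A(2) B(2) a b by (simp_all add: card_Plus)
qed

text \<open>The basis consists of the rank-one maps sending \<open>x\<close> to
  \<open>\<phi> i x \<odot> j\<close>, the matrix units; the dual functionals are the matrix entries
  \<open>\<psi> j (f i)\<close>.\<close>

lemma fdvs_hom_vs: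
  fixes M :: "('k::field, 'm) module" and N :: "('k, 'n) module"
  assumes M: "fdvs M" and N: "fdvs N"
  shows "fdvs (hom_vs M N)"
proof -
  have vM: "vspace M" and vN: "vspace N" using M N by auto
  let ?H = "hom_vs M N"
  note H = vspace_hom_vs[OF vM vN]
  obtain A \<phi> where A: "coords M A (\<lambda>x. x) \<phi>" "card A = vdim M" by (rule fdvs_coords[OF M])
  obtain B \<psi> where B: "coords N B (\<lambda>x. x) \<psi>" "card B = vdim N" by (rule fdvs_coords[OF N])
  note a = coords_idD[OF A(1)]
  note b = coords_idD[OF B(1)]
  let ?e = "\<lambda>(i, j). \<lambda>x\<in>carrier M. \<phi> i x \<odot>\<^bsub>N\<^esub> j" and ?h = "\<lambda>(i, j) f. \<psi> j (f i)"
  have ecl: "?e p \<in> carrier ?H" if "p \<in> A \<times> B" for p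
    using that a b vN by (auto intro!: restrict_hom_vs[OF vM] linI
      simp: lin_add[OF a(3)] lin_smult[OF a(3)] vs_add_smult vs_smult_smult subset_iff)
  have exp: "f = finsum ?H (\<lambda>p. ?h p f \<odot>\<^bsub>?H\<^esub> ?e p) (A \<times> B)" if f: "f \<in> carrier ?H" for f
  proof (rule hom_vs_eqI[OF f])
    show "finsum ?H (\<lambda>p. ?h p f \<odot>\<^bsub>?H\<^esub> ?e p) (A \<times> B) \<in> carrier ?H"
      using ecl H by auto
    fix x assume x: "x \<in> carrier M"
    have fx: "f i \<in> carrier N" if "i \<in> A" for i using hom_vs_closed[OF f] a that by auto
    have jN: "j \<in> carrier N" if "j \<in> B" for j using b that by auto
    interpret abelian_monoid N by (rule vspace_abelian_monoid[OF vN])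
    have "f x = f (finsum M (\<lambda>i. \<phi> i x \<odot>\<^bsub>M\<^esub> i) A)" using a(5) x by simp
    also have "\<dots> = finsum N (\<lambda>i. f (\<phi> i x \<odot>\<^bsub>M\<^esub> i)) A"
      using a vM by (intro lin_finsum[OF hom_vs_lin[OF f] vM vN]) auto
    also have "\<dots> = finsum N (\<lambda>i. finsum N (\<lambda>j. \<phi> i x \<odot>\<^bsub>N\<^esub> (\<psi> j (f i) \<odot>\<^bsub>N\<^esub> j)) B) A"
    proof (rule finsum_cong')
      fix i assume i: "i \<in> A"
      have "f (\<phi> i x \<odot>\<^bsub>M\<^esub> i) = \<phi> i x \<odot>\<^bsub>N\<^esub> f i"
        using i a by (intro lin_smult[OF hom_vs_lin[OF f]]) auto
      also have "\<dots> = \<phi> i x \<odot>\<^bsub>N\<^esub> finsum N (\<lambda>j. \<psi> j (f i) \<odot>\<^bsub>N\<^esub> j) B"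
        using b(5)[OF fx[OF i]] by simp
      also have "\<dots> = finsum N (\<lambda>j. \<phi> i x \<odot>\<^bsub>N\<^esub> (\<psi> j (f i) \<odot>\<^bsub>N\<^esub> j)) B"
        using jN vN by (intro vs_finsum_smult[symmetric]) auto
      finally show "f (\<phi> i x \<odot>\<^bsub>M\<^esub> i) = finsum N (\<lambda>j. \<phi> i x \<odot>\<^bsub>N\<^esub> (\<psi> j (f i) \<odot>\<^bsub>N\<^esub> j)) B" .
    qed (use jN vN in auto)
    also have "\<dots> = finsum N (\<lambda>(i, j). \<phi> i x \<odot>\<^bsub>N\<^esub> (\<psi> j (f i) \<odot>\<^bsub>N\<^esub> j)) (A \<times> B)"
      using a b jN vN by (intro finsum_Times) auto
    also have "\<dots> = finsum N (\<lambda>p. (?h p f \<odot>\<^bsub>?H\<^esub> ?e p) x) (A \<times> B)"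
      by (rule finsum_cong') (use jN vN x in \<open>auto simp: hom_vs_simps mult.commute simp flip: vs_smult_smult\<close>)
    also have "\<dots> = finsum ?H (\<lambda>p. ?h p f \<odot>\<^bsub>?H\<^esub> ?e p) (A \<times> B) x"
      using ecl H by (intro lin_finsum[OF lin_hom_vs_apply[OF x] H vN, symmetric]) auto
    finally show "f x = finsum ?H (\<lambda>p. ?h p f \<odot>\<^bsub>?H\<^esub> ?e p) (A \<times> B) x" .
  qed
  have "coords ?H (A \<times> B) ?e ?h"
    unfolding coords_def
  proof (intro conjI ballI)
    show "?h p \<in> lin ?H field_vs" if "p \<in> A \<times> B" for p
      using that a(2) by (auto intro!: lin_comp[OF lin_hom_vs_apply b(3)])
    show "?h p (?e q) = (if p = q then 1 else 0)" if "p \<in> A \<times> B" "q \<in> A \<times> B" for p q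
      using that a b lin_smult[OF b(3)] by (auto simp: subset_iff split: if_splits)
    show "f = finsum ?H (\<lambda>p. ?h p f \<odot>\<^bsub>?H\<^esub> ?e p) (A \<times> B)" if "f \<in> carrier ?H" for f
      using exp[OF that] .
  qed (use a b ecl in blast)+
  from coords_fdvs(1)[OF H this] show ?thesis .
qed

section \<open>Iterated tensor products\<close>

text \<open>For maps \<open>G z\<close> that are linear on the tensor product, linear dependence on
  the parameter \<open>z\<close> can be tested on pure tensors, because it survives pointwise sums.
  This allows multilinear maps to be lifted one factor at a time.\<close>

lemma lin_tensor_param:
  assumes L: "vspace L" and M: "vspace M" and P: "vspace P" and N: "vspace N"
    and G: "\<And>z. z \<in> carrier N \<Longrightarrow> G z \<in> lin (tensor L M) P"
    and pure: "\<And>x y. x \<in> carrier L \<Longrightarrow> y \<in> carrier M \<Longrightarrow> (\<lambda>z. G z (tens L M x y)) \<in> lin N P"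
    and t: "t \<in> carrier (tensor L M)"
  shows "(\<lambda>z. G z t) \<in> lin N P"
  using L M t
proof (induction rule: tensor_induct)
  case (tens x y)
  then show ?case by (rule pure)
next
  case (add s t)
  show ?case
    by (rule lin_cong[OF lin_plus[OF add(3,4) P] N]) (simp add: lin_add[OF G] add)
qed

lemma lin_tens_left: "vspace M \<Longrightarrow> vspace N \<Longrightarrow> y \<in> carrier N \<Longrightarrow> (\<lambda>x. tens M N x y) \<in> lin M (tensor M N)"
  and lin_tens_right: "vspace M \<Longrightarrow> vspace N \<Longrightarrow> x \<in> carrier M \<Longrightarrow> tens M N x \<in> lin N (tensor M N)"
  using bilin_tens[of M N] by (auto simp: bilin_def)

lemma tensor3_induct [consumes 4, case_names tens add]:
  assumes L: "vspace L" and M: "vspace M" and N: "vspace N" and t: "t \<in> carrier (tensor3 L M N)"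
    and pure: "\<And>x y z. x \<in> carrier L \<Longrightarrow> y \<in> carrier M \<Longrightarrow> z \<in> carrier N \<Longrightarrow> Q (tens3 L M N x y z)"
    and add: "\<And>s t. s \<in> carrier (tensor3 L M N) \<Longrightarrow> t \<in> carrier (tensor3 L M N) \<Longrightarrow> Q s \<Longrightarrow> Q t \<Longrightarrow>
      Q (s \<oplus>\<^bsub>tensor3 L M N\<^esub> t)"
  shows "Q t"
  using vspace_tensor[OF L M] N t
proof (induction rule: tensor_induct)
  case (tens s z)
  from L M tens(1) show ?case
  proof (induction rule: tensor_induct)
    case (tens x y)
    then show ?case using pure \<open>z \<in> carrier N\<close> by blast
  next
    case (add s t)
    then show ?case
      using lin_add[OF lin_tens_left[OF vspace_tensor[OF L M] N \<open>z \<in> carrier N\<close>] add(1,2)]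
        assms(6) tens_closed[OF vspace_tensor[OF L M] N] \<open>z \<in> carrier N\<close> by simp
  qed
qed (rule assms(6))

lemma tensor4_induct [consumes 5, case_names tens add]:
  assumes K: "vspace K" and L: "vspace L" and M: "vspace M" and N: "vspace N"
    and t: "t \<in> carrier (tensor4 K L M N)"
    and pure: "\<And>w x y z. w \<in> carrier K \<Longrightarrow> x \<in> carrier L \<Longrightarrow> y \<in> carrier M \<Longrightarrow> z \<in> carrier N \<Longrightarrow>
      Q (tens4 K L M N w x y z)"
    and add: "\<And>s t. s \<in> carrier (tensor4 K L M N) \<Longrightarrow> t \<in> carrier (tensor4 K L M N) \<Longrightarrow> Q s \<Longrightarrow> Q t \<Longrightarrow>
      Q (s \<oplus>\<^bsub>tensor4 K L M N\<^esub> t)"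
  shows "Q t"
proof -
  note KLM = vspace_tensor[OF vspace_tensor[OF K L] M]
  show ?thesis
    using KLM N t
  proof (induction rule: tensor_induct)
    case (tens s z)
    from K L M tens(1) show ?case
    proof (induction rule: tensor3_induct)
      case (tens x y)
      then show ?case using pure \<open>z \<in> carrier N\<close> by blast
    next
      case (add s t)
      then show ?case
        using lin_add[OF lin_tens_left[OF KLM N \<open>z \<in> carrier N\<close>] add(1,2)]
          assms(7) tens_closed[OF KLM N] \<open>z \<in> carrier N\<close> by simp
    qed
  qed (rule assms(7))
qed

text \<open>For fixed \<open>z\<close> the map in the first two arguments is lifted to
  \<open>tensor L M\<close>; the lifts depend linearly on \<open>z\<close> by
  \<open>lin_tensor_param\<close>, so the result is bilinear and can be lifted again.\<close>

lemma tensor3_lift: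
  fixes P :: "('k::field, 'p) module"
  assumes L: "vspace L" and M: "vspace M" and N: "vspace N" and P: "vspace P"
    and 1: "\<And>y z. y \<in> carrier M \<Longrightarrow> z \<in> carrier N \<Longrightarrow> (\<lambda>x. f x y z) \<in> lin L P"
    and 2: "\<And>x z. x \<in> carrier L \<Longrightarrow> z \<in> carrier N \<Longrightarrow> (\<lambda>y. f x y z) \<in> lin M P"
    and 3: "\<And>x y. x \<in> carrier L \<Longrightarrow> y \<in> carrier M \<Longrightarrow> (\<lambda>z. f x y z) \<in> lin N P"
  obtains g where "g \<in> lin (tensor3 L M N) P"
    "\<And>x y z. x \<in> carrier L \<Longrightarrow> y \<in> carrier M \<Longrightarrow> z \<in> carrier N \<Longrightarrow> g (tens3 L M N x y z) = f x y z"
proof -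
  have "\<exists>g. g \<in> lin (tensor L M) P \<and> (\<forall>x\<in>carrier L. \<forall>y\<in>carrier M. g (tens L M x y) = f x y z)"
    if "z \<in> carrier N" for z
  proof -
    have "bilin L M P (\<lambda>x y. f x y z)" using 1 2 that by (simp add: bilin_def)
    show ?thesis by (rule tensor_lift[OF L M \<open>bilin L M P (\<lambda>x y. f x y z)\<close> P]) blast
  qed
  then obtain G where G: "\<And>z. z \<in> carrier N \<Longrightarrow> G z \<in> lin (tensor L M) P"
    "\<And>x y z. z \<in> carrier N \<Longrightarrow> x \<in> carrier L \<Longrightarrow> y \<in> carrier M \<Longrightarrow> G z (tens L M x y) = f x y z"
    by metis
  have "(\<lambda>z. G z t) \<in> lin N P" if "t \<in> carrier (tensor L M)" for t
  proof (rule lin_tensor_param[OF L M P N G(1) _ that])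
    show "(\<lambda>z. G z (tens L M x y)) \<in> lin N P" if "x \<in> carrier L" "y \<in> carrier M" for x y
      by (rule lin_cong[OF 3[OF that] N]) (simp add: G that)
  qed
  then have bil: "bilin (tensor L M) N P (\<lambda>t z. G z t)" using G by (simp add: bilin_def)
  obtain g where g: "g \<in> lin (tensor3 L M N) P"
    "\<And>t z. t \<in> carrier (tensor L M) \<Longrightarrow> z \<in> carrier N \<Longrightarrow> g (tens (tensor L M) N t z) = G z t"
    by (rule tensor_lift[OF vspace_tensor[OF L M] N bil P]) blast
  show ?thesis
  proof (rule that[OF g(1)])
    fix x y z assume "x \<in> carrier L" "y \<in> carrier M" "z \<in> carrier N"
    then show "g (tens3 L M N x y z) = f x y z"
      using g(2)[OF tens_closed[OF L M, of x y], of z] G(2)[of z x y] by simp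
  qed
qed

lemma tensor4_lift:
  fixes P :: "('k::field, 'p) module"
  assumes K: "vspace K" and L: "vspace L" and M: "vspace M" and N: "vspace N" and P: "vspace P"
    and 1: "\<And>x y z. x \<in> carrier L \<Longrightarrow> y \<in> carrier M \<Longrightarrow> z \<in> carrier N \<Longrightarrow> (\<lambda>w. f w x y z) \<in> lin K P"
    and 2: "\<And>w y z. w \<in> carrier K \<Longrightarrow> y \<in> carrier M \<Longrightarrow> z \<in> carrier N \<Longrightarrow> (\<lambda>x. f w x y z) \<in> lin L P"
    and 3: "\<And>w x z. w \<in> carrier K \<Longrightarrow> x \<in> carrier L \<Longrightarrow> z \<in> carrier N \<Longrightarrow> (\<lambda>y. f w x y z) \<in> lin M P"
    and 4: "\<And>w x y. w \<in> carrier K \<Longrightarrow> x \<in> carrier L \<Longrightarrow> y \<in> carrier M \<Longrightarrow> (\<lambda>z. f w x y z) \<in> lin N P"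
  obtains g where "g \<in> lin (tensor4 K L M N) P"
    "\<And>w x y z. w \<in> carrier K \<Longrightarrow> x \<in> carrier L \<Longrightarrow> y \<in> carrier M \<Longrightarrow> z \<in> carrier N \<Longrightarrow>
      g (tens4 K L M N w x y z) = f w x y z"
proof -
  note KL = vspace_tensor[OF K L] and KLM = vspace_tensor[OF vspace_tensor[OF K L] M]
  have "\<exists>g. g \<in> lin (tensor3 K L M) P \<and>
      (\<forall>w\<in>carrier K. \<forall>x\<in>carrier L. \<forall>y\<in>carrier M. g (tens3 K L M w x y) = f w x y z)"
    if "z \<in> carrier N" for z
    by (rule tensor3_lift[OF K L M P 1[OF _ _ that] 2[OF _ _ that] 3[OF _ _ that]]) blast+
  then obtain G where G: "\<And>z. z \<in> carrier N \<Longrightarrow> G z \<in> lin (tensor3 K L M) P"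
    "\<And>w x y z. z \<in> carrier N \<Longrightarrow> w \<in> carrier K \<Longrightarrow> x \<in> carrier L \<Longrightarrow> y \<in> carrier M \<Longrightarrow>
       G z (tens3 K L M w x y) = f w x y z"
    by metis
  have "(\<lambda>z. G z t) \<in> lin N P" if "t \<in> carrier (tensor3 K L M)" for t
  proof (rule lin_tensor_param[OF KL M P N G(1) _ that])
    fix s y assume s: "s \<in> carrier (tensor K L)" and y: "y \<in> carrier M"
    show "(\<lambda>z. G z (tens (tensor K L) M s y)) \<in> lin N P"
    \<comment> \<open>The first factor \<open>s\<close> of a pure tensor of
      \<open>tensor (tensor K L) M\<close> is in turn a sum of pure tensors, so the parameter test
      is applied a second time.\<close>
    proof (rule lin_tensor_param[OF K L P N _ _ s])
      show "(\<lambda>s. G z (tens (tensor K L) M s y)) \<in> lin (tensor K L) P" if "z \<in> carrier N" for z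
        by (rule lin_comp[OF lin_tens_left[OF KL M y] G(1)[OF that]])
      show "(\<lambda>z. G z (tens3 K L M w x y)) \<in> lin N P" if "w \<in> carrier K" "x \<in> carrier L" for w x
        by (rule lin_cong[OF 4[OF that y] N]) (simp add: G that y)
    qed
  qed
  then have "bilin (tensor3 K L M) N P (\<lambda>t z. G z t)" using G by (simp add: bilin_def)
  then obtain g where "g \<in> lin (tensor4 K L M N) P"
    "\<And>t z. t \<in> carrier (tensor3 K L M) \<Longrightarrow> z \<in> carrier N \<Longrightarrow> g (tens (tensor3 K L M) N t z) = G z t"
    using tensor_lift[OF KLM N _ P] by metis
  then show ?thesis
    using tens_closed[OF KL M] tens_closed[OF K L] G(2) by (intro that) auto
qed

lemma tensor3_lin_eq:
  assumes "vspace L" "vspace M" "vspace N" "f \<in> lin (tensor3 L M N) P" "g \<in> lin (tensor3 L M N) P"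
    and "\<And>x y z. x \<in> carrier L \<Longrightarrow> y \<in> carrier M \<Longrightarrow> z \<in> carrier N \<Longrightarrow>
      f (tens3 L M N x y z) = g (tens3 L M N x y z)"
    and "t \<in> carrier (tensor3 L M N)"
  shows "f t = g t"
  using assms(1-3,7)
  by (induction rule: tensor3_induct) (simp_all add: assms(6) lin_add[OF assms(4)] lin_add[OF assms(5)])

lemma tensor4_lin_eq:
  assumes "vspace K" "vspace L" "vspace M" "vspace N" "f \<in> lin (tensor4 K L M N) P" "g \<in> lin (tensor4 K L M N) P"
    and "\<And>w x y z. w \<in> carrier K \<Longrightarrow> x \<in> carrier L \<Longrightarrow> y \<in> carrier M \<Longrightarrow> z \<in> carrier N \<Longrightarrow>
      f (tens4 K L M N w x y z) = g (tens4 K L M N w x y z)"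
    and "t \<in> carrier (tensor4 K L M N)"
  shows "f t = g t"
  using assms(1-4,8)
  by (induction rule: tensor4_induct) (simp_all add: assms(7) lin_add[OF assms(5)] lin_add[OF assms(6)])

section \<open>The Zariski topology and loci of bounded rank\<close>

lemma openin_zariski: "openin (zariski V) U \<longleftrightarrow> (\<exists>F\<subseteq>poly_funs V. U = carrier V - zero_locus V F)"
  unfolding zariski_def using istopology_zariski[of V] by (simp add: topology_inverse')

lemma topspace_zariski: "topspace (zariski V) = carrier V"
proof
  have "openin (zariski V) (carrier V)"
    unfolding openin_zariski
    by (rule exI[of _ "{\<lambda>v. 1}"]) (auto simp: zero_locus_def intro: poly_funs.const)
  then show "carrier V \<subseteq> topspace (zariski V)" by (rule openin_subset)
  show "topspace (zariski V) \<subseteq> carrier V"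
    using openin_topspace[of "zariski V"] unfolding openin_zariski by blast
qed

lemma closedin_zero_locus: "F \<subseteq> poly_funs V \<Longrightarrow> closedin (zariski V) (zero_locus V F)"
  unfolding closedin_def topspace_zariski openin_zariski by (auto simp: zero_locus_def)

section \<open>Minors as polynomial functions\<close>

lemma poly_funs_sum:
  "finite A \<Longrightarrow> (\<And>i. i \<in> A \<Longrightarrow> f i \<in> poly_funs V) \<Longrightarrow> (\<lambda>v. \<Sum>i\<in>A. f i v) \<in> poly_funs V"
  by (induction A rule: finite_induct) (auto intro: poly_funs.const poly_funs.add)

lemma poly_funs_prod:
  "finite A \<Longrightarrow> (\<And>i. i \<in> A \<Longrightarrow> f i \<in> poly_funs V) \<Longrightarrow> (\<lambda>v. \<Prod>i\<in>A. f i v) \<in> poly_funs V"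
  by (induction A rule: finite_induct) (auto intro: poly_funs.const poly_funs.mult)

text \<open>By the Leibniz formula a determinant is a polynomial in its entries. Permutations
  preserve the index range, so the hypothesis covers every entry that occurs.\<close>

lemma poly_funs_det:
  assumes "\<And>i j. i < n \<Longrightarrow> j < n \<Longrightarrow> f i j \<in> poly_funs V"
  shows "(\<lambda>v. det (Matrix.mat n n (\<lambda>(i, j). f i j v))) \<in> poly_funs V"
proof -
  have "(\<lambda>v. \<Sum>p\<in>{p. p permutes {0..<n}}. signof p * (\<Prod>i\<in>{0..<n}. f i (p i) v)) \<in> poly_funs V"
  proof (intro poly_funs_sum poly_funs.mult poly_funs.const poly_funs_prod)
    fix p i assume "p \<in> {p. p permutes {0..<n}}" "i \<in> {0..<n}"
    then have "p i \<in> {0..<n}" using permutes_in_image[of p "{0..<n}" i] by simp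
    then show "f i (p i) \<in> poly_funs V" using assms \<open>i \<in> {0..<n}\<close> by simp
  qed (simp_all add: finite_permutations)
  moreover have "det (Matrix.mat n n (\<lambda>(i, j). f i j v)) =
      (\<Sum>p\<in>{p. p permutes {0..<n}}. signof p * (\<Prod>i\<in>{0..<n}. f i (p i) v))" for v
  proof (subst det_def'[of _ n])
    have "(\<Prod>i = 0..<n. Matrix.mat n n (\<lambda>(i, j). f i j v) $$ (i, p i)) = (\<Prod>i = 0..<n. f i (p i) v)"
      if "p permutes {0..<n}" for p
    proof (rule prod.cong)
      fix i assume "i \<in> {0..<n}"
      moreover from this have "p i \<in> {0..<n}" using permutes_in_image[OF that, of i] by simp
      ultimately show "Matrix.mat n n (\<lambda>(i, j). f i j v) $$ (i, p i) = f i (p i) v" by simp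
    qed simp
    then show "(\<Sum>p\<in>{p. p permutes {0..<n}}.
        signof p * (\<Prod>i = 0..<n. Matrix.mat n n (\<lambda>(i, j). f i j v) $$ (i, p i))) =
      (\<Sum>p\<in>{p. p permutes {0..<n}}. signof p * (\<Prod>i\<in>{0..<n}. f i (p i) v))"
      by (intro sum.cong) simp_all
  qed simp
  ultimately show ?thesis by simp
qed

text \<open>A matrix factoring through dimension \<open>d < n\<close> is a product of two square
  matrices padded with zeros, and row \<open>d\<close> of the right factor vanishes.\<close>

lemma det_mult_rank_lt:
  fixes a b :: "nat \<Rightarrow> nat \<Rightarrow> 'k::field"
  assumes "d < n"
  shows "det (Matrix.mat n n (\<lambda>(i, j). \<Sum>l<d. a i l * b l j)) = 0"
proof -
  let ?A = "Matrix.mat n n (\<lambda>(i, l). if l < d then a i l else 0)"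
  let ?B = "Matrix.mat n n (\<lambda>(l, j). if l < d then b l j else 0)"
  have "Matrix.mat n n (\<lambda>(i, j). \<Sum>l<d. a i l * b l j) = ?A * ?B"
  proof (rule eq_matI)
    fix i j assume "i < dim_row (?A * ?B)" "j < dim_col (?A * ?B)"
    then have ij: "i < n" "j < n" by auto
    have "(?A * ?B) $$ (i, j) = (\<Sum>l\<in>{0..<n}. (if l < d then a i l else 0) * (if l < d then b l j else 0))"
      using ij by (simp add: scalar_prod_def)
    also have "\<dots> = (\<Sum>l<d. a i l * b l j)"
      using assms by (intro sum.mono_neutral_cong_right) auto
    finally show "Matrix.mat n n (\<lambda>(i, j). \<Sum>l<d. a i l * b l j) $$ (i, j) = (?A * ?B) $$ (i, j)"
      using ij by simp
  qed auto
  moreover have "det ?B = 0"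
  proof -
    have "?B = mat\<^sub>r n n (\<lambda>i. if i = d then 0\<^sub>v n else Matrix.vec n (\<lambda>j. if i < d then b i j else 0))"
      by (rule eq_matI) auto
    then show ?thesis using det_row_0[OF assms, of "\<lambda>i. Matrix.vec n (\<lambda>j. if i < d then b i j else 0)"] by simp
  qed
  ultimately show ?thesis by (simp add: det_mult[of ?A n ?B])
qed

text \<open>If the rank is at least \<open>n\<close>, vectors mapped to \<open>n\<close> basis
  vectors of the image and the dual functionals give the identity matrix. Conversely, expanding the
  values \<open>f (x j)\<close> in a basis of the image factors the matrix through the rank, so for
  smaller rank its determinant is zero.\<close>

lemma le_rank_iff_minor:
  fixes M :: "('k::field, 'm) module" and N :: "('k, 'n) module"
  assumes f: "f \<in> lin M N" and M: "vspace M" and N: "fdvs N"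
  shows "n \<le> rank_of M N f \<longleftrightarrow>
    (\<exists>x \<phi>. (\<forall>j<n. x j \<in> carrier M) \<and> (\<forall>i<n. \<phi> i \<in> lin N field_vs) \<and>
       det (Matrix.mat n n (\<lambda>(i, j). \<phi> i (f (x j)))) \<noteq> 0)"
proof -
  let ?U = "f ` carrier M"
  have vN: "vspace N" using N by simp
  have U: "subsp ?U N" by (rule subsp_range[OF f M vN])
  obtain A B \<psi> where c: "coords N B (\<lambda>x. x) \<psi>" "A \<subseteq> B" "A \<subseteq> ?U" "card A = vdim (N\<lparr>carrier := ?U\<rparr>)"
    using subsp_adapted_coords[OF N U] by metis
  have B: "finite B" and \<psi>: "\<And>i. i \<in> B \<Longrightarrow> \<psi> i \<in> lin N field_vs"
    and dual: "\<And>i j. i \<in> B \<Longrightarrow> j \<in> B \<Longrightarrow> \<psi> i j = (if i = j then 1 else 0)"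
    using c(1) by (auto simp: coords_def)
  have A: "finite A" using B c(2) finite_subset by blast
  have rank: "rank_of M N f = card A" using c(4) by (simp add: rank_of_def)
  show ?thesis
  proof
    assume "n \<le> rank_of M N f"
    then obtain A' where A': "A' \<subseteq> A" "card A' = n" using rank obtain_subset_with_card_n by metis
    then obtain e where e: "bij_betw e {..<n} A'"
      using A by (metis ex_bij_betw_nat_finite finite_subset lessThan_atLeast0)
    have eA: "e j \<in> A" if "j < n" for j using e A'(1) that by (auto simp: bij_betw_def)
    have "\<exists>x. x \<in> carrier M \<and> f x = e j" if "j < n" for j
      using subsetD[OF c(3) eA[OF that]] by auto
    then obtain x where x: "\<And>j. j < n \<Longrightarrow> x j \<in> carrier M \<and> f (x j) = e j" by metis
    have inj: "e i = e j \<longleftrightarrow> i = j" if "i < n" "j < n" for i j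
      using e that by (auto simp: bij_betw_def inj_on_def)
    have "Matrix.mat n n (\<lambda>(i, j). \<psi> (e i) (f (x j))) = 1\<^sub>m n"
      by (rule eq_matI) (use x eA c(2) in \<open>auto simp: dual inj subset_iff\<close>)
    then have "det (Matrix.mat n n (\<lambda>(i, j). \<psi> (e i) (f (x j)))) \<noteq> 0" by simp
    then show "\<exists>x \<phi>. (\<forall>j<n. x j \<in> carrier M) \<and> (\<forall>i<n. \<phi> i \<in> lin N field_vs) \<and>
       det (Matrix.mat n n (\<lambda>(i, j). \<phi> i (f (x j)))) \<noteq> 0"
      using x eA c(2) \<psi> by (intro exI[of _ x] exI[of _ "\<lambda>i. \<psi> (e i)"]) auto
  next
    assume "\<exists>x \<phi>. (\<forall>j<n. x j \<in> carrier M) \<and> (\<forall>i<n. \<phi> i \<in> lin N field_vs) \<and>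
       det (Matrix.mat n n (\<lambda>(i, j). \<phi> i (f (x j)))) \<noteq> 0"
    then obtain x \<phi> where x: "\<And>j. j < n \<Longrightarrow> x j \<in> carrier M" and \<phi>: "\<And>i. i < n \<Longrightarrow> \<phi> i \<in> lin N field_vs"
      and det: "det (Matrix.mat n n (\<lambda>(i, j). \<phi> i (f (x j)))) \<noteq> 0" by blast
    show "n \<le> rank_of M N f"
    proof (rule ccontr)
      let ?NU = "N\<lparr>carrier := ?U\<rparr>"
      assume "\<not> n \<le> rank_of M N f"
      then have lt: "card A < n" using rank by simp
      have NU: "vspace ?NU" by (rule subsp_vspace[OF vN U])
      obtain C \<chi> where C: "coords ?NU C (\<lambda>x. x) \<chi>" "card C = vdim ?NU"
        by (rule fdvs_coords[OF subsp_fdvs(1)[OF N U]])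
      have C': "finite C" "C \<subseteq> ?U" "\<And>v. v \<in> ?U \<Longrightarrow> finsum ?NU (\<lambda>i. \<chi> i v \<odot>\<^bsub>N\<^esub> i) C = v"
        using C(1) by (auto simp: coords_def)
      obtain e where e: "bij_betw e {..<card C} C"
        using C'(1) by (metis ex_bij_betw_nat_finite lessThan_atLeast0)
      have "\<phi> i (f (x j)) = (\<Sum>l<card C. \<phi> i (e l) * \<chi> (e l) (f (x j)))" if "i < n" "j < n" for i j
      proof -
        have lin: "\<phi> i \<in> lin ?NU field_vs"
          using \<phi>[OF that(1)] U by (intro lin_restrict) (simp_all add: subsp_def)
        have fx: "f (x j) \<in> ?U" using x that by auto
        have cl: "(\<lambda>c. \<chi> c (f (x j)) \<odot>\<^bsub>N\<^esub> c) \<in> C \<rightarrow> carrier ?NU"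
          using C'(2) U by (auto simp: subsp_def)
        have "\<phi> i (f (x j)) = \<phi> i (finsum ?NU (\<lambda>c. \<chi> c (f (x j)) \<odot>\<^bsub>N\<^esub> c) C)"
          using C'(3)[OF fx] by simp
        also have "\<dots> = (\<Sum>c\<in>C. \<phi> i (\<chi> c (f (x j)) \<odot>\<^bsub>N\<^esub> c))"
          by (subst lin_finsum[OF lin NU vspace_field_vs cl]) (simp add: finsum_field_vs C'(1))
        also have "\<dots> = (\<Sum>c\<in>C. \<phi> i c * \<chi> c (f (x j)))"
          using C'(2) U lin_smult[OF \<phi>[OF that(1)]]
          by (intro sum.cong) (auto simp: subsp_def mult.commute subset_iff)
        also have "\<dots> = (\<Sum>l<card C. \<phi> i (e l) * \<chi> (e l) (f (x j)))"
          by (rule sum.reindex_bij_betw[OF e, symmetric])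
        finally show ?thesis .
      qed
      then have "Matrix.mat n n (\<lambda>(i, j). \<phi> i (f (x j))) =
          Matrix.mat n n (\<lambda>(i, j). \<Sum>l<card C. \<phi> i (e l) * \<chi> (e l) (f (x j)))"
        by (intro eq_matI) auto
      then show False
        using det det_mult_rank_lt[of "card C" n "\<lambda>i l. \<phi> i (e l)" "\<lambda>l j. \<chi> (e l) (f (x j))"] lt C(2) c(4) by simp
    qed
  qed
qed

text \<open>The locus is the common zero set of all minors of size \<open>n\<close>, for every
  choice of vectors and functionals. Zero loci of arbitrary families are closed, so no bases have to
  be fixed and \<open>M\<close> need not be finite-dimensional.\<close>

lemma closedin_rank_less:
  fixes V :: "('k::field, 'v) module" and M :: "('k, 'm) module" and N :: "('k, 'n) module"
  assumes V: "vspace V" and M: "vspace M" and N: "fdvs N"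
    and F: "\<And>v. v \<in> carrier V \<Longrightarrow> F v \<in> lin M N"
    and lin: "\<And>x. x \<in> carrier M \<Longrightarrow> (\<lambda>v. F v x) \<in> lin V N"
  shows "closedin (zariski V) {v \<in> carrier V. rank_of M N (F v) < n}"
proof -
  define ok where "ok x \<phi> \<longleftrightarrow> (\<forall>j<n. x j \<in> carrier M) \<and> (\<forall>i<n. \<phi> i \<in> lin N field_vs)"
    for x and \<phi> :: "nat \<Rightarrow> 'n \<Rightarrow> 'k"
  define minor where "minor x \<phi> v = det (Matrix.mat n n (\<lambda>(i, j). \<phi> i (F v (x j))))"
    for x and \<phi> :: "nat \<Rightarrow> 'n \<Rightarrow> 'k" and v
  let ?minors = "{minor x \<phi> | x \<phi>. ok x \<phi>}"
  have "minor x \<phi> \<in> poly_funs V" if "ok x \<phi>" for x \<phi>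
    unfolding minor_def
    by (rule poly_funs_det, rule poly_funs.linear, rule lin_comp[OF lin]) (use that in \<open>auto simp: ok_def\<close>)
  then have "?minors \<subseteq> poly_funs V" by blast
  moreover have "{v \<in> carrier V. rank_of M N (F v) < n} = zero_locus V ?minors"
  proof -
    have "rank_of M N (F v) < n \<longleftrightarrow> (\<forall>x \<phi>. ok x \<phi> \<longrightarrow> minor x \<phi> v = 0)" if "v \<in> carrier V" for v
    proof -
      have "n \<le> rank_of M N (F v) \<longleftrightarrow> (\<exists>x \<phi>. ok x \<phi> \<and> minor x \<phi> v \<noteq> 0)"
        using le_rank_iff_minor[OF F[OF that] M N, of n] unfolding ok_def minor_def by (simp only: conj_assoc)
      then show ?thesis using not_le[of n "rank_of M N (F v)"] by blast
    qed
    then show ?thesis unfolding zero_locus_def by blast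
  qed
  ultimately show ?thesis by (simp only: closedin_zero_locus)
qed

text \<open>Natural numbers are well-ordered, so a least value \<open>d\<close> is attained on
  \<open>Z\<close>. Where the function is less than \<open>d + 1\<close> it equals \<open>d\<close>;
  this set is open and nonempty in \<open>Z\<close>, hence dense by irreducibility.\<close>

lemma upper_semicontinuous_min_on_component:
  assumes usc: "upper_semicontinuous X \<delta>" and Z: "irreducible_component X Z"
  shows "\<exists>U. openin (subtopology X Z) U \<and> subtopology X Z closure_of U = Z \<and>
    (\<exists>d. (\<forall>x\<in>U. \<delta> x = d) \<and> (\<forall>x\<in>Z. d \<le> \<delta> x))"
proof -
  have irr: "Z \<subseteq> topspace X" "Z \<noteq> {}"
      "\<And>A B. closedin X A \<Longrightarrow> closedin X B \<Longrightarrow> Z \<subseteq> A \<union> B \<Longrightarrow> Z \<subseteq> A \<or> Z \<subseteq> B"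
    using Z by (auto simp: irreducible_component_def irreducible_set_def)
  define d where "d = (LEAST n. n \<in> \<delta> ` Z)"
  have "d \<in> \<delta> ` Z" unfolding d_def using irr(2) by (metis LeastI ex_in_conv image_is_empty)
  then obtain z where z: "z \<in> Z" "\<delta> z = d" by auto
  have d: "d \<le> \<delta> x" if "x \<in> Z" for x unfolding d_def using that by (simp add: Least_le)
  define C where "C = {x \<in> topspace X. Suc d \<le> \<delta> x}"
  have C: "closedin X C" using usc by (simp add: upper_semicontinuous_def C_def)
  have op: "openin (subtopology X Z) (Z \<inter> (topspace X - C))"
    using C by (metis openin_diff openin_subtopology_Int2 openin_topspace)
  have "Z \<subseteq> subtopology X Z closure_of (Z \<inter> (topspace X - C))"
  proof -
    obtain D where D: "closedin X D" "subtopology X Z closure_of (Z \<inter> (topspace X - C)) = D \<inter> Z"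
      using closedin_closure_of[of "subtopology X Z"] unfolding closedin_subtopology by metis
    have "Z \<inter> (topspace X - C) \<subseteq> D"
      using closure_of_subset[of "Z \<inter> (topspace X - C)" "subtopology X Z"] D(2) by auto
    \<comment> \<open>\<open>D\<close> is closed and contains the part of \<open>Z\<close> outside
      \<open>C\<close>. As the minimum point \<open>z\<close> is not in \<open>C\<close>,
      irreducibility forces \<open>Z\<close> into \<open>D\<close>.\<close>
    then have "Z \<subseteq> C \<union> D" using irr(1) by auto
    then have "Z \<subseteq> C \<or> Z \<subseteq> D" by (rule irr(3)[OF C D(1)])
    moreover have "z \<notin> C" using z by (simp add: C_def)
    ultimately show ?thesis using z(1) D(2) by auto
  qed
  moreover have "subtopology X Z closure_of (Z \<inter> (topspace X - C)) \<subseteq> Z"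
    using closure_of_subset_topspace[of "subtopology X Z"] by auto
  ultimately have cl: "subtopology X Z closure_of (Z \<inter> (topspace X - C)) = Z" by blast
  have "\<forall>x\<in>Z \<inter> (topspace X - C). \<delta> x = d"
    using d by (auto simp: C_def not_le less_Suc_eq_le intro: antisym)
  then show ?thesis using op cl d by (intro exI conjI) auto
qed

section \<open>Multilinearity of iterated pure tensors and comparison of ranks\<close>

lemma lin_tens3:
  assumes L: "vspace L" and M: "vspace M" and N: "vspace N"
  shows "y \<in> carrier M \<Longrightarrow> z \<in> carrier N \<Longrightarrow> (\<lambda>x. tens3 L M N x y z) \<in> lin L (tensor3 L M N)"
    "x \<in> carrier L \<Longrightarrow> z \<in> carrier N \<Longrightarrow> (\<lambda>y. tens3 L M N x y z) \<in> lin M (tensor3 L M N)"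
    "x \<in> carrier L \<Longrightarrow> y \<in> carrier M \<Longrightarrow> (\<lambda>z. tens3 L M N x y z) \<in> lin N (tensor3 L M N)"
    "x \<in> carrier L \<Longrightarrow> y \<in> carrier M \<Longrightarrow> z \<in> carrier N \<Longrightarrow> tens3 L M N x y z \<in> carrier (tensor3 L M N)"
proof -
  note LM = vspace_tensor[OF L M]
  show "y \<in> carrier M \<Longrightarrow> z \<in> carrier N \<Longrightarrow> (\<lambda>x. tens3 L M N x y z) \<in> lin L (tensor3 L M N)"
    by (rule lin_comp[OF lin_tens_left[OF L M] lin_tens_left[OF LM N]])
  show "x \<in> carrier L \<Longrightarrow> z \<in> carrier N \<Longrightarrow> (\<lambda>y. tens3 L M N x y z) \<in> lin M (tensor3 L M N)"
    by (rule lin_comp[OF lin_tens_right[OF L M] lin_tens_left[OF LM N]])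
  show "x \<in> carrier L \<Longrightarrow> y \<in> carrier M \<Longrightarrow> (\<lambda>z. tens3 L M N x y z) \<in> lin N (tensor3 L M N)"
    by (rule lin_tens_right[OF LM N tens_closed[OF L M]])
  show "x \<in> carrier L \<Longrightarrow> y \<in> carrier M \<Longrightarrow> z \<in> carrier N \<Longrightarrow> tens3 L M N x y z \<in> carrier (tensor3 L M N)"
    by (intro tens_closed L M N LM)
qed

lemma lin_tens4:
  assumes K: "vspace K" and L: "vspace L" and M: "vspace M" and N: "vspace N"
  shows "x \<in> carrier L \<Longrightarrow> y \<in> carrier M \<Longrightarrow> z \<in> carrier N \<Longrightarrow>
      (\<lambda>w. tens4 K L M N w x y z) \<in> lin K (tensor4 K L M N)"
    "w \<in> carrier K \<Longrightarrow> y \<in> carrier M \<Longrightarrow> z \<in> carrier N \<Longrightarrow>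
      (\<lambda>x. tens4 K L M N w x y z) \<in> lin L (tensor4 K L M N)"
    "w \<in> carrier K \<Longrightarrow> x \<in> carrier L \<Longrightarrow> z \<in> carrier N \<Longrightarrow>
      (\<lambda>y. tens4 K L M N w x y z) \<in> lin M (tensor4 K L M N)"
    "w \<in> carrier K \<Longrightarrow> x \<in> carrier L \<Longrightarrow> y \<in> carrier M \<Longrightarrow>
      (\<lambda>z. tens4 K L M N w x y z) \<in> lin N (tensor4 K L M N)"
    "w \<in> carrier K \<Longrightarrow> x \<in> carrier L \<Longrightarrow> y \<in> carrier M \<Longrightarrow> z \<in> carrier N \<Longrightarrow>
      tens4 K L M N w x y z \<in> carrier (tensor4 K L M N)"
proof -
  note KLM = vspace_tensor[OF vspace_tensor[OF K L] M]
  note t3 = lin_tens3[OF K L M]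
  show "x \<in> carrier L \<Longrightarrow> y \<in> carrier M \<Longrightarrow> z \<in> carrier N \<Longrightarrow>
      (\<lambda>w. tens4 K L M N w x y z) \<in> lin K (tensor4 K L M N)"
    by (rule lin_comp[OF t3(1) lin_tens_left[OF KLM N]])
  show "w \<in> carrier K \<Longrightarrow> y \<in> carrier M \<Longrightarrow> z \<in> carrier N \<Longrightarrow>
      (\<lambda>x. tens4 K L M N w x y z) \<in> lin L (tensor4 K L M N)"
    by (rule lin_comp[OF t3(2) lin_tens_left[OF KLM N]])
  show "w \<in> carrier K \<Longrightarrow> x \<in> carrier L \<Longrightarrow> z \<in> carrier N \<Longrightarrow>
      (\<lambda>y. tens4 K L M N w x y z) \<in> lin M (tensor4 K L M N)"
    by (rule lin_comp[OF t3(3) lin_tens_left[OF KLM N]])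
  show "w \<in> carrier K \<Longrightarrow> x \<in> carrier L \<Longrightarrow> y \<in> carrier M \<Longrightarrow>
      (\<lambda>z. tens4 K L M N w x y z) \<in> lin N (tensor4 K L M N)"
    by (rule lin_tens_right[OF KLM N t3(4)])
  show "w \<in> carrier K \<Longrightarrow> x \<in> carrier L \<Longrightarrow> y \<in> carrier M \<Longrightarrow> z \<in> carrier N \<Longrightarrow>
      tens4 K L M N w x y z \<in> carrier (tensor4 K L M N)"
    by (intro tens_closed N KLM t3(4))
qed

lemma lin_tensor4_param:
  assumes K: "vspace K" and L: "vspace L" and M: "vspace M" and N: "vspace N" and P: "vspace P" and V: "vspace V"
    and G: "\<And>v. v \<in> carrier V \<Longrightarrow> G v \<in> lin (tensor4 K L M N) P"
    and pure: "\<And>w x y z. w \<in> carrier K \<Longrightarrow> x \<in> carrier L \<Longrightarrow> y \<in> carrier M \<Longrightarrow> z \<in> carrier N \<Longrightarrow>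
      (\<lambda>v. G v (tens4 K L M N w x y z)) \<in> lin V P"
    and t: "t \<in> carrier (tensor4 K L M N)"
  shows "(\<lambda>v. G v t) \<in> lin V P"
  using K L M N t
proof (induction rule: tensor4_induct)
  case (tens w x y z)
  then show ?case by (rule pure)
next
  case (add s t)
  show ?case
    by (rule lin_cong[OF lin_plus[OF add(3,4) P] V]) (simp add: lin_add[OF G] add)
qed

lemma lin_neg: "f \<in> lin M N \<Longrightarrow> vspace M \<Longrightarrow> vspace N \<Longrightarrow> (\<lambda>x. \<ominus>\<^bsub>N\<^esub> f x) \<in> lin M N"
  by (rule lin_cong[OF lin_scale[of f M N "- 1"]]) (simp_all add: vs_neg_eq lin_closed)

text \<open>Only the images are compared: a linear map cannot increase the dimension of the image of
  \<open>f\<close>. No map between the sources \<open>M'\<close> and \<open>M\<close> has to be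
  constructed.\<close>

lemma rank_of_le_image:
  assumes f: "f \<in> lin M N" and f': "f' \<in> lin M' N'" and L: "L \<in> lin N N'"
    and M: "vspace M" and M': "vspace M'" and N: "fdvs N" and N': "fdvs N'"
    and sub: "\<And>x. x \<in> carrier M' \<Longrightarrow> f' x \<in> L ` f ` carrier M"
  shows "rank_of M' N' f' \<le> rank_of M N f"
proof -
  have U: "subsp (f ` carrier M) N" and U': "subsp (f' ` carrier M') N'"
    using assms by (auto intro!: subsp_range)
  have "vdim (N'\<lparr>carrier := f' ` carrier M'\<rparr>) \<le> vdim (N'\<lparr>carrier := L ` f ` carrier M\<rparr>)"
    using sub N N' by (intro vdim_mono U' subsp_image[OF L _ _ U]) auto
  also have "\<dots> \<le> vdim (N\<lparr>carrier := f ` carrier M\<rparr>)"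
    using N' by (intro vdim_image_le[OF L N _ U]) auto
  finally show ?thesis by (simp add: rank_of_def)
qed

lemma tensor_map:
  assumes f: "f \<in> lin M M'" and f': "f' \<in> lin N N'" and "vspace M" "vspace N" "vspace M'" "vspace N'"
  obtains F where "F \<in> lin (tensor M N) (tensor M' N')"
    "\<And>x y. x \<in> carrier M \<Longrightarrow> y \<in> carrier N \<Longrightarrow> F (tens M N x y) = tens M' N' (f x) (f' y)"
proof (rule tensor_lift[of M N "tensor M' N'" "\<lambda>x y. tens M' N' (f x) (f' y)"])
  show "bilin M N (tensor M' N') (\<lambda>x y. tens M' N' (f x) (f' y))"
    unfolding bilin_def using assms
    by (intro conjI ballI lin_comp[OF f lin_tens_left] lin_comp[OF f' lin_tens_right]) (auto intro: lin_closed)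
qed (use assms vspace_tensor in blast)+

section \<open>The maps \<open>\<Theta>\<close> and \<open>B\<close>\<close>

locale tensor_setting =
  fixes E :: "('k::field, 'e) module" and W :: "('k, 'w) module"
  assumes fdE: "fdvs E" and fdW: "fdvs W"
begin

abbreviation "EE \<equiv> tensor E E"
abbreviation "EEE \<equiv> tensor3 E E E"
abbreviation "EEEE \<equiv> tensor4 E E E E"
abbreviation "WE \<equiv> tensor W E"
abbreviation "EW \<equiv> tensor E W"
abbreviation "t3 \<equiv> tens3 E E E"
abbreviation "BB \<equiv> direct_sum WE EW"

lemma vE: "vspace E" and vW: "vspace W"
  using fdE fdW by auto

lemma fd_tensors: "fdvs EE" "fdvs EEE" "fdvs EEEE" "fdvs WE" "fdvs EW" "fdvs BB" "fdvs (hom_vs E W)"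
  by (intro fdvs_tensor(1) fdvs_direct_sum(1) fdvs_hom_vs fdE fdW)+

lemmas v_tensors = fd_tensors[THEN fdvs_vspace]

lemma vV: "vspace (tensor_maps E W)"
  unfolding tensor_maps_def by (intro vspace_hom_vs v_tensors vW)

lemmas t3_lin = lin_tens3[OF vE vE vE]

lemma surj_tensor_mapsD: "\<mu> \<in> surj_tensor_maps E W \<Longrightarrow> \<mu> \<in> carrier (tensor_maps E W)"
  by (simp add: surj_tensor_maps_def)

lemma tensor_maps_lin: "\<mu> \<in> carrier (tensor_maps E W) \<Longrightarrow> \<mu> \<in> lin EEE W"
  unfolding tensor_maps_def by (rule hom_vs_lin)

lemma mu_lin:
  assumes "\<mu> \<in> carrier (tensor_maps E W)"
  shows "b \<in> carrier E \<Longrightarrow> c \<in> carrier E \<Longrightarrow> (\<lambda>a. \<mu> (t3 a b c)) \<in> lin E W"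
    "a \<in> carrier E \<Longrightarrow> c \<in> carrier E \<Longrightarrow> (\<lambda>b. \<mu> (t3 a b c)) \<in> lin E W"
    "a \<in> carrier E \<Longrightarrow> b \<in> carrier E \<Longrightarrow> (\<lambda>c. \<mu> (t3 a b c)) \<in> lin E W"
  by (blast intro: lin_comp[OF t3_lin(1) tensor_maps_lin[OF assms]])
    (blast intro: lin_comp[OF t3_lin(2) tensor_maps_lin[OF assms]]
      lin_comp[OF t3_lin(3) tensor_maps_lin[OF assms]])+

lemma mu_closed:
  "\<mu> \<in> carrier (tensor_maps E W) \<Longrightarrow> a \<in> carrier E \<Longrightarrow> b \<in> carrier E \<Longrightarrow> c \<in> carrier E \<Longrightarrow>
    \<mu> (t3 a b c) \<in> carrier W"
  using tensor_maps_lin lin_closed t3_lin(4) by metis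

lemma eval_lin: "x \<in> carrier EEE \<Longrightarrow> (\<lambda>\<mu>. \<mu> x) \<in> lin (tensor_maps E W) W"
  unfolding tensor_maps_def by (rule lin_hom_vs_apply)

text \<open>Existence comes from the universal property applied to the curried trilinear map.
  Uniqueness holds because pure tensors generate additively and the values, being extensional, are
  determined by evaluation. The later definite descriptions are resolved in the same way.\<close>

lemma Theta:
  assumes mu: "\<mu> \<in> carrier (tensor_maps E W)"
  shows "Theta E W \<mu> \<in> carrier (hom_vs EE (hom_vs E W))"
    "a \<in> carrier E \<Longrightarrow> b \<in> carrier E \<Longrightarrow> c \<in> carrier E \<Longrightarrow> Theta E W \<mu> (tens E E a b) c = \<mu> (t3 a b c)"
proof -
  let ?P = "\<lambda>\<theta>. \<theta> \<in> carrier (hom_vs EE (hom_vs E W)) \<and>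
    (\<forall>a\<in>carrier E. \<forall>b\<in>carrier E. \<forall>c\<in>carrier E. \<theta> (tens E E a b) c = \<mu> (t3 a b c))"
  let ?f = "\<lambda>a b. \<lambda>c\<in>carrier E. \<mu> (t3 a b c)"
  have "bilin E E (hom_vs E W) ?f"
    unfolding bilin_def
    by (intro conjI ballI lin_into_hom_vs restrict_hom_vs vE vW mu_lin[OF mu])
      (simp_all add: mu_lin[OF mu])
  then obtain g where g: "g \<in> lin EE (hom_vs E W)"
    "\<And>a b. a \<in> carrier E \<Longrightarrow> b \<in> carrier E \<Longrightarrow> g (tens E E a b) = ?f a b"
    by (rule tensor_lift[OF vE vE _ v_tensors(7)]) blast
  have "?P (restrict g (carrier EE))"
    using restrict_hom_vs[OF v_tensors(1) g(1)] g(2) by (simp add: tens_closed vE)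
  moreover have "\<theta> = \<theta>'" if "?P \<theta>" "?P \<theta>'" for \<theta> \<theta>'
  proof (rule hom_vs_eqI)
    fix x assume x: "x \<in> carrier EE"
    show "\<theta> x = \<theta>' x"
    proof (rule tensor_lin_eq[OF vE vE _ _ x])
      fix a b assume ab: "a \<in> carrier E" "b \<in> carrier E"
      then have t: "tens E E a b \<in> carrier EE" by (intro tens_closed vE)
      show "\<theta> (tens E E a b) = \<theta>' (tens E E a b)"
      proof (rule hom_vs_eqI[of _ E W])
        show "\<theta> (tens E E a b) \<in> carrier (hom_vs E W)" "\<theta>' (tens E E a b) \<in> carrier (hom_vs E W)"
          using hom_vs_closed[OF _ t, of _ "hom_vs E W"] that by blast+
      qed (use that ab in simp)
    qed (use that in \<open>auto intro: hom_vs_lin\<close>)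
  qed (use that in auto)
  ultimately have "\<exists>!\<theta>. ?P \<theta>" by blast
  from theI'[OF this] have "?P (Theta E W \<mu>)" unfolding Theta_def .
  then show "Theta E W \<mu> \<in> carrier (hom_vs EE (hom_vs E W))"
    "a \<in> carrier E \<Longrightarrow> b \<in> carrier E \<Longrightarrow> c \<in> carrier E \<Longrightarrow> Theta E W \<mu> (tens E E a b) c = \<mu> (t3 a b c)"
    by auto
qed

lemma Theta_lin: "\<mu> \<in> carrier (tensor_maps E W) \<Longrightarrow> Theta E W \<mu> \<in> lin EE (hom_vs E W)"
  by (rule hom_vs_lin[OF Theta(1)])

lemma Bmap:
  assumes mu: "\<mu> \<in> carrier (tensor_maps E W)"
  shows "Bmap E W \<mu> \<in> carrier (hom_vs EEEE BB)"
    "a \<in> carrier E \<Longrightarrow> b \<in> carrier E \<Longrightarrow> c \<in> carrier E \<Longrightarrow> d \<in> carrier E \<Longrightarrow>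
      Bmap E W \<mu> (tens4 E E E E a b c d) =
        (tens W E (\<mu> (t3 a b c)) d, \<ominus>\<^bsub>EW\<^esub> tens E W a (\<mu> (t3 b c d)))"
proof -
  let ?f = "\<lambda>a b c d. (tens W E (\<mu> (t3 a b c)) d, \<ominus>\<^bsub>EW\<^esub> tens E W a (\<mu> (t3 b c d)))"
  let ?P = "\<lambda>\<beta>. \<beta> \<in> carrier (hom_vs EEEE BB) \<and>
    (\<forall>a\<in>carrier E. \<forall>b\<in>carrier E. \<forall>c\<in>carrier E. \<forall>d\<in>carrier E. \<beta> (tens4 E E E E a b c d) = ?f a b c d)"
  obtain g where g: "g \<in> lin EEEE BB"
    "\<And>a b c d. a \<in> carrier E \<Longrightarrow> b \<in> carrier E \<Longrightarrow> c \<in> carrier E \<Longrightarrow> d \<in> carrier E \<Longrightarrow>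
      g (tens4 E E E E a b c d) = ?f a b c d"
  proof (rule tensor4_lift[OF vE vE vE vE v_tensors(6), of ?f])
    fix b c d assume *: "b \<in> carrier E" "c \<in> carrier E" "d \<in> carrier E"
    show "(\<lambda>a. ?f a b c d) \<in> lin E BB"
      using * by (intro lin_Pair lin_neg vE v_tensors lin_comp[OF mu_lin(1)[OF mu] lin_tens_left]
          lin_tens_left vW mu_closed[OF mu])
  next
    fix a c d assume *: "a \<in> carrier E" "c \<in> carrier E" "d \<in> carrier E"
    show "(\<lambda>b. ?f a b c d) \<in> lin E BB"
      using * by (intro lin_Pair lin_neg vE v_tensors lin_comp[OF mu_lin(2)[OF mu] lin_tens_left]
          lin_comp[OF mu_lin(1)[OF mu] lin_tens_right] vW)
  next
    fix a b d assume *: "a \<in> carrier E" "b \<in> carrier E" "d \<in> carrier E"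
    show "(\<lambda>c. ?f a b c d) \<in> lin E BB"
      using * by (intro lin_Pair lin_neg vE v_tensors lin_comp[OF mu_lin(3)[OF mu] lin_tens_left]
          lin_comp[OF mu_lin(2)[OF mu] lin_tens_right] vW)
  next
    fix a b c assume *: "a \<in> carrier E" "b \<in> carrier E" "c \<in> carrier E"
    show "(\<lambda>d. ?f a b c d) \<in> lin E BB"
      using * by (intro lin_Pair lin_neg vE v_tensors lin_tens_right
          lin_comp[OF mu_lin(3)[OF mu] lin_tens_right] vW mu_closed[OF mu])
  qed blast
  have "?P (restrict g (carrier EEEE))"
    using restrict_hom_vs[OF v_tensors(3) g(1)] g(2) lin_tens4(5)[OF vE vE vE vE] by simp
  moreover have "\<beta> = \<beta>'" if "?P \<beta>" "?P \<beta>'" for \<beta> \<beta>'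
  proof (rule hom_vs_eqI)
    show "\<beta> x = \<beta>' x" if "x \<in> carrier EEEE" for x
      by (rule tensor4_lin_eq[OF vE vE vE vE _ _ _ that, of _ BB])
        (use \<open>?P \<beta>\<close> \<open>?P \<beta>'\<close> in \<open>auto intro: hom_vs_lin\<close>)
  qed (use that in auto)
  ultimately have "\<exists>!\<beta>. ?P \<beta>" by blast
  from theI'[OF this] have "?P (Bmap E W \<mu>)" unfolding Bmap_def .
  then show "Bmap E W \<mu> \<in> carrier (hom_vs EEEE BB)"
    "a \<in> carrier E \<Longrightarrow> b \<in> carrier E \<Longrightarrow> c \<in> carrier E \<Longrightarrow> d \<in> carrier E \<Longrightarrow>
      Bmap E W \<mu> (tens4 E E E E a b c d) = ?f a b c d"
    by auto
qed

lemma Bmap_lin: "\<mu> \<in> carrier (tensor_maps E W) \<Longrightarrow> Bmap E W \<mu> \<in> lin EEEE BB"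
  by (rule hom_vs_lin[OF Bmap(1)])

section \<open>Closedness of the rank loci\<close>

text \<open>On pure tensors, and after evaluation at \<open>c\<close>, the dependence on
  \<open>\<mu>\<close> is evaluation of \<open>\<mu>\<close> at a fixed tensor. This makes the
  minors of \<open>Theta\<close> polynomial.\<close>

lemma Theta_lin_param:
  assumes x: "x \<in> carrier EE"
  shows "(\<lambda>\<mu>. Theta E W \<mu> x) \<in> lin (tensor_maps E W) (hom_vs E W)"
proof (rule lin_tensor_param[OF vE vE v_tensors(7) vV Theta_lin _ x])
  fix a b assume ab: "a \<in> carrier E" "b \<in> carrier E"
  then have t: "tens E E a b \<in> carrier EE" by (intro tens_closed vE)
  show "(\<lambda>\<mu>. Theta E W \<mu> (tens E E a b)) \<in> lin (tensor_maps E W) (hom_vs E W)"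
  proof (rule lin_into_hom_vs[OF _ _ vV vE vW])
    show "Theta E W \<mu> (tens E E a b) \<in> carrier (hom_vs E W)" if "\<mu> \<in> carrier (tensor_maps E W)" for \<mu>
      using hom_vs_closed[OF Theta(1)[OF that] t] .
    show "(\<lambda>\<mu>. Theta E W \<mu> (tens E E a b) c) \<in> lin (tensor_maps E W) W" if "c \<in> carrier E" for c
      by (rule lin_cong[OF eval_lin[OF t3_lin(4)[OF ab that]] vV]) (simp add: Theta ab that)
  qed
qed

lemma Bmap_lin_param:
  assumes x: "x \<in> carrier EEEE"
  shows "(\<lambda>\<mu>. Bmap E W \<mu> x) \<in> lin (tensor_maps E W) BB"
proof (rule lin_tensor4_param[OF vE vE vE vE v_tensors(6) vV Bmap_lin _ x])
  fix a b c d assume *: "a \<in> carrier E" "b \<in> carrier E" "c \<in> carrier E" "d \<in> carrier E"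
  have "(\<lambda>\<mu>. (tens W E (\<mu> (t3 a b c)) d, \<ominus>\<^bsub>EW\<^esub> tens E W a (\<mu> (t3 b c d)))) \<in> lin (tensor_maps E W) BB"
    using * by (intro lin_Pair lin_neg v_tensors vV lin_comp[OF eval_lin lin_tens_left]
        lin_comp[OF eval_lin lin_tens_right] vE vW t3_lin(4))
  then show "(\<lambda>\<mu>. Bmap E W \<mu> (tens4 E E E E a b c d)) \<in> lin (tensor_maps E W) BB"
    by (rule lin_cong[OF _ vV]) (simp add: Bmap *)
qed

lemma surj_iff_rank:
  assumes mu: "\<mu> \<in> carrier (tensor_maps E W)"
  shows "\<mu> \<in> surj_tensor_maps E W \<longleftrightarrow> \<not> rank_of EEE W \<mu> < vdim W"
proof
  assume "\<mu> \<in> surj_tensor_maps E W"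
  then show "\<not> rank_of EEE W \<mu> < vdim W" by (simp add: surj_tensor_maps_def rank_of_def)
next
  assume "\<not> rank_of EEE W \<mu> < vdim W"
  then have "\<mu> ` carrier EEE = carrier W"
    using subsp_eq_carrier[OF fdW subsp_range[OF tensor_maps_lin[OF mu] v_tensors(2) vW]]
    by (simp add: rank_of_def)
  then show "\<mu> \<in> surj_tensor_maps E W" using mu by (simp add: surj_tensor_maps_def)
qed

text \<open>Surjectivity means rank at least \<open>vdim W\<close>, the complement of a closed locus
  of smaller rank.\<close>

lemma openin_surj: "openin (zariski (tensor_maps E W)) (surj_tensor_maps E W)"
proof -
  let ?C = "{\<mu> \<in> carrier (tensor_maps E W). rank_of EEE W \<mu> < vdim W}"
  have "closedin (zariski (tensor_maps E W)) ?C"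
    by (rule closedin_rank_less[OF vV v_tensors(2) fdW tensor_maps_lin eval_lin])
  then have "openin (zariski (tensor_maps E W)) (carrier (tensor_maps E W) - ?C)"
    by (simp add: closedin_def topspace_zariski)
  moreover have "carrier (tensor_maps E W) - ?C = surj_tensor_maps E W"
    using surj_iff_rank surj_tensor_mapsD by blast
  ultimately show ?thesis by simp
qed

lemma topspace_surj: "topspace (surj_topology E W) = surj_tensor_maps E W"
  using openin_subset[OF openin_surj] by auto

lemma closedin_X_locus: "closedin (surj_topology E W) (X_locus E W a b)"
proof -
  let ?V = "tensor_maps E W"
  \<comment> \<open>A rank is at most \<open>a\<close> iff it is less than \<open>a + 1\<close>. For
    negative \<open>a\<close> the truncation \<open>nat (a + 1)\<close> is zero, and the locus is
    empty as it should be.\<close>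
  let ?C = "{\<mu> \<in> carrier ?V. rank_of EE (hom_vs E W) (Theta E W \<mu>) < nat (a + 1)}"
  let ?D = "{\<mu> \<in> carrier ?V. rank_of EEEE BB (Bmap E W \<mu>) < nat (b + 1)}"
  have "closedin (zariski ?V) ?C"
    by (rule closedin_rank_less[OF vV v_tensors(1) fd_tensors(7) Theta_lin Theta_lin_param])
  moreover have "closedin (zariski ?V) ?D"
    by (rule closedin_rank_less[OF vV v_tensors(3) fd_tensors(6) Bmap_lin Bmap_lin_param])
  moreover have "X_locus E W a b = (?C \<inter> ?D) \<inter> surj_tensor_maps E W"
    unfolding X_locus_def rank_Theta_def rank_B_def using surj_tensor_mapsD by auto
  ultimately show ?thesis
    unfolding closedin_subtopology by (intro exI[of _ "?C \<inter> ?D"]) (simp add: closedin_Int)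
qed

section \<open>Invariance under the general linear groups\<close>

lemma GL_vsD:
  assumes g: "g \<in> GL_vs V" and V: "vspace V"
  shows "g \<in> lin V V" "inv_into (carrier V) g \<in> lin V V"
    "x \<in> carrier V \<Longrightarrow> g (inv_into (carrier V) g x) = x"
    "x \<in> carrier V \<Longrightarrow> inv_into (carrier V) g (g x) = x"
proof -
  show lin: "g \<in> lin V V" using g by (simp add: GL_vs_def hom_vs_lin)
  have b: "bij_betw g (carrier V) (carrier V)" using g by (simp add: GL_vs_def)
  show r: "g (inv_into (carrier V) g x) = x" if "x \<in> carrier V" for x
    using bij_betw_inv_into_right[OF b that] .
  show l: "inv_into (carrier V) g (g x) = x" if "x \<in> carrier V" for x
    using bij_betw_inv_into_left[OF b that] .
  have cl: "inv_into (carrier V) g x \<in> carrier V" if "x \<in> carrier V" for x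
    using bij_betw_inv_into[OF b] that by (auto simp: bij_betw_def)
  show "inv_into (carrier V) g \<in> lin V V"
  proof (rule linI)
    show "inv_into (carrier V) g (x \<oplus>\<^bsub>V\<^esub> y) = inv_into (carrier V) g x \<oplus>\<^bsub>V\<^esub> inv_into (carrier V) g y"
      if "x \<in> carrier V" "y \<in> carrier V" for x y
      using l[of "inv_into (carrier V) g x \<oplus>\<^bsub>V\<^esub> inv_into (carrier V) g y"] that cl r V
      by (simp add: lin_add[OF lin])
    show "inv_into (carrier V) g (c \<odot>\<^bsub>V\<^esub> x) = c \<odot>\<^bsub>V\<^esub> inv_into (carrier V) g x"
      if "x \<in> carrier V" for c x
      using l[of "c \<odot>\<^bsub>V\<^esub> inv_into (carrier V) g x"] that cl r V by (simp add: lin_smult[OF lin])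
  qed (rule cl)
qed

context
  fixes g h \<mu>
  assumes g: "g \<in> GL_vs E" and h: "h \<in> GL_vs W" and mu: "\<mu> \<in> carrier (tensor_maps E W)"
begin

abbreviation (input) "g' \<equiv> inv_into (carrier E) g"

lemmas gs = GL_vsD[OF g vE]
lemmas hs = GL_vsD[OF h vW]

lemma GL_act:
  shows "GL_act E W g h \<mu> \<in> carrier (tensor_maps E W)"
    "a \<in> carrier E \<Longrightarrow> b \<in> carrier E \<Longrightarrow> c \<in> carrier E \<Longrightarrow>
      GL_act E W g h \<mu> (t3 a b c) = h (\<mu> (t3 (g' a) (g' b) (g' c)))"
proof -
  let ?f = "\<lambda>a b c. h (\<mu> (t3 (g' a) (g' b) (g' c)))"
  let ?P = "\<lambda>\<nu>. \<nu> \<in> carrier (tensor_maps E W) \<and>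
    (\<forall>a\<in>carrier E. \<forall>b\<in>carrier E. \<forall>c\<in>carrier E. \<nu> (t3 a b c) = ?f a b c)"
  have cl: "g' a \<in> carrier E" if "a \<in> carrier E" for a using lin_closed[OF gs(2) that] .
  obtain \<nu> where nu: "\<nu> \<in> lin EEE W"
    "\<And>a b c. a \<in> carrier E \<Longrightarrow> b \<in> carrier E \<Longrightarrow> c \<in> carrier E \<Longrightarrow> \<nu> (t3 a b c) = ?f a b c"
  proof (rule tensor3_lift[OF vE vE vE vW, of ?f])
    show "(\<lambda>a. ?f a b c) \<in> lin E W" if "b \<in> carrier E" "c \<in> carrier E" for b c
      by (rule lin_comp[OF lin_comp[OF gs(2) mu_lin(1)[OF mu]] hs(1)]) (use that cl in auto)
    show "(\<lambda>b. ?f a b c) \<in> lin E W" if "a \<in> carrier E" "c \<in> carrier E" for a c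
      by (rule lin_comp[OF lin_comp[OF gs(2) mu_lin(2)[OF mu]] hs(1)]) (use that cl in auto)
    show "(\<lambda>c. ?f a b c) \<in> lin E W" if "a \<in> carrier E" "b \<in> carrier E" for a b
      by (rule lin_comp[OF lin_comp[OF gs(2) mu_lin(3)[OF mu]] hs(1)]) (use that cl in auto)
  qed blast
  have "?P (restrict \<nu> (carrier EEE))"
    using restrict_hom_vs[OF v_tensors(2) nu(1)] nu(2) t3_lin(4) by (simp add: tensor_maps_def)
  moreover have "\<nu> = \<nu>'" if "?P \<nu>" "?P \<nu>'" for \<nu> \<nu>'
  proof (rule hom_vs_eqI[of _ EEE W])
    show "\<nu> x = \<nu>' x" if "x \<in> carrier EEE" for x
      by (rule tensor3_lin_eq[OF vE vE vE tensor_maps_lin tensor_maps_lin _ that])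
        (use \<open>?P \<nu>\<close> \<open>?P \<nu>'\<close> in auto)
  qed (use that in \<open>auto simp: tensor_maps_def\<close>)
  ultimately have "\<exists>!\<nu>. ?P \<nu>" by blast
  from theI'[OF this] have "?P (GL_act E W g h \<mu>)" unfolding GL_act_def .
  then show "GL_act E W g h \<mu> \<in> carrier (tensor_maps E W)"
    "a \<in> carrier E \<Longrightarrow> b \<in> carrier E \<Longrightarrow> c \<in> carrier E \<Longrightarrow> GL_act E W g h \<mu> (t3 a b c) = ?f a b c"
    by auto
qed

text \<open>Every value of \<open>h \<circ> \<mu>\<close> is attained by the transformed tensor: at
  a pure tensor by applying \<open>g\<close> to the three arguments, and at sums by additivity.
  These values fill \<open>W\<close>, since \<open>h\<close> is bijective and \<open>\<mu>\<close>
  surjective.\<close>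

lemma GL_act_surj:
  assumes surj: "\<mu> \<in> surj_tensor_maps E W"
  shows "GL_act E W g h \<mu> \<in> surj_tensor_maps E W"
proof -
  let ?n = "GL_act E W g h \<mu>"
  note nl = tensor_maps_lin[OF GL_act(1)] and ml = tensor_maps_lin[OF mu]
  have "\<exists>u'\<in>carrier EEE. ?n u' = h (\<mu> u)" if "u \<in> carrier EEE" for u
    using vE vE vE that
  proof (induction rule: tensor3_induct)
    case (tens a b c)
    then show ?case
      by (intro bexI[of _ "t3 (g a) (g b) (g c)"]) (simp_all add: GL_act gs(4) lin_closed[OF gs(1)] t3_lin(4))
  next
    case (add s t)
    then obtain s' t' where "s' \<in> carrier EEE" "?n s' = h (\<mu> s)" "t' \<in> carrier EEE" "?n t' = h (\<mu> t)" by blast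
    with add show ?case
      by (intro bexI[of _ "s' \<oplus>\<^bsub>EEE\<^esub> t'"])
        (simp_all add: v_tensors lin_add[OF nl] lin_add[OF ml] lin_add[OF hs(1)] lin_closed[OF ml])
  qed
  moreover have "\<exists>u\<in>carrier EEE. h (\<mu> u) = w" if "w \<in> carrier W" for w
  proof -
    have "inv_into (carrier W) h w \<in> \<mu> ` carrier EEE"
      using surj lin_closed[OF hs(2) that] by (simp add: surj_tensor_maps_def)
    then show ?thesis using hs(3)[OF that] by force
  qed
  ultimately have "?n ` carrier EEE = carrier W"
    using lin_closed[OF nl] by (metis (no_types, lifting) image_subsetI subsetI subset_antisym image_eqI)
  then show ?thesis using GL_act(1) by (simp add: surj_tensor_maps_def)
qed

lemma rank_Theta_GL_act: "rank_Theta E W (GL_act E W g h \<mu>) \<le> rank_Theta E W \<mu>"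
  unfolding rank_Theta_def
proof (rule rank_of_le_image[OF Theta_lin[OF mu] Theta_lin[OF GL_act(1)]])
  let ?n = "GL_act E W g h \<mu>"
  \<comment> \<open>The transformed map at \<open>a \<otimes> b\<close> is the old one at
    \<open>g' a \<otimes> g' b\<close>, conjugated by
    \<open>f \<mapsto> h \<circ> f \<circ> g'\<close>.\<close>
  let ?L = "\<lambda>f. \<lambda>c\<in>carrier E. h (f (g' c))"
  have cl: "g' a \<in> carrier E" if "a \<in> carrier E" for a using lin_closed[OF gs(2) that] .
  show L: "?L \<in> lin (hom_vs E W) (hom_vs E W)"
  proof (rule lin_into_hom_vs[OF _ _ v_tensors(7) vE vW])
    show "?L f \<in> carrier (hom_vs E W)" if "f \<in> carrier (hom_vs E W)" for f
      by (rule restrict_hom_vs[OF vE lin_comp[OF lin_comp[OF gs(2) hom_vs_lin[OF that]] hs(1)]])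
    show "(\<lambda>f. ?L f c) \<in> lin (hom_vs E W) W" if "c \<in> carrier E" for c
      using lin_comp[OF lin_hom_vs_apply[OF cl[OF that]] hs(1)] that by simp
  qed
  fix x assume "x \<in> carrier EE"
  with vE vE show "Theta E W ?n x \<in> ?L ` Theta E W \<mu> ` carrier EE"
  proof (induction rule: tensor_induct)
    case (tens a b)
    have t: "tens E E a b \<in> carrier EE" "tens E E (g' a) (g' b) \<in> carrier EE"
      using tens cl by (auto intro!: tens_closed vE)
    have "Theta E W ?n (tens E E a b) = ?L (Theta E W \<mu> (tens E E (g' a) (g' b)))"
    proof (rule hom_vs_eqI[of _ E W])
      show "Theta E W ?n (tens E E a b) \<in> carrier (hom_vs E W)"
        using hom_vs_closed[OF Theta(1)[OF GL_act(1)] t(1)] .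
      show "?L (Theta E W \<mu> (tens E E (g' a) (g' b))) \<in> carrier (hom_vs E W)"
        using lin_closed[OF L hom_vs_closed[OF Theta(1)[OF mu] t(2)]] .
    qed (use tens cl in \<open>simp add: Theta(2)[OF mu] Theta(2)[OF GL_act(1)] GL_act(2)\<close>)
    then show ?case using t by blast
  next
    case (add s t)
    then obtain s' t' where "s' \<in> carrier EE" "Theta E W ?n s = ?L (Theta E W \<mu> s')"
      "t' \<in> carrier EE" "Theta E W ?n t = ?L (Theta E W \<mu> t')" by blast
    with add(1,2) have "Theta E W ?n (s \<oplus>\<^bsub>EE\<^esub> t) = ?L (Theta E W \<mu> (s' \<oplus>\<^bsub>EE\<^esub> t'))"
      by (simp only: lin_add[OF Theta_lin[OF GL_act(1)]] lin_add[OF Theta_lin[OF mu]] lin_add[OF L]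
          hom_vs_closed[OF Theta(1)[OF mu]])
    moreover have "s' \<oplus>\<^bsub>EE\<^esub> t' \<in> carrier EE"
      using \<open>s' \<in> carrier EE\<close> \<open>t' \<in> carrier EE\<close> by (simp add: v_tensors)
    ultimately show ?case by blast
  qed
qed (rule v_tensors fd_tensors)+

lemma rank_B_GL_act: "rank_B E W (GL_act E W g h \<mu>) \<le> rank_B E W \<mu>"
proof -
  let ?n = "GL_act E W g h \<mu>"
  have cl: "g' a \<in> carrier E" if "a \<in> carrier E" for a using lin_closed[OF gs(2) that] .
  obtain F where F: "F \<in> lin WE WE"
    "\<And>x y. x \<in> carrier W \<Longrightarrow> y \<in> carrier E \<Longrightarrow> F (tens W E x y) = tens W E (h x) (g y)"
    using tensor_map[OF hs(1) gs(1) vW vE vW vE] by blast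
  obtain G where G: "G \<in> lin EW EW"
    "\<And>x y. x \<in> carrier E \<Longrightarrow> y \<in> carrier W \<Longrightarrow> G (tens E W x y) = tens E W (g x) (h y)"
    using tensor_map[OF gs(1) hs(1) vE vW vE vW] by blast
  \<comment> \<open>The transport on the target of \<open>Bmap\<close> is
    \<open>(h \<otimes> g) \<oplus> (g \<otimes> h)\<close>: the argument of \<open>Bmap\<close>
    outside the ternary product is moved back by \<open>g\<close>, the product itself by
    \<open>h\<close>.\<close>
  let ?L = "\<lambda>p. (F (fst p), G (snd p))"
  have L: "?L \<in> lin BB BB"
    by (intro lin_Pair lin_comp[OF lin_fst F(1)] lin_comp[OF lin_snd G(1)])
  show ?thesis
    unfolding rank_B_def
  proof (rule rank_of_le_image[OF Bmap_lin[OF mu] Bmap_lin[OF GL_act(1)] L])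
    fix x assume "x \<in> carrier EEEE"
    with vE vE vE vE show "Bmap E W ?n x \<in> ?L ` Bmap E W \<mu> ` carrier EEEE"
    proof (induction rule: tensor4_induct)
      case (tens a b c d)
      have "Bmap E W ?n (tens4 E E E E a b c d) = ?L (Bmap E W \<mu> (tens4 E E E E (g' a) (g' b) (g' c) (g' d)))"
        using tens cl vE vW
        by (simp add: Bmap(2)[OF mu] Bmap(2)[OF GL_act(1)] GL_act(2) F(2) G(2) mu_closed[OF mu] gs(3)
            vs_neg_eq[OF v_tensors(5)] lin_smult[OF G(1)] tens_closed lin_closed[OF hs(1)])
      moreover have "tens4 E E E E (g' a) (g' b) (g' c) (g' d) \<in> carrier EEEE"
        using tens cl by (intro lin_tens4(5) vE)
      ultimately show ?case by blast
    next
      case (add s t)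
      then obtain s' t' where "s' \<in> carrier EEEE" "Bmap E W ?n s = ?L (Bmap E W \<mu> s')"
        "t' \<in> carrier EEEE" "Bmap E W ?n t = ?L (Bmap E W \<mu> t')" by blast
      with add(1,2) have "Bmap E W ?n (s \<oplus>\<^bsub>EEEE\<^esub> t) = ?L (Bmap E W \<mu> (s' \<oplus>\<^bsub>EEEE\<^esub> t'))"
        by (simp only: lin_add[OF Bmap_lin[OF GL_act(1)]] lin_add[OF Bmap_lin[OF mu]] lin_add[OF L]
            hom_vs_closed[OF Bmap(1)[OF mu]])
      moreover have "s' \<oplus>\<^bsub>EEEE\<^esub> t' \<in> carrier EEEE"
        using \<open>s' \<in> carrier EEEE\<close> \<open>t' \<in> carrier EEEE\<close> by (simp add: v_tensors)
      ultimately show ?case by blast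
    qed
  qed (rule v_tensors fd_tensors)+
qed

end

lemma GL_act_X_locus:
  assumes "g \<in> GL_vs E" "h \<in> GL_vs W" "\<mu> \<in> X_locus E W a b"
  shows "GL_act E W g h \<mu> \<in> X_locus E W a b"
proof -
  have s: "\<mu> \<in> surj_tensor_maps E W" using assms by (simp add: X_locus_def)
  note m = surj_tensor_mapsD[OF s]
  show ?thesis
    using assms(3) GL_act_surj[OF assms(1,2) m s] rank_Theta_GL_act[OF assms(1,2) m]
      rank_B_GL_act[OF assms(1,2) m]
    by (simp add: X_locus_def)
qed

end

section \<open>The tensor space of the operator rng and its projection to \<open>Q\<close>\<close>

lemma lin_scalar: "vspace V \<Longrightarrow> w \<in> carrier V \<Longrightarrow> (\<lambda>n. (n * m) \<odot>\<^bsub>V\<^esub> w) \<in> lin field_vs V"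
  by (rule linI) (simp_all add: vs_add_smult distrib_right mult.assoc flip: vs_smult_smult)

lemma tens_zero:
  assumes "vspace M" "vspace N"
  shows "y \<in> carrier N \<Longrightarrow> tens M N \<zero>\<^bsub>M\<^esub> y = \<zero>\<^bsub>tensor M N\<^esub>"
    "x \<in> carrier M \<Longrightarrow> tens M N x \<zero>\<^bsub>N\<^esub> = \<zero>\<^bsub>tensor M N\<^esub>"
  using lin_zero[OF lin_tens_left[OF assms] assms(1) vspace_tensor[OF assms]]
    lin_zero[OF lin_tens_right[OF assms] assms(2) vspace_tensor[OF assms]] by auto

context tensor_setting
begin

abbreviation "T \<equiv> direct_sum E W"
abbreviation "\<Gamma> \<equiv> field_vs :: ('k, 'k) module"
abbreviation "X \<equiv> tensor4 T \<Gamma> T \<Gamma>"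
abbreviation "t4 \<equiv> tens4 T \<Gamma> T \<Gamma>"
abbreviation "Q \<equiv> direct_sum EE BB"

lemma fdT: "fdvs T" and fdX: "fdvs X" and fdQ: "fdvs Q"
  by (intro fdvs_direct_sum(1) fdvs_tensor(1) fdvs_field_vs fdE fdW)+

text \<open>The origin of the constant in the defect formula: the three summands have dimensions
  r^2, rs and rs.\<close>

lemma vdim_Q: "vdim Q = vdim E ^ 2 + 2 * vdim E * vdim W"
  by (simp add: fdvs_direct_sum(2) fdvs_tensor(2) fdE fdW fd_tensors power2_eq_square)

lemma vT: "vspace T" and vX: "vspace X" and vQ: "vspace Q"
  using fdT fdX fdQ by auto

lemmas v\<Gamma> = vspace_field_vs
lemmas t4_lin = lin_tens4[OF vT v\<Gamma> vT v\<Gamma>]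
lemmas X_lin_eq = tensor4_lin_eq[OF vT v\<Gamma> vT v\<Gamma>]

lemma t4_closed: "a \<in> carrier T \<Longrightarrow> b \<in> carrier T \<Longrightarrow> t4 a n b m \<in> carrier X"
  by (rule t4_lin(5)) auto

text \<open>Because \<open>\<Gamma>\<close> is the ground field, both scalar slots can be pulled
  out. This is the identification of \<open>T \<otimes> k \<otimes> T \<otimes> k\<close> with
  \<open>T \<otimes> T\<close> at the level of pure tensors.\<close>

lemma t4_scale:
  assumes "a \<in> carrier T" "b \<in> carrier T"
  shows "t4 a n b m = (n * m) \<odot>\<^bsub>X\<^esub> t4 a 1 b 1"
proof -
  have "t4 a (n \<odot>\<^bsub>\<Gamma>\<^esub> 1) b m = n \<odot>\<^bsub>X\<^esub> t4 a 1 b m"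
    by (rule lin_smult[OF t4_lin(2)]) (use assms in auto)
  moreover have "t4 a 1 b (m \<odot>\<^bsub>\<Gamma>\<^esub> 1) = m \<odot>\<^bsub>X\<^esub> t4 a 1 b 1"
    by (rule lin_smult[OF t4_lin(4)]) (use assms in auto)
  ultimately show ?thesis using assms by (simp add: vs_smult_smult vX t4_closed)
qed

lemma t4_add_left:
  assumes "a \<in> carrier T" "a' \<in> carrier T" "b \<in> carrier T"
  shows "t4 (a \<oplus>\<^bsub>T\<^esub> a') n b m = t4 a n b m \<oplus>\<^bsub>X\<^esub> t4 a' n b m"
  using lin_add[OF t4_lin(1), of n b m a a'] assms by simp

lemma t4_add_right:
  assumes "a \<in> carrier T" "b \<in> carrier T" "b' \<in> carrier T"
  shows "t4 a n (b \<oplus>\<^bsub>T\<^esub> b') m = t4 a n b m \<oplus>\<^bsub>X\<^esub> t4 a n b' m"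
  using lin_add[OF t4_lin(3), of a n m b b'] assms by simp

lemma t4_zero:
  assumes "a \<in> carrier T"
  shows "t4 a n \<zero>\<^bsub>T\<^esub> m = \<zero>\<^bsub>X\<^esub>"
  using lin_zero[OF t4_lin(3)[of a n m] vT vX] assms by simp

text \<open>The universal property of the same identification: a bilinear map on \<open>T\<close>
  extends with the two scalars multiplied out.\<close>

lemma op_lift:
  fixes P :: "('k, 'p) module"
  assumes f: "bilin T T P f" and P: "vspace P"
  obtains g where "g \<in> lin X P"
    "\<And>a n b m. a \<in> carrier T \<Longrightarrow> b \<in> carrier T \<Longrightarrow> g (t4 a n b m) = (n * m) \<odot>\<^bsub>P\<^esub> f a b"
proof (rule tensor4_lift[OF vT v\<Gamma> vT v\<Gamma> P, of "\<lambda>a n b m. (n * m) \<odot>\<^bsub>P\<^esub> f a b"])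
  have f1: "(\<lambda>a. f a b) \<in> lin T P" if "b \<in> carrier T" for b using f that unfolding bilin_def by blast
  have f2: "f a \<in> lin T P" if "a \<in> carrier T" for a using f that unfolding bilin_def by blast
  have fc: "f a b \<in> carrier P" if "a \<in> carrier T" "b \<in> carrier T" for a b
    using lin_closed[OF f2] that by blast
  show "(\<lambda>a. (n * m) \<odot>\<^bsub>P\<^esub> f a b) \<in> lin T P" if "b \<in> carrier T" for n b m
    by (rule lin_scale[OF f1[OF that] P])
  show "(\<lambda>b. (n * m) \<odot>\<^bsub>P\<^esub> f a b) \<in> lin T P" if "a \<in> carrier T" for a n m
    by (rule lin_scale[OF f2[OF that] P])
  show "(\<lambda>n. (n * m) \<odot>\<^bsub>P\<^esub> f a b) \<in> lin \<Gamma> P" if "a \<in> carrier T" "b \<in> carrier T" for a b m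
    by (rule lin_scalar[OF P fc[OF that]])
  show "(\<lambda>m. (n * m) \<odot>\<^bsub>P\<^esub> f a b) \<in> lin \<Gamma> P" if "a \<in> carrier T" "b \<in> carrier T" for a b n
    using lin_scalar[OF P fc[OF that], of n] by (simp add: mult.commute)
qed (use that in auto)

text \<open>The decomposition of \<open>T \<otimes> T\<close> into four summands, with \<open>W \<otimes> W\<close> dropped.\<close>

definition Phi where
  "Phi = (SOME g. g \<in> lin X Q \<and> (\<forall>a\<in>carrier T. \<forall>n. \<forall>b\<in>carrier T. \<forall>m. g (t4 a n b m) =
     (n * m) \<odot>\<^bsub>Q\<^esub> (tens E E (fst a) (fst b), (tens W E (snd a) (fst b), tens E W (fst a) (snd b)))))"

lemma Phi: "Phi \<in> lin X Q"
  "a \<in> carrier T \<Longrightarrow> b \<in> carrier T \<Longrightarrow> Phi (t4 a n b m) =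
     (n * m) \<odot>\<^bsub>Q\<^esub> (tens E E (fst a) (fst b), (tens W E (snd a) (fst b), tens E W (fst a) (snd b)))"
proof -
  let ?f = "\<lambda>a b. (tens E E (fst a) (fst b), (tens W E (snd a) (fst b), tens E W (fst a) (snd b)))"
  let ?P = "\<lambda>g. g \<in> lin X Q \<and> (\<forall>a\<in>carrier T. \<forall>n. \<forall>b\<in>carrier T. \<forall>m. g (t4 a n b m) = (n * m) \<odot>\<^bsub>Q\<^esub> ?f a b)"
  have "bilin T T Q ?f"
    unfolding bilin_def
  proof (intro conjI ballI lin_Pair)
    fix b assume b: "b \<in> carrier T"
    then have "fst b \<in> carrier E" "snd b \<in> carrier W" by auto
    then show "(\<lambda>a. tens E E (fst a) (fst b)) \<in> lin T EE" "(\<lambda>a. tens W E (snd a) (fst b)) \<in> lin T WE"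
      "(\<lambda>a. tens E W (fst a) (snd b)) \<in> lin T EW"
      by (auto intro!: lin_comp[OF lin_fst lin_tens_left] lin_comp[OF lin_snd lin_tens_left] vE vW)
  next
    fix a assume a: "a \<in> carrier T"
    then have "fst a \<in> carrier E" "snd a \<in> carrier W" by auto
    then show "(\<lambda>b. tens E E (fst a) (fst b)) \<in> lin T EE" "(\<lambda>b. tens W E (snd a) (fst b)) \<in> lin T WE"
      "(\<lambda>b. tens E W (fst a) (snd b)) \<in> lin T EW"
      by (auto intro!: lin_comp[OF lin_fst lin_tens_right] lin_comp[OF lin_snd lin_tens_right] vE vW)
  qed
  then have "\<exists>g. ?P g" by (rule op_lift[OF _ vQ]) blast
  then have "?P Phi" unfolding Phi_def by (rule someI_ex)
  then show "Phi \<in> lin X Q"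
    "a \<in> carrier T \<Longrightarrow> b \<in> carrier T \<Longrightarrow> Phi (t4 a n b m) = (n * m) \<odot>\<^bsub>Q\<^esub> ?f a b"
    by auto
qed

text \<open>Each summand of \<open>Q\<close> is embedded back through the inclusions of
  \<open>E\<close> and \<open>W\<close> into \<open>T\<close>. The displayed value at a pure tensor
  lacks only the term in \<open>W \<otimes> W\<close>, so it measures what \<open>Phi\<close>
  forgets.\<close>

lemma Phi_section:
  obtains \<sigma> where "\<sigma> \<in> lin Q X" "\<And>q. q \<in> carrier Q \<Longrightarrow> Phi (\<sigma> q) = q"
    "\<And>a b. a \<in> carrier T \<Longrightarrow> b \<in> carrier T \<Longrightarrow>
      \<sigma> (Phi (t4 a 1 b 1)) = t4 (fst a, \<zero>\<^bsub>W\<^esub>) 1 (fst b, \<zero>\<^bsub>W\<^esub>) 1 \<oplus>\<^bsub>X\<^esub>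
        (t4 (\<zero>\<^bsub>E\<^esub>, snd a) 1 (fst b, \<zero>\<^bsub>W\<^esub>) 1 \<oplus>\<^bsub>X\<^esub> t4 (fst a, \<zero>\<^bsub>W\<^esub>) 1 (\<zero>\<^bsub>E\<^esub>, snd b) 1)"
proof -
  have i1: "(\<lambda>x. (x, \<zero>\<^bsub>W\<^esub>)) \<in> lin E T" and i2: "(\<lambda>y. (\<zero>\<^bsub>E\<^esub>, y)) \<in> lin W T"
    by (intro lin_Pair lin_id lin_const_zero vE vW)+
  have bil: "bilin M N X (\<lambda>x y. t4 (i x) 1 (j y) 1)"
    if "i \<in> lin M T" "j \<in> lin N T" for M :: "('k, 'm) module" and N :: "('k, 'n) module" and i j
    unfolding bilin_def
  proof (intro conjI ballI)
    show "(\<lambda>x. t4 (i x) 1 (j y) 1) \<in> lin M X" if "y \<in> carrier N" for y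
      by (rule lin_comp[OF \<open>i \<in> lin M T\<close> t4_lin(1)]) (simp_all only: lin_closed[OF \<open>j \<in> lin N T\<close> that] field_vs_simps UNIV_I)
    show "(\<lambda>y. t4 (i x) 1 (j y) 1) \<in> lin N X" if "x \<in> carrier M" for x
      by (rule lin_comp[OF \<open>j \<in> lin N T\<close> t4_lin(3)]) (simp_all only: lin_closed[OF \<open>i \<in> lin M T\<close> that] field_vs_simps UNIV_I)
  qed
  obtain s1 where s1: "s1 \<in> lin EE X"
    "\<And>x y. x \<in> carrier E \<Longrightarrow> y \<in> carrier E \<Longrightarrow> s1 (tens E E x y) = t4 (x, \<zero>\<^bsub>W\<^esub>) 1 (y, \<zero>\<^bsub>W\<^esub>) 1"
    by (rule tensor_lift[OF vE vE bil[OF i1 i1] vX]) blast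
  obtain s2 where s2: "s2 \<in> lin WE X"
    "\<And>x y. x \<in> carrier W \<Longrightarrow> y \<in> carrier E \<Longrightarrow> s2 (tens W E x y) = t4 (\<zero>\<^bsub>E\<^esub>, x) 1 (y, \<zero>\<^bsub>W\<^esub>) 1"
    by (rule tensor_lift[OF vW vE bil[OF i2 i1] vX]) blast
  obtain s3 where s3: "s3 \<in> lin EW X"
    "\<And>x y. x \<in> carrier E \<Longrightarrow> y \<in> carrier W \<Longrightarrow> s3 (tens E W x y) = t4 (x, \<zero>\<^bsub>W\<^esub>) 1 (\<zero>\<^bsub>E\<^esub>, y) 1"
    by (rule tensor_lift[OF vE vW bil[OF i1 i2] vX]) blast
  let ?s = "\<lambda>q. s1 (fst q) \<oplus>\<^bsub>X\<^esub> (s2 (fst (snd q)) \<oplus>\<^bsub>X\<^esub> s3 (snd (snd q)))"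
  have lin: "?s \<in> lin Q X"
    by (intro lin_plus vX lin_comp[OF lin_fst s1(1)] lin_comp[OF lin_comp[OF lin_snd lin_fst] s2(1)]
        lin_comp[OF lin_comp[OF lin_snd lin_snd] s3(1)])
  have z: "(\<zero>\<^bsub>EE\<^esub>, (\<zero>\<^bsub>WE\<^esub>, \<zero>\<^bsub>EW\<^esub>)) = \<zero>\<^bsub>Q\<^esub>" by simp
  have P1: "Phi (s1 u) = (u, (\<zero>\<^bsub>WE\<^esub>, \<zero>\<^bsub>EW\<^esub>))" if "u \<in> carrier EE" for u
    by (rule tensor_lin_eq[OF vE vE lin_comp[OF s1(1) Phi(1)] _ that])
      (auto intro!: lin_Pair lin_id lin_const_zero v_tensors simp: s1(2) Phi(2) vE vW tens_zero v_tensors tens_closed)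
  have P2: "Phi (s2 u) = (\<zero>\<^bsub>EE\<^esub>, (u, \<zero>\<^bsub>EW\<^esub>))" if "u \<in> carrier WE" for u
    by (rule tensor_lin_eq[OF vW vE lin_comp[OF s2(1) Phi(1)] _ that])
      (auto intro!: lin_Pair lin_id lin_const_zero v_tensors simp: s2(2) Phi(2) vE vW tens_zero v_tensors tens_closed)
  have P3: "Phi (s3 u) = (\<zero>\<^bsub>EE\<^esub>, (\<zero>\<^bsub>WE\<^esub>, u))" if "u \<in> carrier EW" for u
    by (rule tensor_lin_eq[OF vE vW lin_comp[OF s3(1) Phi(1)] _ that])
      (auto intro!: lin_Pair lin_id lin_const_zero v_tensors simp: s3(2) Phi(2) vE vW tens_zero v_tensors tens_closed)
  have "Phi (?s q) = q" if "q \<in> carrier Q" for q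
  proof -
    have q: "fst q \<in> carrier EE" "fst (snd q) \<in> carrier WE" "snd (snd q) \<in> carrier EW"
      using that by auto
    have "Phi (?s q) = Phi (s1 (fst q)) \<oplus>\<^bsub>Q\<^esub> (Phi (s2 (fst (snd q))) \<oplus>\<^bsub>Q\<^esub> Phi (s3 (snd (snd q))))"
      using q by (simp only: lin_add[OF Phi(1)] lin_closed[OF s1(1)] lin_closed[OF s2(1)] lin_closed[OF s3(1)] vs_add_closed[OF vX])
    also have "\<dots> = q" using q by (simp add: P1 P2 P3 v_tensors)
    finally show ?thesis .
  qed
  moreover have "?s (Phi (t4 a 1 b 1)) = t4 (fst a, \<zero>\<^bsub>W\<^esub>) 1 (fst b, \<zero>\<^bsub>W\<^esub>) 1 \<oplus>\<^bsub>X\<^esub>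
        (t4 (\<zero>\<^bsub>E\<^esub>, snd a) 1 (fst b, \<zero>\<^bsub>W\<^esub>) 1 \<oplus>\<^bsub>X\<^esub> t4 (fst a, \<zero>\<^bsub>W\<^esub>) 1 (\<zero>\<^bsub>E\<^esub>, snd b) 1)"
    if "a \<in> carrier T" "b \<in> carrier T" for a b
  proof -
    have "fst a \<in> carrier E" "snd a \<in> carrier W" "fst b \<in> carrier E" "snd b \<in> carrier W" using that by auto
    then show ?thesis using that by (simp add: Phi(2) s1(2) s2(2) s3(2) v_tensors tens_closed vE vW)
  qed
  ultimately show ?thesis using that[OF lin] by blast
qed

lemma Phi_surj: "Phi ` carrier X = carrier Q"
proof (rule Phi_section)
  fix \<sigma> assume \<sigma>: "\<sigma> \<in> lin Q X" "\<And>q. q \<in> carrier Q \<Longrightarrow> Phi (\<sigma> q) = q"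
  show ?thesis
  proof (intro equalityI subsetI)
    show "q \<in> carrier Q" if "q \<in> Phi ` carrier X" for q
      using that lin_closed[OF Phi(1)] by blast
    show "q \<in> Phi ` carrier X" if "q \<in> carrier Q" for q
      using \<sigma>(2)[OF that] lin_closed[OF \<sigma>(1) that] by (metis image_eqI)
  qed
qed

end

section \<open>The ternary product attached to a surjective tensor\<close>

locale surjective_tensor = tensor_setting E W
  for E :: "('k::field, 'e) module" and W :: "('k, 'w) module" +
  fixes \<mu>
  assumes surj: "\<mu> \<in> surj_tensor_maps E W"
begin

abbreviation (input) "p \<equiv> T_prod E W \<mu>"
abbreviation (input) "X' \<equiv> op_tensor_rng T \<Gamma> p"

lemmas mu = surj_tensor_mapsD[OF surj]

lemma p_lin:
  assumes "a \<in> carrier T" "b \<in> carrier T" "c \<in> carrier T"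
  shows "(\<lambda>a. p a n b m c) \<in> lin T T" "(\<lambda>n. p a n b m c) \<in> lin \<Gamma> T" "(\<lambda>b. p a n b m c) \<in> lin T T"
    "(\<lambda>m. p a n b m c) \<in> lin \<Gamma> T" "(\<lambda>c. p a n b m c) \<in> lin T T"
proof -
  have f: "fst a \<in> carrier E" "fst b \<in> carrier E" "fst c \<in> carrier E" using assms by auto
  have l: "(\<lambda>a. (n * m) \<odot>\<^bsub>W\<^esub> \<mu> (t3 (fst a) (fst b) (fst c))) \<in> lin T W"
    "(\<lambda>b. (n * m) \<odot>\<^bsub>W\<^esub> \<mu> (t3 (fst a) (fst b) (fst c))) \<in> lin T W"
    "(\<lambda>c. (n * m) \<odot>\<^bsub>W\<^esub> \<mu> (t3 (fst a) (fst b) (fst c))) \<in> lin T W"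
    using f by (auto intro!: lin_scale vW lin_comp[OF lin_fst mu_lin(1)[OF mu]]
        lin_comp[OF lin_fst mu_lin(2)[OF mu]] lin_comp[OF lin_fst mu_lin(3)[OF mu]])
  show "(\<lambda>a. p a n b m c) \<in> lin T T" "(\<lambda>b. p a n b m c) \<in> lin T T" "(\<lambda>c. p a n b m c) \<in> lin T T"
    unfolding T_prod_def by (intro lin_Pair lin_const_zero vE l)+
  have s: "(\<lambda>n. (n * m) \<odot>\<^bsub>W\<^esub> \<mu> (t3 (fst a) (fst b) (fst c))) \<in> lin \<Gamma> W"
    "(\<lambda>m. (m * n) \<odot>\<^bsub>W\<^esub> \<mu> (t3 (fst a) (fst b) (fst c))) \<in> lin \<Gamma> W"
    by (intro lin_scalar vW mu_closed[OF mu] f)+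
  then show "(\<lambda>n. p a n b m c) \<in> lin \<Gamma> T" "(\<lambda>m. p a n b m c) \<in> lin \<Gamma> T"
    unfolding T_prod_def by (auto intro!: lin_Pair lin_const_zero vE simp: mult.commute[of n])
qed

lemma p_closed: "a \<in> carrier T \<Longrightarrow> b \<in> carrier T \<Longrightarrow> c \<in> carrier T \<Longrightarrow> p a n b m c \<in> carrier T"
  by (auto simp: T_prod_def vE vW mu_closed[OF mu])

section \<open>The multiplication of the operator rng\<close>

text \<open>The eight-fold multilinear formula is lifted in two stages. For fixed left arguments the
  right four are lifted to an endomorphism \<open>R\<close> of \<open>X\<close>; these endomorphisms
  depend linearly on each left argument and are lifted again, into
  \<open>hom_vs X X\<close>.\<close>

lemma op_mult:
  shows "op_mult T \<Gamma> p \<in> carrier (hom_vs X (hom_vs X X))"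
    "a \<in> carrier T \<Longrightarrow> b \<in> carrier T \<Longrightarrow> c \<in> carrier T \<Longrightarrow> d \<in> carrier T \<Longrightarrow>
      op_mult T \<Gamma> p (t4 a \<alpha> b \<beta>) (t4 c \<gamma> d \<delta>) = t4 (p a \<alpha> b \<beta> c) \<gamma> d \<delta>"
proof -
  note vH = vspace_hom_vs[OF vX vX]
  let ?P = "\<lambda>m. m \<in> carrier (hom_vs X (hom_vs X X)) \<and>
    (\<forall>a\<in>carrier T. \<forall>\<alpha>\<in>carrier \<Gamma>. \<forall>b\<in>carrier T. \<forall>\<beta>\<in>carrier \<Gamma>.
     \<forall>c\<in>carrier T. \<forall>\<gamma>\<in>carrier \<Gamma>. \<forall>d\<in>carrier T. \<forall>\<delta>\<in>carrier \<Gamma>.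
       m (t4 a \<alpha> b \<beta>) (t4 c \<gamma> d \<delta>) = t4 (p a \<alpha> b \<beta> c) \<gamma> d \<delta>)"
  have exR: "\<exists>R. R \<in> carrier (hom_vs X X) \<and>
      (\<forall>c\<in>carrier T. \<forall>\<gamma>. \<forall>d\<in>carrier T. \<forall>\<delta>. R (t4 c \<gamma> d \<delta>) = t4 (p a \<alpha> b \<beta> c) \<gamma> d \<delta>)"
    if ab: "a \<in> carrier T" "b \<in> carrier T" for a \<alpha> b \<beta>
  proof -
    obtain R where R: "R \<in> lin X X"
      "\<And>c \<gamma> d \<delta>. c \<in> carrier T \<Longrightarrow> \<gamma> \<in> carrier \<Gamma> \<Longrightarrow> d \<in> carrier T \<Longrightarrow> \<delta> \<in> carrier \<Gamma> \<Longrightarrow>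
        R (t4 c \<gamma> d \<delta>) = t4 (p a \<alpha> b \<beta> c) \<gamma> d \<delta>"
    proof (rule tensor4_lift[OF vT v\<Gamma> vT v\<Gamma> vX, of "\<lambda>c \<gamma> d \<delta>. t4 (p a \<alpha> b \<beta> c) \<gamma> d \<delta>"])
      show "(\<lambda>c. t4 (p a \<alpha> b \<beta> c) \<gamma> d \<delta>) \<in> lin T X" if "d \<in> carrier T" for \<gamma> d \<delta>
        by (rule lin_comp[OF p_lin(5)[OF ab vs_zero_closed[OF vT]] t4_lin(1)]) (use that in auto)
      show "(\<lambda>\<gamma>. t4 (p a \<alpha> b \<beta> c) \<gamma> d \<delta>) \<in> lin \<Gamma> X" if "c \<in> carrier T" "d \<in> carrier T" for c d \<delta>
        using ab that by (intro t4_lin(2) p_closed) auto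
      show "(\<lambda>d. t4 (p a \<alpha> b \<beta> c) \<gamma> d \<delta>) \<in> lin T X" if "c \<in> carrier T" for c \<gamma> \<delta>
        using ab that by (intro t4_lin(3) p_closed) auto
      show "(\<lambda>\<delta>. t4 (p a \<alpha> b \<beta> c) \<gamma> d \<delta>) \<in> lin \<Gamma> X" if "c \<in> carrier T" "d \<in> carrier T" for c \<gamma> d
        using ab that by (intro t4_lin(4) p_closed) auto
    qed blast
    then show ?thesis
      using restrict_hom_vs[OF vX R(1)] by (intro exI[of _ "restrict R (carrier X)"]) (simp add: t4_closed)
  qed
  define R where "R a \<alpha> b \<beta> = (SOME R. R \<in> carrier (hom_vs X X) \<and>
      (\<forall>c\<in>carrier T. \<forall>\<gamma>. \<forall>d\<in>carrier T. \<forall>\<delta>. R (t4 c \<gamma> d \<delta>) = t4 (p a \<alpha> b \<beta> c) \<gamma> d \<delta>))"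
    for a \<alpha> b \<beta>
  have R: "R a \<alpha> b \<beta> \<in> carrier (hom_vs X X)"
    "\<And>c \<gamma> d \<delta>. c \<in> carrier T \<Longrightarrow> d \<in> carrier T \<Longrightarrow>
      R a \<alpha> b \<beta> (t4 c \<gamma> d \<delta>) = t4 (p a \<alpha> b \<beta> c) \<gamma> d \<delta>"
    if "a \<in> carrier T" "b \<in> carrier T" for a \<alpha> b \<beta>
    using someI_ex[OF exR[OF that, of \<alpha> \<beta>], folded R_def] by blast+
  \<comment> \<open>One argument for all four slots: \<open>v\<close> is the varying left argument
    and \<open>q v c\<close> the ternary product containing it, with the remaining entries
    fixed.\<close>
  have param: "S \<in> lin V (hom_vs X X)"
    if "vspace V" and S: "\<And>v. v \<in> carrier V \<Longrightarrow> S v \<in> carrier (hom_vs X X)"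
      "\<And>v c \<gamma> d \<delta>. v \<in> carrier V \<Longrightarrow> c \<in> carrier T \<Longrightarrow> d \<in> carrier T \<Longrightarrow> S v (t4 c \<gamma> d \<delta>) = t4 (q v c) \<gamma> d \<delta>"
      and q: "\<And>c. c \<in> carrier T \<Longrightarrow> (\<lambda>v. q v c) \<in> lin V T" for V :: "('k, 'v) module" and S q
  proof (rule lin_into_hom_vs[OF S(1) _ that(1) vX vX])
    fix x assume x: "x \<in> carrier X"
    show "(\<lambda>v. S v x) \<in> lin V X"
    proof (rule lin_tensor4_param[OF vT v\<Gamma> vT v\<Gamma> vX that(1) hom_vs_lin[OF S(1)] _ x])
      fix c \<gamma> d \<delta> assume *: "c \<in> carrier T" "d \<in> carrier T"
      show "(\<lambda>v. S v (t4 c \<gamma> d \<delta>)) \<in> lin V X"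
        by (rule lin_cong[OF lin_comp[OF q t4_lin(1)] that(1)]) (use * S(2) in auto)
    qed
  qed
  obtain m where m: "m \<in> lin X (hom_vs X X)"
    "\<And>a \<alpha> b \<beta>. a \<in> carrier T \<Longrightarrow> \<alpha> \<in> carrier \<Gamma> \<Longrightarrow> b \<in> carrier T \<Longrightarrow> \<beta> \<in> carrier \<Gamma> \<Longrightarrow>
      m (t4 a \<alpha> b \<beta>) = R a \<alpha> b \<beta>"
  proof (rule tensor4_lift[OF vT v\<Gamma> vT v\<Gamma> vH, of R])
    show "(\<lambda>a. R a \<alpha> b \<beta>) \<in> lin T (hom_vs X X)" if "b \<in> carrier T" for \<alpha> b \<beta>
      by (rule param[OF vT R(1) R(2) p_lin(1)]) (use that in auto)
    show "(\<lambda>\<alpha>. R a \<alpha> b \<beta>) \<in> lin \<Gamma> (hom_vs X X)" if "a \<in> carrier T" "b \<in> carrier T" for a b \<beta>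
      by (rule param[OF v\<Gamma> R(1) R(2) p_lin(2)]) (use that in auto)
    show "(\<lambda>b. R a \<alpha> b \<beta>) \<in> lin T (hom_vs X X)" if "a \<in> carrier T" for a \<alpha> \<beta>
      by (rule param[OF vT R(1) R(2) p_lin(3)]) (use that in auto)
    show "(\<lambda>\<beta>. R a \<alpha> b \<beta>) \<in> lin \<Gamma> (hom_vs X X)" if "a \<in> carrier T" "b \<in> carrier T" for a \<alpha> b
      by (rule param[OF v\<Gamma> R(1) R(2) p_lin(4)]) (use that in auto)
  qed blast
  have ex: "?P (restrict m (carrier X))"
    using restrict_hom_vs[OF vX m(1)] m(2) R(2) by (simp add: t4_closed)
  have uniq: "m = m'" if "?P m" "?P m'" for m m'
  proof (rule hom_vs_eqI)
    show m1: "m \<in> carrier (hom_vs X (hom_vs X X))" and m2: "m' \<in> carrier (hom_vs X (hom_vs X X))"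
      using that by auto
    fix x assume x: "x \<in> carrier X"
    show "m x = m' x"
    proof (rule X_lin_eq[OF hom_vs_lin[OF m1] hom_vs_lin[OF m2] _ x])
      fix a \<alpha> b \<beta> assume ab: "a \<in> carrier T" "b \<in> carrier T"
      note c1 = hom_vs_closed[OF m1 t4_closed[OF ab]] and c2 = hom_vs_closed[OF m2 t4_closed[OF ab]]
      show "m (t4 a \<alpha> b \<beta>) = m' (t4 a \<alpha> b \<beta>)"
      proof (rule hom_vs_eqI[OF c1 c2])
        show "m (t4 a \<alpha> b \<beta>) y = m' (t4 a \<alpha> b \<beta>) y" if "y \<in> carrier X" for y
          by (rule X_lin_eq[OF hom_vs_lin[OF c1] hom_vs_lin[OF c2] _ that])
            (use \<open>?P m\<close> \<open>?P m'\<close> ab in \<open>simp del: direct_sum_simps(1)\<close>)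
      qed
    qed
  qed
  have "\<exists>!m. ?P m" by (rule ex1I[of ?P, OF ex]) (rule uniq[OF _ ex])
  from theI'[OF this] have "?P (op_mult T \<Gamma> p)" unfolding op_mult_def .
  then show "op_mult T \<Gamma> p \<in> carrier (hom_vs X (hom_vs X X))"
    "a \<in> carrier T \<Longrightarrow> b \<in> carrier T \<Longrightarrow> c \<in> carrier T \<Longrightarrow> d \<in> carrier T \<Longrightarrow>
      op_mult T \<Gamma> p (t4 a \<alpha> b \<beta>) (t4 c \<gamma> d \<delta>) = t4 (p a \<alpha> b \<beta> c) \<gamma> d \<delta>"
    by auto
qed

abbreviation (input) "mul \<equiv> op_mult T \<Gamma> p"

lemma mul_lin:
  shows "y \<in> carrier X \<Longrightarrow> (\<lambda>x. mul x y) \<in> lin X X" "x \<in> carrier X \<Longrightarrow> mul x \<in> lin X X"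
    "x \<in> carrier X \<Longrightarrow> y \<in> carrier X \<Longrightarrow> mul x y \<in> carrier X"
  using lin_comp[OF hom_vs_lin[OF op_mult(1)] lin_hom_vs_apply[of y X X]]
    hom_vs_lin[OF hom_vs_closed[OF op_mult(1)]] lin_closed[of "mul x" X X y] by auto

lemma Phi_W_left:
  assumes "w \<in> carrier W" "d \<in> carrier T"
  shows "Phi (t4 (\<zero>\<^bsub>E\<^esub>, w) \<gamma> d \<delta>) = (\<zero>\<^bsub>EE\<^esub>, ((\<gamma> * \<delta>) \<odot>\<^bsub>WE\<^esub> tens W E w (fst d), \<zero>\<^bsub>EW\<^esub>))"
proof -
  have "fst d \<in> carrier E" "snd d \<in> carrier W" using assms by auto
  then show ?thesis using assms by (simp add: Phi(2) vE vW tens_zero v_tensors)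
qed

lemma Phi_W_right:
  assumes "w \<in> carrier W" "a \<in> carrier T"
  shows "Phi (t4 a \<gamma> (\<zero>\<^bsub>E\<^esub>, w) \<delta>) = (\<zero>\<^bsub>EE\<^esub>, (\<zero>\<^bsub>WE\<^esub>, (\<gamma> * \<delta>) \<odot>\<^bsub>EW\<^esub> tens E W (fst a) w))"
proof -
  have "fst a \<in> carrier E" "snd a \<in> carrier W" using assms by auto
  then show ?thesis using assms by (simp add: Phi(2) vE vW tens_zero v_tensors)
qed

text \<open>Up to the scalars of \<open>y\<close>, \<open>Phi\<close> sends the product of
  \<open>t\<close> with \<open>c \<otimes> d\<close> to \<open>\<Theta>(u)(c) \<otimes> d\<close> in
  \<open>W \<otimes> E\<close>, where \<open>u\<close> is the \<open>E \<otimes> E\<close> component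
  of \<open>Phi t\<close>. Thus the product sees only \<open>u\<close>, and it vanishes with
  \<open>u\<close>.\<close>

lemma Phi_mult_right:
  assumes t: "t \<in> carrier X" "fst (Phi t) = \<zero>\<^bsub>EE\<^esub>" and y: "y \<in> carrier X"
  shows "Phi (mul t y) = \<zero>\<^bsub>Q\<^esub>"
  using vT v\<Gamma> vT v\<Gamma> y
proof (induction rule: tensor4_induct)
  case (tens c \<gamma> d \<delta>)
  have cd: "fst c \<in> carrier E" "fst d \<in> carrier E" using tens by auto
  let ?g = "\<lambda>t. (\<zero>\<^bsub>EE\<^esub>, ((\<gamma> * \<delta>) \<odot>\<^bsub>WE\<^esub> tens W E (Theta E W \<mu> (fst (Phi t)) (fst c)) (fst d), \<zero>\<^bsub>EW\<^esub>))"
  have "Phi (mul t (t4 c \<gamma> d \<delta>)) = ?g t"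
  proof (rule X_lin_eq[OF lin_comp[OF mul_lin(1) Phi(1)] _ _ t(1)])
    show "t4 c \<gamma> d \<delta> \<in> carrier X" using tens by (intro t4_closed)
    have "(\<lambda>t. Theta E W \<mu> (fst (Phi t)) (fst c)) \<in> lin X W"
      by (rule lin_comp[OF lin_comp[OF lin_comp[OF Phi(1) lin_fst] Theta_lin[OF mu]] lin_hom_vs_apply[OF cd(1)]])
    then show "?g \<in> lin X Q"
      by (intro lin_Pair lin_const_zero v_tensors lin_scale lin_comp[OF _ lin_tens_left[OF vW vE cd(2)]])
    fix a \<alpha> b \<beta> assume ab: "a \<in> carrier T" "b \<in> carrier T"
    then have fab: "fst a \<in> carrier E" "fst b \<in> carrier E" by auto
    have w: "(\<alpha> * \<beta>) \<odot>\<^bsub>W\<^esub> \<mu> (t3 (fst a) (fst b) (fst c)) \<in> carrier W"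
      using fab cd by (simp add: vW mu_closed[OF mu])
    have "Theta E W \<mu> (fst (Phi (t4 a \<alpha> b \<beta>))) (fst c) = (\<alpha> * \<beta>) \<odot>\<^bsub>W\<^esub> \<mu> (t3 (fst a) (fst b) (fst c))"
      using ab fab cd by (simp add: Phi(2) lin_smult[OF Theta_lin[OF mu]] tens_closed vE hom_vs_simps(4) Theta(2)[OF mu])
    then show "Phi (mul (t4 a \<alpha> b \<beta>) (t4 c \<gamma> d \<delta>)) = ?g (t4 a \<alpha> b \<beta>)"
      using ab tens by (simp only: op_mult(2) T_prod_def Phi_W_left[OF w])
  qed
  also have "\<dots> = \<zero>\<^bsub>Q\<^esub>"
  proof -
    have "Theta E W \<mu> \<zero>\<^bsub>EE\<^esub> (fst c) = \<zero>\<^bsub>W\<^esub>"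
      using lin_zero[OF Theta_lin[OF mu] v_tensors(1) v_tensors(7)] cd by (simp add: hom_vs_simps(2))
    then show ?thesis using cd t(2) by (simp add: tens_zero vW vE v_tensors)
  qed
  finally show ?case .
next
  case (add y y')
  have "mul t (y \<oplus>\<^bsub>X\<^esub> y') = mul t y \<oplus>\<^bsub>X\<^esub> mul t y'"
    by (rule lin_add[OF mul_lin(2)[OF t(1)] add(1,2)])
  then have "Phi (mul t (y \<oplus>\<^bsub>X\<^esub> y')) = Phi (mul t y) \<oplus>\<^bsub>Q\<^esub> Phi (mul t y')"
    using lin_add[OF Phi(1) mul_lin(3)[OF t(1) add(1)] mul_lin(3)[OF t(1) add(2)]] by simp
  then show ?case unfolding add(3,4) using vs_add_zero(1)[OF vQ vs_zero_closed[OF vQ]] by simp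
qed

text \<open>Left multiplication by a pure tensor acts on the \<open>E \<otimes> E\<close> component
  by \<open>\<mu>(a,b,-) \<otimes> id\<close>, up to the scalars, and ignores the other components,
  since \<open>\<mu>\<close> reads only the \<open>E\<close> part of its last argument.\<close>

lemma Phi_mult_left:
  assumes t: "t \<in> carrier X" "fst (Phi t) = \<zero>\<^bsub>EE\<^esub>" and y: "y \<in> carrier X"
  shows "Phi (mul y t) = \<zero>\<^bsub>Q\<^esub>"
  using vT v\<Gamma> vT v\<Gamma> y
proof (induction rule: tensor4_induct)
  case (tens a \<alpha> b \<beta>)
  have ab: "fst a \<in> carrier E" "fst b \<in> carrier E" using tens by auto
  have "(\<lambda>c. (\<alpha> * \<beta>) \<odot>\<^bsub>W\<^esub> \<mu> (t3 (fst a) (fst b) c)) \<in> lin E W"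
    by (intro lin_scale vW mu_lin(3)[OF mu] ab)
  then obtain M where M: "M \<in> lin EE WE" "\<And>c d. c \<in> carrier E \<Longrightarrow> d \<in> carrier E \<Longrightarrow>
      M (tens E E c d) = tens W E ((\<alpha> * \<beta>) \<odot>\<^bsub>W\<^esub> \<mu> (t3 (fst a) (fst b) c)) d"
    \<comment> \<open>\<open>M\<close> is this induced map from \<open>E \<otimes> E\<close> to
      \<open>W \<otimes> E\<close>.\<close>
    using tensor_map[OF _ lin_id vE vE vW vE] by blast
  let ?g = "\<lambda>t. (\<zero>\<^bsub>EE\<^esub>, (M (fst (Phi t)), \<zero>\<^bsub>EW\<^esub>))"
  have "Phi (mul (t4 a \<alpha> b \<beta>) t) = ?g t"
  proof (rule X_lin_eq[OF lin_comp[OF mul_lin(2) Phi(1)] _ _ t(1)])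
    show "t4 a \<alpha> b \<beta> \<in> carrier X" using tens by (intro t4_closed)
    show "?g \<in> lin X Q"
      by (intro lin_Pair lin_const_zero v_tensors lin_comp[OF lin_comp[OF Phi(1) lin_fst] M(1)])
    fix c \<gamma> d \<delta> assume cd: "c \<in> carrier T" "d \<in> carrier T"
    then have fcd: "fst c \<in> carrier E" "fst d \<in> carrier E" by auto
    have w: "(\<alpha> * \<beta>) \<odot>\<^bsub>W\<^esub> \<mu> (t3 (fst a) (fst b) (fst c)) \<in> carrier W"
      using ab fcd by (simp add: vW mu_closed[OF mu])
    have "M (fst (Phi (t4 c \<gamma> d \<delta>))) = (\<gamma> * \<delta>) \<odot>\<^bsub>WE\<^esub> tens W E ((\<alpha> * \<beta>) \<odot>\<^bsub>W\<^esub> \<mu> (t3 (fst a) (fst b) (fst c))) (fst d)"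
      using cd fcd by (simp add: Phi(2) lin_smult[OF M(1)] tens_closed vE M(2))
    then show "Phi (mul (t4 a \<alpha> b \<beta>) (t4 c \<gamma> d \<delta>)) = ?g (t4 c \<gamma> d \<delta>)"
      using cd tens by (simp only: op_mult(2) T_prod_def Phi_W_left[OF w])
  qed
  then show ?case using t(2) lin_zero[OF M(1) v_tensors(1) v_tensors(4)] by simp
next
  case (add y y')
  have "mul (y \<oplus>\<^bsub>X\<^esub> y') t = mul y t \<oplus>\<^bsub>X\<^esub> mul y' t"
    by (rule lin_add[OF mul_lin(1)[OF t(1)] add(1,2)])
  then have "Phi (mul (y \<oplus>\<^bsub>X\<^esub> y') t) = Phi (mul y t) \<oplus>\<^bsub>Q\<^esub> Phi (mul y' t)"
    using lin_add[OF Phi(1) mul_lin(3)[OF add(1) t(1)] mul_lin(3)[OF add(2) t(1)]] by simp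
  then show ?case unfolding add(3,4) using vs_add_zero(1)[OF vQ vs_zero_closed[OF vQ]] by simp
qed

end

lemma vspace_mult_update: "vspace V \<Longrightarrow> vspace (V\<lparr>mult := f\<rparr>)"
  by (rule vspaceI) (simp_all add: vs_add_comm vs_add_assoc vs_add_left_comm vs_smult_smult vs_add_smult vs_smult_add)

lemma a_inv_mult_update: "\<ominus>\<^bsub>V\<lparr>mult := f\<rparr>\<^esub> x = \<ominus>\<^bsub>V\<^esub> x"
  by (simp add: a_inv_def m_inv_def)

context surjective_tensor
begin

section \<open>The defining ideal of the operator rng\<close>

definition op_relation where
  "op_relation a \<alpha> b \<beta> c \<gamma> d \<delta> = t4 (p a \<alpha> b \<beta> c) \<gamma> d \<delta> \<ominus>\<^bsub>X\<^esub> t4 a \<alpha> (p b \<beta> c \<gamma> d) \<delta>"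

definition op_relations where
  "op_relations = {op_relation a \<alpha> b \<beta> c \<gamma> d \<delta> | a \<alpha> b \<beta> c \<gamma> d \<delta>.
     a \<in> carrier T \<and> b \<in> carrier T \<and> c \<in> carrier T \<and> d \<in> carrier T}"

definition op_null where
  "op_null = {t \<in> carrier X. Phi t \<in> Pair \<zero>\<^bsub>EE\<^esub> ` Bmap E W \<mu> ` carrier EEEE}"

lemma op_ideal_eq_gen: "op_ideal T \<Gamma> p = gen_rng_ideal X' op_relations"
  unfolding op_ideal_def op_relations_def op_relation_def by simp

lemma lin_inj_BB: "Pair \<zero>\<^bsub>EE\<^esub> \<in> lin BB Q"
  by (intro lin_Pair lin_const_zero lin_id v_tensors)

lemma subsp_null_image: "subsp (Pair \<zero>\<^bsub>EE\<^esub> ` Bmap E W \<mu> ` carrier EEEE) Q"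
  by (intro subsp_image[OF lin_inj_BB] subsp_range[OF Bmap_lin[OF mu]] v_tensors vQ)

lemma subsp_op_null: "subsp op_null X"
  unfolding op_null_def by (rule subsp_vimage[OF Phi(1) vX vQ subsp_null_image])

text \<open>The first ternary product is an element of \<open>W\<close> in the left slot and gives
  the \<open>W \<otimes> E\<close> component; the second sits in the right slot and gives
  \<open>E \<otimes> W\<close> with a minus sign. Together they are \<open>Bmap\<close> at the
  \<open>E\<close> parts, times the product of the four scalars.\<close>

lemma Phi_op_relation:
  assumes "a \<in> carrier T" "b \<in> carrier T" "c \<in> carrier T" "d \<in> carrier T"
  shows "Phi (op_relation a \<alpha> b \<beta> c \<gamma> d \<delta>) =
    (\<zero>\<^bsub>EE\<^esub>, (\<alpha> * \<beta> * \<gamma> * \<delta>) \<odot>\<^bsub>BB\<^esub> Bmap E W \<mu> (tens4 E E E E (fst a) (fst b) (fst c) (fst d)))"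
proof -
  have f: "fst a \<in> carrier E" "fst b \<in> carrier E" "fst c \<in> carrier E" "fst d \<in> carrier E"
    using assms by auto
  let ?k = "\<alpha> * \<beta> * \<gamma> * \<delta>"
  let ?u = "\<mu> (t3 (fst a) (fst b) (fst c))" and ?v = "\<mu> (t3 (fst b) (fst c) (fst d))"
  have w: "?u \<in> carrier W" "?v \<in> carrier W"
    using f by (auto intro: mu_closed[OF mu])
  have t: "tens W E ?u (fst d) \<in> carrier WE" "tens E W (fst a) ?v \<in> carrier EW"
    using f w by (auto intro: tens_closed vE vW)
  have k: "\<gamma> * \<delta> * (\<alpha> * \<beta>) = ?k" "\<alpha> * \<delta> * (\<beta> * \<gamma>) = ?k" by (simp_all add: ac_simps)
  have 1: "Phi (t4 (p a \<alpha> b \<beta> c) \<gamma> d \<delta>) = (\<zero>\<^bsub>EE\<^esub>, (?k \<odot>\<^bsub>WE\<^esub> tens W E ?u (fst d), \<zero>\<^bsub>EW\<^esub>))"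
    unfolding T_prod_def using w assms(4) f t
    by (subst Phi_W_left)
      (simp_all add: vW vE lin_smult[OF lin_tens_left] k v_tensors flip: vs_smult_smult)
  have 2: "Phi (t4 a \<alpha> (p b \<beta> c \<gamma> d) \<delta>) = (\<zero>\<^bsub>EE\<^esub>, (\<zero>\<^bsub>WE\<^esub>, ?k \<odot>\<^bsub>EW\<^esub> tens E W (fst a) ?v))"
    unfolding T_prod_def using w assms(1) f t
    by (subst Phi_W_right)
      (simp_all add: vW vE lin_smult[OF lin_tens_right] k v_tensors flip: vs_smult_smult)
  have c: "p a \<alpha> b \<beta> c \<in> carrier T" "p b \<beta> c \<gamma> d \<in> carrier T"
    using assms p_closed by blast+
  have m: "Phi (op_relation a \<alpha> b \<beta> c \<gamma> d \<delta>) =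
      Phi (t4 (p a \<alpha> b \<beta> c) \<gamma> d \<delta>) \<ominus>\<^bsub>Q\<^esub> Phi (t4 a \<alpha> (p b \<beta> c \<gamma> d) \<delta>)"
    unfolding op_relation_def by (rule lin_minus[OF Phi(1) vX vQ]) (use assms c in \<open>blast intro: t4_closed\<close>)+
  have "(\<zero>\<^bsub>EE\<^esub>, (\<zero>\<^bsub>WE\<^esub>, ?k \<odot>\<^bsub>EW\<^esub> tens E W (fst a) ?v)) \<in> carrier Q"
    using t by (simp add: v_tensors)
  then have m': "Phi (op_relation a \<alpha> b \<beta> c \<gamma> d \<delta>) = (\<zero>\<^bsub>EE\<^esub>, (?k \<odot>\<^bsub>WE\<^esub> tens W E ?u (fst d), \<zero>\<^bsub>EW\<^esub>)) \<oplus>\<^bsub>Q\<^esub>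
      (- 1) \<odot>\<^bsub>Q\<^esub> (\<zero>\<^bsub>EE\<^esub>, (\<zero>\<^bsub>WE\<^esub>, ?k \<odot>\<^bsub>EW\<^esub> tens E W (fst a) ?v))"
    unfolding m 1 2 by (rule vs_minus_eq[OF vQ])
  show ?thesis
    unfolding m' Bmap(2)[OF mu f] using t
    by (simp add: v_tensors vs_neg_eq mult.commute flip: vs_smult_smult)
qed

lemma op_relations_closed: "op_relations \<subseteq> carrier X"
  unfolding op_relations_def op_relation_def
  using p_closed by (auto simp del: direct_sum_simps(1) intro!: vs_minus_closed vX t4_closed)

lemma op_relations_null: "op_relations \<subseteq> op_null"
proof
  fix t assume t: "t \<in> op_relations"
  then obtain a \<alpha> b \<beta> c \<gamma> d \<delta> where *: "t = op_relation a \<alpha> b \<beta> c \<gamma> d \<delta>"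
    "a \<in> carrier T" "b \<in> carrier T" "c \<in> carrier T" "d \<in> carrier T" unfolding op_relations_def by blast
  let ?e = "tens4 E E E E (fst a) (fst b) (fst c) (fst d)"
  have e: "?e \<in> carrier EEEE" using * by (auto intro!: lin_tens4(5) vE)
  have "(\<alpha> * \<beta> * \<gamma> * \<delta>) \<odot>\<^bsub>BB\<^esub> Bmap E W \<mu> ?e = Bmap E W \<mu> ((\<alpha> * \<beta> * \<gamma> * \<delta>) \<odot>\<^bsub>EEEE\<^esub> ?e)"
    by (rule lin_smult[OF Bmap_lin[OF mu] e, symmetric])
  then have "Phi t = Pair \<zero>\<^bsub>EE\<^esub> (Bmap E W \<mu> ((\<alpha> * \<beta> * \<gamma> * \<delta>) \<odot>\<^bsub>EEEE\<^esub> ?e))"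
    using Phi_op_relation * by simp
  moreover have "(\<alpha> * \<beta> * \<gamma> * \<delta>) \<odot>\<^bsub>EEEE\<^esub> ?e \<in> carrier EEEE" using e by (simp add: v_tensors)
  ultimately show "t \<in> op_null" using t op_relations_closed unfolding op_null_def by blast
qed

lemma vX': "vspace X'"
  unfolding op_tensor_rng_def by (rule vspace_mult_update[OF vX])

lemma X'_simps: "carrier X' = carrier X" "add X' = add X" "zero X' = zero X" "module.smult X' = module.smult X"
  "mult X' = mul" "\<ominus>\<^bsub>X'\<^esub> t = \<ominus>\<^bsub>X\<^esub> t"
  by (simp_all add: op_tensor_rng_def a_inv_mult_update)

lemma subsp_op_null': "subsp op_null X'"
  using subsp_op_null by (simp add: subsp_def X'_simps)

lemma rng_ideal_op_null: "rng_ideal op_null X'"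
  unfolding rng_ideal_def
proof (intro conjI ballI)
  show "additive_subgroup op_null X'" by (rule subsp_additive_subgroup[OF vX' subsp_op_null'])
  fix t y assume t: "t \<in> op_null" and y: "y \<in> carrier X'"
  then have *: "t \<in> carrier X" "fst (Phi t) = \<zero>\<^bsub>EE\<^esub>" "y \<in> carrier X"
    by (auto simp: op_null_def X'_simps)
  \<comment> \<open>Products with elements of \<open>op_null\<close> are sent to zero by
    \<open>Phi\<close>, and zero lies in the image of \<open>Bmap\<close>.\<close>
  have 0: "\<zero>\<^bsub>Q\<^esub> \<in> Pair \<zero>\<^bsub>EE\<^esub> ` Bmap E W \<mu> ` carrier EEEE" using subsp_null_image unfolding subsp_def by blast
  show "t \<otimes>\<^bsub>X'\<^esub> y \<in> op_null"
    using Phi_mult_right[OF *] mul_lin(3)[OF *(1,3)] 0 unfolding op_null_def X'_simps by simp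
  show "y \<otimes>\<^bsub>X'\<^esub> t \<in> op_null"
    using Phi_mult_left[OF *] mul_lin(3)[OF *(3,1)] 0 unfolding op_null_def X'_simps by simp
qed

text \<open>Modulo an ideal containing the relations \<open>W \<otimes> W\<close> vanishes, so every tensor \<open>t\<close> agrees with
  \<open>\<sigma> (Phi t)\<close> for a linear section \<open>\<sigma>\<close> of \<open>Phi\<close>, and only the image of \<open>t\<close> in \<open>Q\<close> matters.\<close>

lemma op_null_subset:
  assumes J: "rng_ideal J X'" and S: "op_relations \<subseteq> J"
  shows "op_null \<subseteq> J"
proof -
  interpret additive_subgroup J X' using J by (simp add: rng_ideal_def)
  interpret X': abelian_group X' by (rule vspace_abelian_group[OF vX'])
  have Jadd: "s \<oplus>\<^bsub>X\<^esub> t \<in> J" if "s \<in> J" "t \<in> J" for s t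
    using a_closed[OF that] by (simp add: X'_simps)
  have JX: "t \<in> carrier X" if "t \<in> J" for t using a_subset that by (auto simp: X'_simps)
  \<comment> \<open>Sums and negatives are the only linear operations under which the additive
    subgroup \<open>J\<close> is known to be closed.\<close>
  have Jneg: "(- 1) \<odot>\<^bsub>X\<^esub> t \<in> J" if "t \<in> J" for t
    using a_inv_closed[OF that] vs_neg_eq[OF vX JX[OF that]] by (simp add: X'_simps)
  obtain \<sigma> where \<sigma>: "\<sigma> \<in> lin Q X" "\<And>q. q \<in> carrier Q \<Longrightarrow> Phi (\<sigma> q) = q"
    "\<And>a b. a \<in> carrier T \<Longrightarrow> b \<in> carrier T \<Longrightarrow>
      \<sigma> (Phi (t4 a 1 b 1)) = t4 (fst a, \<zero>\<^bsub>W\<^esub>) 1 (fst b, \<zero>\<^bsub>W\<^esub>) 1 \<oplus>\<^bsub>X\<^esub>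
        (t4 (\<zero>\<^bsub>E\<^esub>, snd a) 1 (fst b, \<zero>\<^bsub>W\<^esub>) 1 \<oplus>\<^bsub>X\<^esub> t4 (fst a, \<zero>\<^bsub>W\<^esub>) 1 (\<zero>\<^bsub>E\<^esub>, snd b) 1)"
    using Phi_section by blast
  have \<sigma>P: "(\<lambda>t. \<sigma> (Phi t)) \<in> lin X X" by (rule lin_comp[OF Phi(1) \<sigma>(1)])
  have rel: "op_relation a \<alpha> b \<beta> c \<gamma> d \<delta> \<in> J"
    if "a \<in> carrier T" "b \<in> carrier T" "c \<in> carrier T" "d \<in> carrier T" for a \<alpha> b \<beta> c \<gamma> d \<delta>
    using S that unfolding op_relations_def by blast
  \<comment> \<open>The scalars \<open>n\<close> and \<open>m\<close> are carried along because
    \<open>J\<close> need not be closed under scalar multiplication. Surjectivity enters here: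
    \<open>w\<close> is a value of \<open>\<mu>\<close>, hence a sum of values at pure
    tensors.\<close>
  have WW: "t4 (\<zero>\<^bsub>E\<^esub>, w) n (\<zero>\<^bsub>E\<^esub>, w') m \<in> J" if w: "w \<in> carrier W" and w': "w' \<in> carrier W" for w w' n m
  proof -
    have "t4 (\<zero>\<^bsub>E\<^esub>, \<mu> u) n (\<zero>\<^bsub>E\<^esub>, w') m \<in> J" if "u \<in> carrier EEE" for u
      using vE vE vE that
    proof (induction rule: tensor3_induct)
      case (tens a b c)
      let ?i = "\<lambda>x. (x, \<zero>\<^bsub>W\<^esub>)"
      have T: "?i a \<in> carrier T" "?i b \<in> carrier T" "?i c \<in> carrier T" "(\<zero>\<^bsub>E\<^esub>, w') \<in> carrier T"
        using tens w' by (auto simp: vE vW)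
      have m: "\<mu> (t3 a b c) \<in> carrier W" "\<mu> (t3 b c \<zero>\<^bsub>E\<^esub>) = \<zero>\<^bsub>W\<^esub>"
        using tens lin_zero[OF mu_lin(3)[OF mu] vE vW] by (auto intro: mu_closed[OF mu])
      \<comment> \<open>In the relation for \<open>a\<close>, \<open>b\<close>, \<open>c\<close> and
        an element of \<open>W\<close>, the second ternary product has zero \<open>E\<close> part in
        its last argument. It vanishes, which leaves exactly the desired tensor.\<close>
      have "p (?i a) 1 (?i b) 1 (?i c) = (\<zero>\<^bsub>E\<^esub>, \<mu> (t3 a b c))" "p (?i b) 1 (?i c) n (\<zero>\<^bsub>E\<^esub>, w') = \<zero>\<^bsub>T\<^esub>"
        using m by (simp_all add: T_prod_def vW)
      then have "op_relation (?i a) 1 (?i b) 1 (?i c) n (\<zero>\<^bsub>E\<^esub>, w') m =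
          t4 (\<zero>\<^bsub>E\<^esub>, \<mu> (t3 a b c)) n (\<zero>\<^bsub>E\<^esub>, w') m \<ominus>\<^bsub>X\<^esub> \<zero>\<^bsub>X\<^esub>"
        unfolding op_relation_def by (simp only: t4_zero[OF T(1)])
      also have "\<dots> = t4 (\<zero>\<^bsub>E\<^esub>, \<mu> (t3 a b c)) n (\<zero>\<^bsub>E\<^esub>, w') m"
        using m T by (intro vs_minus_zero vX t4_closed) (auto simp: vE)
      finally show ?case using rel[OF T] by metis
    next
      case (add s t)
      have l: "\<mu> s \<in> carrier W" "\<mu> t \<in> carrier W" using add lin_closed[OF tensor_maps_lin[OF mu]] by auto
      then have "t4 (\<zero>\<^bsub>E\<^esub>, \<mu> (s \<oplus>\<^bsub>EEE\<^esub> t)) n (\<zero>\<^bsub>E\<^esub>, w') m =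
          t4 (\<zero>\<^bsub>E\<^esub>, \<mu> s) n (\<zero>\<^bsub>E\<^esub>, w') m \<oplus>\<^bsub>X\<^esub> t4 (\<zero>\<^bsub>E\<^esub>, \<mu> t) n (\<zero>\<^bsub>E\<^esub>, w') m"
        using t4_add_left[of "(\<zero>\<^bsub>E\<^esub>, \<mu> s)" "(\<zero>\<^bsub>E\<^esub>, \<mu> t)" "(\<zero>\<^bsub>E\<^esub>, w')" n m] w' add(1,2)
        by (simp add: vE lin_add[OF tensor_maps_lin[OF mu]])
      then show ?case using Jadd[OF add(3,4)] by simp
    qed
    moreover obtain u where "u \<in> carrier EEE" "w = \<mu> u"
      using surj w unfolding surj_tensor_maps_def by blast
    ultimately show ?thesis by simp
  qed
  have dec: "\<exists>j\<in>J. t = \<sigma> (Phi t) \<oplus>\<^bsub>X\<^esub> j" if "t \<in> carrier X" for t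
    using vT v\<Gamma> vT v\<Gamma> that
  proof (induction rule: tensor4_induct)
    case (tens a n b m)
    obtain x w where a: "a = (x, w)" "x \<in> carrier E" "w \<in> carrier W" using tens(1) by auto
    obtain y v where b: "b = (y, v)" "y \<in> carrier E" "v \<in> carrier W" using tens(3) by auto
    let ?x = "(x, \<zero>\<^bsub>W\<^esub>)" and ?w = "(\<zero>\<^bsub>E\<^esub>, w)" and ?y = "(y, \<zero>\<^bsub>W\<^esub>)" and ?v = "(\<zero>\<^bsub>E\<^esub>, v)"
    have T: "?x \<in> carrier T" "?w \<in> carrier T" "?y \<in> carrier T" "?v \<in> carrier T"
      using a b by (auto simp: vE vW)
    have ab: "a = ?x \<oplus>\<^bsub>T\<^esub> ?w" "b = ?y \<oplus>\<^bsub>T\<^esub> ?v" using a b by (auto simp: vE vW)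
    let ?s = "t4 ?x 1 ?y 1 \<oplus>\<^bsub>X\<^esub> (t4 ?w 1 ?y 1 \<oplus>\<^bsub>X\<^esub> t4 ?x 1 ?v 1)"
    have s: "\<sigma> (Phi (t4 a 1 b 1)) = ?s" using \<sigma>(3)[OF tens(1,3)] a b by simp
    have cl: "t4 ?x 1 ?y 1 \<in> carrier X" "t4 ?w 1 ?y 1 \<in> carrier X" "t4 ?x 1 ?v 1 \<in> carrier X" "t4 ?w 1 ?v 1 \<in> carrier X"
      by (intro t4_closed T)+
    have "t4 a 1 b 1 = (t4 ?x 1 ?y 1 \<oplus>\<^bsub>X\<^esub> t4 ?w 1 ?y 1) \<oplus>\<^bsub>X\<^esub> (t4 ?x 1 ?v 1 \<oplus>\<^bsub>X\<^esub> t4 ?w 1 ?v 1)"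
      unfolding ab by (simp only: t4_add_left t4_add_right T vs_add_closed[OF vT])
    also have "\<dots> = ?s \<oplus>\<^bsub>X\<^esub> t4 ?w 1 ?v 1"
      using cl by (simp only: vs_add_assoc[OF vX] vs_add_left_comm[OF vX] vs_add_closed[OF vX])
    finally have e: "t4 a 1 b 1 = ?s \<oplus>\<^bsub>X\<^esub> t4 ?w 1 ?v 1" .
    have "t4 a n b m = (n * m) \<odot>\<^bsub>X\<^esub> t4 a 1 b 1" by (rule t4_scale[OF tens(1,3)])
    moreover have "\<sigma> (Phi ((n * m) \<odot>\<^bsub>X\<^esub> t4 a 1 b 1)) = (n * m) \<odot>\<^bsub>X\<^esub> ?s"
      using lin_smult[OF \<sigma>P t4_closed[OF tens(1,3)]] s by simp
    \<comment> \<open>The factor \<open>n * m\<close> is put back into the scalar slots of the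
      \<open>W \<otimes> W\<close> term, so that \<open>WW\<close> applies to it.\<close>
    moreover have "(n * m) \<odot>\<^bsub>X\<^esub> t4 a 1 b 1 = (n * m) \<odot>\<^bsub>X\<^esub> ?s \<oplus>\<^bsub>X\<^esub> t4 ?w n ?v m"
      unfolding e t4_scale[OF T(2,4), of n m] using cl by (intro vs_smult_add vX vs_add_closed)
    ultimately have "t4 a n b m = \<sigma> (Phi (t4 a n b m)) \<oplus>\<^bsub>X\<^esub> t4 ?w n ?v m" by simp
    then show ?case using WW[OF a(3) b(3)] by blast
  next
    case (add s t)
    then obtain i j where ij: "i \<in> J" "j \<in> J" "s = \<sigma> (Phi s) \<oplus>\<^bsub>X\<^esub> i" "t = \<sigma> (Phi t) \<oplus>\<^bsub>X\<^esub> j" by blast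
    have cl: "\<sigma> (Phi s) \<in> carrier X" "\<sigma> (Phi t) \<in> carrier X" "i \<in> carrier X" "j \<in> carrier X"
      using lin_closed[OF \<sigma>P] add(1,2) JX ij by auto
    have "s \<oplus>\<^bsub>X\<^esub> t = (\<sigma> (Phi s) \<oplus>\<^bsub>X\<^esub> i) \<oplus>\<^bsub>X\<^esub> (\<sigma> (Phi t) \<oplus>\<^bsub>X\<^esub> j)" using ij(3,4) by argo
    also have "\<dots> = (\<sigma> (Phi s) \<oplus>\<^bsub>X\<^esub> \<sigma> (Phi t)) \<oplus>\<^bsub>X\<^esub> (i \<oplus>\<^bsub>X\<^esub> j)"
      using cl by (simp only: vs_add_assoc[OF vX] vs_add_left_comm[OF vX] vs_add_closed[OF vX])
    also have "\<sigma> (Phi s) \<oplus>\<^bsub>X\<^esub> \<sigma> (Phi t) = \<sigma> (Phi (s \<oplus>\<^bsub>X\<^esub> t))"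
      by (rule lin_add[OF \<sigma>P add(1,2), symmetric])
    finally show ?case using Jadd[OF ij(1,2)] by blast
  qed
  \<comment> \<open>Relations with all scalars equal to 1 realise the values of \<open>Bmap\<close>
    at pure tensors; sums of these suffice for the whole image.\<close>
  have lift: "\<exists>s\<in>J. Phi s = Pair \<zero>\<^bsub>EE\<^esub> (Bmap E W \<mu> u)" if "u \<in> carrier EEEE" for u
    using vE vE vE vE that
  proof (induction rule: tensor4_induct)
    case (tens a b c d)
    let ?i = "\<lambda>x. (x, \<zero>\<^bsub>W\<^esub>)"
    have T: "?i a \<in> carrier T" "?i b \<in> carrier T" "?i c \<in> carrier T" "?i d \<in> carrier T"
      using tens by (auto simp: vW)
    have "Bmap E W \<mu> (tens4 E E E E a b c d) \<in> carrier BB"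
      using tens by (intro hom_vs_closed[OF Bmap(1)[OF mu]] lin_tens4(5) vE)
    then have "Phi (op_relation (?i a) 1 (?i b) 1 (?i c) 1 (?i d) 1) = Pair \<zero>\<^bsub>EE\<^esub> (Bmap E W \<mu> (tens4 E E E E a b c d))"
      using Phi_op_relation[OF T, of 1 1 1 1] vs_smult_one[OF v_tensors(6)] by (simp only: mult_1 fst_conv)
    then show ?case using rel[OF T] by blast
  next
    case (add s t)
    then obtain s' t' where st: "s' \<in> J" "Phi s' = Pair \<zero>\<^bsub>EE\<^esub> (Bmap E W \<mu> s)"
      "t' \<in> J" "Phi t' = Pair \<zero>\<^bsub>EE\<^esub> (Bmap E W \<mu> t)" by blast
    have "Phi (s' \<oplus>\<^bsub>X\<^esub> t') = Pair \<zero>\<^bsub>EE\<^esub> (Bmap E W \<mu> (s \<oplus>\<^bsub>EEEE\<^esub> t))"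
      using lin_add[OF Phi(1) JX[OF st(1)] JX[OF st(3)]] st(2,4)
        lin_add[OF lin_comp[OF Bmap_lin[OF mu] lin_inj_BB] add(1,2)] by argo
    then show ?case using Jadd[OF st(1,3)] by blast
  qed
  show ?thesis
  proof
    fix t assume "t \<in> op_null"
    then obtain u where t: "t \<in> carrier X" and u: "u \<in> carrier EEEE" "Phi t = Pair \<zero>\<^bsub>EE\<^esub> (Bmap E W \<mu> u)"
      unfolding op_null_def by blast
    \<comment> \<open>\<open>s\<close> and \<open>t\<close> have the same image in \<open>Q\<close>,
      so both equal the common vector \<open>\<sigma> (Phi t)\<close> up to elements of
      \<open>J\<close>. Since \<open>s\<close> is in \<open>J\<close>, so is that vector, and then
      \<open>t\<close>.\<close>
    obtain s where s: "s \<in> J" "Phi s = Phi t" using lift[OF u(1)] u(2) by metis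
    obtain i where i: "i \<in> J" "t = \<sigma> (Phi t) \<oplus>\<^bsub>X\<^esub> i" using dec[OF t] by blast
    obtain j where j: "j \<in> J" "s = \<sigma> (Phi t) \<oplus>\<^bsub>X\<^esub> j" using dec[OF JX[OF s(1)]] s(2) by metis
    have cl: "\<sigma> (Phi t) \<in> carrier X" "i \<in> carrier X" "j \<in> carrier X"
      using lin_closed[OF \<sigma>P t] JX i j by auto
    have "s \<oplus>\<^bsub>X\<^esub> (- 1) \<odot>\<^bsub>X\<^esub> j = \<sigma> (Phi t)"
      unfolding j(2) using cl by (simp add: vs_add_assoc[OF vX] vX)
    then have "\<sigma> (Phi t) \<in> J" using Jadd[OF s(1) Jneg[OF j(1)]] by simp
    then show "t \<in> J" using Jadd[OF _ i(1)] i(2) by metis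
  qed
qed

lemma op_ideal_eq: "op_ideal T \<Gamma> p = op_null"
  unfolding op_ideal_eq_gen gen_rng_ideal_def
  using rng_ideal_op_null op_relations_null op_null_subset by blast

section \<open>The regular representation and the operator defect\<close>

abbreviation (input) "R \<equiv> operator_rng T \<Gamma> p"
abbreviation (input) "cls \<equiv> \<lambda>t. op_null +>\<^bsub>X'\<^esub> t"

lemma operator_rng_eq: "R = quotient_vs X' op_null"
  unfolding operator_rng_def op_ideal_eq ..

lemmas R_simps = quotient_vs_simps[OF vX' subsp_op_null', folded operator_rng_eq, unfolded X'_simps]

lemma vR: "vspace R"
  unfolding operator_rng_eq by (rule vspace_quotient_vs[OF vX' subsp_op_null'])

lemma lin_X'_iff: "f \<in> lin X' N \<longleftrightarrow> f \<in> lin X N"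
  by (simp add: LinearCombinations.module_hom_def X'_simps)

lemma lin_cls: "cls \<in> lin X R"
  using lin_coset[OF vX' subsp_op_null'] unfolding operator_rng_eq lin_X'_iff .

lemma cls_zero_iff: "t \<in> carrier X \<Longrightarrow> cls t = \<zero>\<^bsub>R\<^esub> \<longleftrightarrow> t \<in> op_null"
  unfolding R_simps(2) by (rule coset_eq_zero_iff[OF vX' subsp_op_null']) (simp add: X'_simps)

text \<open>Rank-nullity for the quotient map and the dimension of a preimage under
  \<open>Phi\<close> both involve \<open>vdim X\<close>, which cancels. What remains is the
  codimension of the image of \<open>Bmap\<close> in \<open>Q\<close>.\<close>

lemma vdim_R: "fdvs R" "vdim R + rank_B E W \<mu> = vdim Q"
proof -
  have surjR: "cls ` carrier X = carrier R" by (simp add: R_simps(1))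
  show fd: "fdvs R" by (rule fdvs_surj[OF lin_cls fdX vR surjR])
  have "{t \<in> carrier X. cls t = \<zero>\<^bsub>R\<^esub>} = op_null"
    using cls_zero_iff subsp_op_null by (auto simp: subsp_def)
  then have 1: "vdim R + vdim (X\<lparr>carrier := op_null\<rparr>) = vdim X"
    using rank_nullity[OF lin_cls fdX vR] surjR by simp
  let ?U = "Bmap E W \<mu> ` carrier EEEE"
  have 2: "vdim (X\<lparr>carrier := op_null\<rparr>) + vdim Q = vdim X + vdim (Q\<lparr>carrier := Pair \<zero>\<^bsub>EE\<^esub> ` ?U\<rparr>)"
    unfolding op_null_def by (rule vdim_vimage[OF Phi(1) fdX vQ Phi_surj subsp_null_image])
  have "vdim (Q\<lparr>carrier := Pair \<zero>\<^bsub>EE\<^esub> ` ?U\<rparr>) = vdim (BB\<lparr>carrier := ?U\<rparr>)"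
    by (rule vdim_image_inj[OF lin_inj_BB fd_tensors(6) vQ subsp_range[OF Bmap_lin[OF mu]]]) (auto simp: v_tensors)
  then show "vdim R + rank_B E W \<mu> = vdim Q"
    using 1 2 by (simp add: rank_B_def rank_of_def)
qed

text \<open>Operators of the regular representation ignore \<open>W\<close> and take values in
  \<open>W\<close>, so they come from maps \<open>E \<rightarrow> W\<close>; \<open>J\<close> embeds
  \<open>hom_vs E W\<close> in the endomorphisms of \<open>T\<close> accordingly.\<close>

definition J where "J f = (\<lambda>x\<in>carrier T. (\<zero>\<^bsub>E\<^esub>, f (fst x)))"

lemma vTT: "vspace (hom_vs T T)"
  by (rule vspace_hom_vs[OF vT vT])

lemma J_lin: "J \<in> lin (hom_vs E W) (hom_vs T T)"
proof (rule lin_into_hom_vs[OF _ _ v_tensors(7) vT vT])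
  show "J f \<in> carrier (hom_vs T T)" if "f \<in> carrier (hom_vs E W)" for f
    unfolding J_def
    by (intro restrict_hom_vs vT lin_Pair lin_const_zero vE lin_comp[OF lin_fst hom_vs_lin[OF that]])
  show "(\<lambda>f. J f x) \<in> lin (hom_vs E W) T" if x: "x \<in> carrier T" for x
  proof -
    have "fst x \<in> carrier E" using x by auto
    then have "(\<lambda>f. (\<zero>\<^bsub>E\<^esub>, f (fst x))) \<in> lin (hom_vs E W) T"
      by (intro lin_Pair lin_const_zero vE lin_hom_vs_apply)
    then show ?thesis using x unfolding J_def by simp
  qed
qed

lemma J_inj:
  assumes f: "f \<in> carrier (hom_vs E W)" and 0: "J f = \<zero>\<^bsub>hom_vs T T\<^esub>"
  shows "f = \<zero>\<^bsub>hom_vs E W\<^esub>"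
proof (rule hom_vs_eqI[OF f])
  show "\<zero>\<^bsub>hom_vs E W\<^esub> \<in> carrier (hom_vs E W)" by (simp add: v_tensors)
  fix x assume x: "x \<in> carrier E"
  have "J f (x, \<zero>\<^bsub>W\<^esub>) = \<zero>\<^bsub>T\<^esub>" unfolding 0 using x by (simp add: hom_vs_simps vW)
  then show "f x = \<zero>\<^bsub>hom_vs E W\<^esub> x" using x by (simp add: J_def hom_vs_simps vW)
qed

text \<open>The regular representation before passing to the quotient, written in the factored form
  that exhibits its rank.\<close>

definition rep where "rep t = J (Theta E W \<mu> (fst (Phi t)))"

lemma rep_lin: "rep \<in> lin X (hom_vs T T)"
  unfolding rep_def by (rule lin_comp[OF lin_comp[OF lin_comp[OF Phi(1) lin_fst] Theta_lin[OF mu]] J_lin])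

lemma rep_t4:
  assumes "a \<in> carrier T" "b \<in> carrier T" "x \<in> carrier T"
  shows "rep (t4 a \<alpha> b \<beta>) x = p a \<alpha> b \<beta> x"
proof -
  have "fst a \<in> carrier E" "fst b \<in> carrier E" "fst x \<in> carrier E" using assms by auto
  then show ?thesis
    using assms by (simp add: rep_def J_def T_prod_def Phi(2) lin_smult[OF Theta_lin[OF mu]] tens_closed vE
        hom_vs_simps(4) Theta(2)[OF mu])
qed

lemma rep_null: "t \<in> op_null \<Longrightarrow> rep t = \<zero>\<^bsub>hom_vs T T\<^esub>"
  using lin_zero[OF lin_comp[OF Theta_lin[OF mu] J_lin] v_tensors(1) vTT] by (auto simp: op_null_def rep_def)

lemma regular_rep:
  shows "regular_rep T \<Gamma> p \<in> carrier (hom_vs R (hom_vs T T))"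
    "t \<in> carrier X \<Longrightarrow> regular_rep T \<Gamma> p (cls t) = rep t"
proof -
  let ?P = "\<lambda>\<rho>. \<rho> \<in> carrier (hom_vs R (hom_vs T T)) \<and>
    (\<forall>a\<in>carrier T. \<forall>\<alpha>\<in>carrier \<Gamma>. \<forall>b\<in>carrier T. \<forall>\<beta>\<in>carrier \<Gamma>. \<forall>x\<in>carrier T.
       \<rho> (op_class T \<Gamma> p a \<alpha> b \<beta>) x = p a \<alpha> b \<beta> x)"
  have cls: "op_class T \<Gamma> p a \<alpha> b \<beta> = cls (t4 a \<alpha> b \<beta>)" for a \<alpha> b \<beta>
    unfolding op_class_def op_ideal_eq ..
  obtain g where g: "g \<in> lin R (hom_vs T T)" "\<And>t. t \<in> carrier X \<Longrightarrow> g (cls t) = rep t"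
    using quotient_lift[OF vX' subsp_op_null' _ vTT, of rep] rep_lin rep_null
    unfolding lin_X'_iff operator_rng_eq[symmetric] X'_simps by metis
  have ex: "?P (restrict g (carrier R))"
    using restrict_hom_vs[OF vR g(1)] g(2) lin_closed[OF lin_cls t4_closed] rep_t4 t4_closed
    by (simp add: cls del: direct_sum_simps(1))
  \<comment> \<open>Any map with the prescribed values on classes of pure tensors must agree with
    \<open>rep\<close> on all classes. This yields uniqueness and also the value of the described
    map.\<close>
  have det: "\<rho> (cls t) = rep t" if "?P \<rho>" "t \<in> carrier X" for \<rho> t
  proof (rule X_lin_eq[OF lin_comp[OF lin_cls hom_vs_lin] rep_lin _ that(2)])
    show r: "\<rho> \<in> carrier (hom_vs R (hom_vs T T))" using that(1) by blast
    fix a \<alpha> b \<beta> assume ab: "a \<in> carrier T" "b \<in> carrier T"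
    show "\<rho> (cls (t4 a \<alpha> b \<beta>)) = rep (t4 a \<alpha> b \<beta>)"
    proof (rule hom_vs_eqI[of _ T T])
      show "\<rho> (cls (t4 a \<alpha> b \<beta>)) \<in> carrier (hom_vs T T)"
        by (rule hom_vs_closed[OF r lin_closed[OF lin_cls t4_closed[OF ab]]])
      show "rep (t4 a \<alpha> b \<beta>) \<in> carrier (hom_vs T T)"
        by (rule lin_closed[OF rep_lin t4_closed[OF ab]])
      show "\<rho> (cls (t4 a \<alpha> b \<beta>)) x = rep (t4 a \<alpha> b \<beta>) x" if "x \<in> carrier T" for x
        using \<open>?P \<rho>\<close> ab that by (simp add: rep_t4 cls del: direct_sum_simps(1))
    qed
  qed
  have uniq: "\<rho> = \<rho>'" if "?P \<rho>" "?P \<rho>'" for \<rho> \<rho>'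
  proof (rule hom_vs_eqI[of _ R "hom_vs T T"])
    show "\<rho> x = \<rho>' x" if x: "x \<in> carrier R" for x
    proof -
      obtain t where "t \<in> carrier X" "x = cls t" using x unfolding R_simps(1) by blast
      then show ?thesis using det[OF \<open>?P \<rho>\<close>] det[OF \<open>?P \<rho>'\<close>] by simp
    qed
  qed (use that in blast)+
  have "\<exists>!\<rho>. ?P \<rho>" by (rule ex1I[of ?P, OF ex]) (rule uniq[OF _ ex])
  from theI'[OF this] have P: "?P (regular_rep T \<Gamma> p)" unfolding regular_rep_def .
  show "regular_rep T \<Gamma> p \<in> carrier (hom_vs R (hom_vs T T))" using P by blast
  show "t \<in> carrier X \<Longrightarrow> regular_rep T \<Gamma> p (cls t) = rep t" by (rule det[OF P])
qed

text \<open>The \<open>E \<otimes> E\<close> component of \<open>Phi\<close> is surjective and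
  \<open>J\<close> is injective, so the image of the regular representation has the dimension of the
  image of \<open>Theta\<close>. Rank-nullity on the operator rng then gives the defect, with
  \<open>vdim_R\<close> supplying the total.\<close>

lemma fdvs_T_defect: "fdvs (T_defect E W \<mu>)"
  and vdim_T_defect:
    "vdim (T_defect E W \<mu>) + rank_Theta E W \<mu> + rank_B E W \<mu> = vdim E ^ 2 + 2 * vdim E * vdim W"
proof -
  let ?\<rho> = "regular_rep T \<Gamma> p"
  note rl = hom_vs_lin[OF regular_rep(1)]
  let ?K = "{x \<in> carrier R. ?\<rho> x = \<zero>\<^bsub>hom_vs T T\<^esub>}"
  have "mod_hom class_ring R (hom_vs T T) ?\<rho>"
    using linear_mapI[OF vR vTT rl] by (simp add: linear_map_def)
  then have D: "T_defect E W \<mu> = R\<lparr>carrier := ?K\<rparr>"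
    unfolding T_defect_def operator_defect_def by (simp add: mod_hom.ker_def)
  have "subsp {x \<in> carrier R. ?\<rho> x \<in> {\<zero>\<^bsub>hom_vs T T\<^esub>}} R"
    by (rule subsp_vimage[OF rl vR vTT subsp_zero[OF vTT]])
  then show "fdvs (T_defect E W \<mu>)" unfolding D using subsp_fdvs(1)[OF vdim_R(1)] by simp
  have \<kappa>: "(\<lambda>t. fst (Phi t)) ` carrier X = carrier EE"
  proof (intro equalityI subsetI)
    show "u \<in> carrier EE" if "u \<in> (\<lambda>t. fst (Phi t)) ` carrier X" for u
      using that lin_closed[OF lin_comp[OF Phi(1) lin_fst]] by blast
    show "u \<in> (\<lambda>t. fst (Phi t)) ` carrier X" if "u \<in> carrier EE" for u
    proof -
      have "(u, \<zero>\<^bsub>BB\<^esub>) \<in> Phi ` carrier X" using that unfolding Phi_surj by (simp add: v_tensors)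
      then obtain t where t: "(u, \<zero>\<^bsub>BB\<^esub>) = Phi t" "t \<in> carrier X" by (rule imageE)
      show ?thesis by (rule image_eqI[OF _ t(2)]) (simp flip: t(1))
    qed
  qed
  have "rep ` carrier X = J ` Theta E W \<mu> ` (\<lambda>t. fst (Phi t)) ` carrier X"
    unfolding image_image rep_def ..
  then have "rep ` carrier X = J ` Theta E W \<mu> ` carrier EE" unfolding \<kappa> .
  moreover have "?\<rho> ` carrier R = rep ` carrier X"
    unfolding R_simps(1) using regular_rep(2) by (auto simp: image_image)
  moreover have "vdim (hom_vs T T\<lparr>carrier := J ` Theta E W \<mu> ` carrier EE\<rparr>) =
      vdim (hom_vs E W\<lparr>carrier := Theta E W \<mu> ` carrier EE\<rparr>)"
    using lin_closed[OF Theta_lin[OF mu]]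
    by (intro vdim_image_inj[OF J_lin fd_tensors(7) vTT subsp_range[OF Theta_lin[OF mu] v_tensors(1,7)]] J_inj) auto
  ultimately have "rank_Theta E W \<mu> + vdim (T_defect E W \<mu>) = vdim R"
    using rank_nullity[OF rl vdim_R(1) vTT] unfolding D rank_Theta_def rank_of_def by simp
  then show "vdim (T_defect E W \<mu>) + rank_Theta E W \<mu> + rank_B E W \<mu> = vdim E ^ 2 + 2 * vdim E * vdim W"
    using vdim_R(2) vdim_Q by simp
qed

end

section \<open>Semicontinuity of the defect dimension\<close>

context tensor_setting
begin

lemma T_defect:
  assumes "\<mu> \<in> surj_tensor_maps E W"
  shows "fdvs (T_defect E W \<mu>)"
    "vdim (T_defect E W \<mu>) + rank_Theta E W \<mu> + rank_B E W \<mu> = vdim E ^ 2 + 2 * vdim E * vdim W"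
proof -
  interpret surjective_tensor E W \<mu> by unfold_locales (rule assms)
  show "fdvs (T_defect E W \<mu>)"
    "vdim (T_defect E W \<mu>) + rank_Theta E W \<mu> + rank_B E W \<mu> = vdim E ^ 2 + 2 * vdim E * vdim W"
    by (rule fdvs_T_defect vdim_T_defect)+
qed

lemma upper_semicontinuous_defect_dim: "upper_semicontinuous (surj_topology E W) (defect_dim E W)"
  unfolding upper_semicontinuous_def topspace_surj
proof
  fix n
  define N where "N = vdim E ^ 2 + 2 * vdim E * vdim W"
  have key: "n \<le> defect_dim E W \<mu> \<longleftrightarrow> n + rank_Theta E W \<mu> + rank_B E W \<mu> \<le> N"
    if "\<mu> \<in> surj_tensor_maps E W" for \<mu>
    using T_defect(2)[OF that] unfolding defect_dim_def N_def by linarith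
  show "closedin (surj_topology E W) {\<mu> \<in> surj_tensor_maps E W. n \<le> defect_dim E W \<mu>}"
  proof (cases "n \<le> N")
    case True
    \<comment> \<open>The defect is at least \<open>n\<close> iff the two ranks sum to at most
      \<open>N - n\<close>. Splitting by an upper bound \<open>a\<close> for the first rank writes
      this as a finite union of closed loci.\<close>
    have "{\<mu> \<in> surj_tensor_maps E W. n \<le> defect_dim E W \<mu>} =
        (\<Union>a\<in>{..N - n}. X_locus E W (int a) (int (N - n - a)))" (is "?A = ?B")
    proof (intro equalityI subsetI)
      fix \<mu> assume "\<mu> \<in> ?A"
      then have "\<mu> \<in> surj_tensor_maps E W" "n + rank_Theta E W \<mu> + rank_B E W \<mu> \<le> N"
        using key by auto
      then show "\<mu> \<in> ?B"
        by (intro UN_I[of "rank_Theta E W \<mu>"]) (auto simp: X_locus_def)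
    next
      fix \<mu> assume "\<mu> \<in> ?B"
      then obtain a where a: "a \<le> N - n" "\<mu> \<in> surj_tensor_maps E W" "rank_Theta E W \<mu> \<le> a"
        "rank_B E W \<mu> \<le> N - n - a" unfolding X_locus_def by auto
      then show "\<mu> \<in> ?A" using key[OF a(2)] True by simp
    qed
    then show ?thesis by (auto intro: closedin_Union closedin_X_locus)
  next
    case False
    \<comment> \<open>No defect exceeds \<open>N\<close>; the case is separate because the
      subtraction \<open>N - n\<close> would be truncated.\<close>
    then have "{\<mu> \<in> surj_tensor_maps E W. n \<le> defect_dim E W \<mu>} = {}" using key by auto
    then show ?thesis by (simp only: closedin_empty)
  qed
qed

end

theorem theorem13p5:
  fixes E :: "('k::field, 'e) module" and W :: "('k, 'w) module" and r s :: nat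
  assumes "vectorspace class_ring E" "vectorspace.fin_dim class_ring E"
      "vectorspace.dim class_ring E = r"
    and "vectorspace class_ring W" "vectorspace.fin_dim class_ring W"
      "vectorspace.dim class_ring W = s"
  shows "openin (zariski (tensor_maps E W)) (surj_tensor_maps E W) \<and>
    (\<forall>a b :: int.
       closedin (surj_topology E W) (X_locus E W a b) \<and>
       (\<forall>g\<in>GL_vs E. \<forall>h\<in>GL_vs W. \<forall>\<mu>\<in>X_locus E W a b. GL_act E W g h \<mu> \<in> X_locus E W a b)) \<and>
    (\<forall>\<mu>\<in>surj_tensor_maps E W.
       vectorspace class_ring (T_defect E W \<mu>) \<and>
       vectorspace.fin_dim class_ring (T_defect E W \<mu>) \<and>
       int (defect_dim E W \<mu>) =
         int r ^ 2 - int (rank_Theta E W \<mu>) + 2 * int r * int s - int (rank_B E W \<mu>)) \<and>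
    upper_semicontinuous (surj_topology E W) (defect_dim E W) \<and>
    (\<forall>Z. irreducible_component (surj_topology E W) Z \<longrightarrow>
       (\<exists>U. openin (subtopology (surj_topology E W) Z) U \<and>
            subtopology (surj_topology E W) Z closure_of U = Z \<and>
            (\<exists>d. (\<forall>\<mu>\<in>U. defect_dim E W \<mu> = d) \<and> (\<forall>\<nu>\<in>Z. d \<le> defect_dim E W \<nu>))))"
proof -
  interpret tensor_setting E W
    by unfold_locales (use assms in \<open>auto simp: fdvs_def\<close>)
  have dim: "int (defect_dim E W \<mu>) =
      int r ^ 2 - int (rank_Theta E W \<mu>) + 2 * int r * int s - int (rank_B E W \<mu>)"
    if "\<mu> \<in> surj_tensor_maps E W" for \<mu>
  proof -
    \<comment> \<open>The additive formula on natural numbers is transferred to the integers before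
      the ranks are moved to the other side.\<close>
    have "int (defect_dim E W \<mu>) + int (rank_Theta E W \<mu>) + int (rank_B E W \<mu>) = int (r ^ 2 + 2 * r * s)"
      using T_defect(2)[OF that] assms unfolding defect_dim_def by (metis of_nat_add)
    then show ?thesis by simp
  qed
  show ?thesis
    using openin_surj closedin_X_locus GL_act_X_locus T_defect(1) dim upper_semicontinuous_defect_dim
      upper_semicontinuous_min_on_component[OF upper_semicontinuous_defect_dim]
    unfolding fdvs_def by blast
qed

end
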